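(* Let $X$ be a compact convex set and let $H\subset A_{sa}(X)$ be an intermediate function space on $X$ such that $H^\uparrow$ is determined by extreme points. Then $$\mathcal A_H^s=\{F\cap\operatorname{ext}X: F\text{ is a split face of }X\text{ such that }\lambda_F\in M^s(H)^\uparrow\}.$$
   Context: A compact convex set is a compact convex subset of a (Hausdorff) locally convex real topological vector space; $\operatorname{ext}X$ is the set of its extreme points. $A_c(X)$ is the space of continuous affine real functions on $X$ and $A_b(X)$ the space of bounded affine real functions on $X$ with the supremum norm. An intermediate function space on $X$ is a (norm-)closed linear subspace $H\subset A_b(X)$ with $A_c(X)\subset H$. A family $F$ of bounded functions on $X$ is determined by extreme points if $\inf u(\operatorname{ext}X)\le u\le\sup u(\operatorname{ext}X)$ for every $u\in F$. $F^\uparrow$ is the set of pointwise limits of bounded non-decreasing sequences from $F$. $M_1(X)$ is the set of (complete) Radon probability measures on $X$; $r(\mu)\in X$ is the barycenter of $\mu\in M_1(X)$, i.e. $a(r(\mu))=\int a\,d\mu$ for all $a\in A_c(X)$. For $\mu,\nu\in M_1(X)$, $\mu\prec\nu$ means $\int f\,d\mu\le\int f\,d\nu$ for every convex continuous $f:X\to\mathbb R$; $\mu$ is maximal if it is maximal with respect to $\prec$. $A_{sa}(X)$ is the space of strongly affine functions: functions $f:X\to\mathbb R$ measurable with respect to every $\mu\in M_1(X)$ and satisfying $\int f\,d\mu=f(r(\mu))$ for each $\mu\in M_1(X)$. A set $A\subset X$ is extremal if $y,z\in A$ whenever $y,z\in X$ and $\frac12(y+z)\in A$; a face is a convex extremal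 set. For a face $A$, the complementary set $A'$ is the union of all faces disjoint from $A$. A face $A$ is split if $A'$ is convex and for each $x\in X\setminus(A\cup A')$ there is a unique $\lambda\in(0,1)$ and a unique pair $a\in A$, $a'\in A'$ with $x=\lambda a+(1-\lambda)a'$. For a split face $A$, $\lambda_A:X\to[0,1]$ is the affine function assigning to $x\in X\setminus(A\cup A')$ this $\lambda$, with $\lambda_A=1$ on $A$ and $\lambda_A=0$ on $A'$. Strong multipliers: $M^s(H)=\{u\in H:\forall a\in H\ \exists b\in H\colon b=u\cdot a\ \mu\text{-almost everywhere for each maximal }\mu\in M_1(X)\}$, and $\mathcal A_H^s=\{[m>0]\cap\operatorname{ext}X:m\in M^s(H)\}$, where $[m>0]=\{x\in X:m(x)>0\}$. *)

theory Defs
  imports "HOL-Analysis.Analysis"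
begin

section \<open>Compact convex sets and spaces of affine functions\<close>

text \<open>
  Hausdorff locally convex real topological vector spaces. The last conjunct is
  \<^term>\<open>convex V\<close> unfolded, since \<^const>\<open>convex\<close> is not available inside a class specification.
\<close>

class locally_convex_space = real_vector + topological_ab_group_add + t2_space +
  assumes tendsto_scaleR_pair:
    "LIM p (nhds c \<times>\<^sub>F nhds x). fst p *\<^sub>R snd p :> nhds (c *\<^sub>R x)"
  and locally_convex:
    "open U \<Longrightarrow> 0 \<in> U \<Longrightarrow> \<exists>V. open V \<and> 0 \<in> V \<and> V \<subseteq> U \<and>
      (\<forall>x\<in>V. \<forall>y\<in>V. \<forall>u\<ge>0. \<forall>v\<ge>0. u + v = 1 \<longrightarrow> u *\<^sub>R x + v *\<^sub>R y \<in> V)"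

definition ext :: "'a::real_vector set \<Rightarrow> 'a set"
  where "ext X = {x. x extreme_point_of X}"

definition affine_on :: "'a::real_vector set \<Rightarrow> ('a \<Rightarrow> real) \<Rightarrow> bool"
  where "affine_on X f \<longleftrightarrow>
    (\<forall>x\<in>X. \<forall>y\<in>X. \<forall>t\<in>{0..1}. f (t *\<^sub>R x + (1 - t) *\<^sub>R y) = t * f x + (1 - t) * f y)"

text \<open>
  A real function on \<open>X\<close> is represented by the unique element of \<^term>\<open>extensional X\<close>
  with these values on \<open>X\<close>, so that a set of such elements is exactly a set of functions
  on \<open>X\<close>.
\<close>

definition continuous_affine :: "'a::{real_vector, topological_space} set \<Rightarrow> ('a \<Rightarrow> real) set"
  where "continuous_affine X = {f \<in> extensional X. affine_on X f \<and> continuous_on X f}"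

definition bounded_affine :: "'a::real_vector set \<Rightarrow> ('a \<Rightarrow> real) set"
  where "bounded_affine X = {f \<in> extensional X. affine_on X f \<and> bounded (f ` X)}"

definition function_subspace :: "'a set \<Rightarrow> ('a \<Rightarrow> real) set \<Rightarrow> bool"
  where "function_subspace X H \<longleftrightarrow>
    (\<lambda>x\<in>X. 0) \<in> H \<and>
    (\<forall>f\<in>H. \<forall>g\<in>H. (\<lambda>x\<in>X. f x + g x) \<in> H) \<and>
    (\<forall>c. \<forall>f\<in>H. (\<lambda>x\<in>X. c * f x) \<in> H)"

text \<open>The last conjunct is closedness in the supremum norm, i.e. under uniform convergence.\<close>

definition intermediate_function_space ::
    "'a::{real_vector, topological_space} set \<Rightarrow> ('a \<Rightarrow> real) set \<Rightarrow> bool"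
  where "intermediate_function_space X H \<longleftrightarrow>
    H \<subseteq> bounded_affine X \<and> continuous_affine X \<subseteq> H \<and> function_subspace X H \<and>
    (\<forall>h. \<forall>f\<in>bounded_affine X.
      (\<forall>n. h n \<in> H) \<and> uniform_limit X h f sequentially \<longrightarrow> f \<in> H)"

definition determined_by_extreme_points :: "'a::real_vector set \<Rightarrow> ('a \<Rightarrow> real) set \<Rightarrow> bool"
  where "determined_by_extreme_points X F \<longleftrightarrow>
    (\<forall>u\<in>F. \<forall>x\<in>X. (INF y\<in>ext X. u y) \<le> u x \<and> u x \<le> (SUP y\<in>ext X. u y))"

definition monotone_limits :: "'a set \<Rightarrow> ('a \<Rightarrow> real) set \<Rightarrow> ('a \<Rightarrow> real) set"
  where "monotone_limits X F = {f \<in> extensional X. \<exists>h.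
    (\<forall>n::nat. h n \<in> F) \<and>
    (\<exists>C. \<forall>n. \<forall>x\<in>X. \<bar>h n x\<bar> \<le> C) \<and>
    (\<forall>n. \<forall>x\<in>X. h n x \<le> h (Suc n) x) \<and>
    (\<forall>x\<in>X. (\<lambda>n. h n x) \<longlonglongrightarrow> f x)}"


section \<open>Radon probability measures and strongly affine functions\<close>

text \<open>
  Radon measures are complete: the \<open>\<sigma>\<close>-algebra contains the Borel sets of \<open>X\<close>. Completeness and
  inner regularity on all measurable sets force it to be the completion of the Borel
  \<open>\<sigma>\<close>-algebra, so equality of two such measures is equality of their Borel restrictions.
\<close>

definition radon_probabilities :: "'a::t2_space set \<Rightarrow> 'a measure set"
  where "radon_probabilities X = {\<mu>.
    emeasure \<mu> (space \<mu>) = 1 \<and> space \<mu> = X \<and> complete_measure \<mu> \<and>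
    sets (restrict_space borel X) \<subseteq> sets \<mu> \<and>
    (\<forall>A\<in>sets \<mu>. emeasure \<mu> A = (SUP K\<in>{K. compact K \<and> K \<subseteq> A}. emeasure \<mu> K))}"

definition barycenter :: "'a::{real_vector, t2_space} set \<Rightarrow> 'a measure \<Rightarrow> 'a"
  where "barycenter X \<mu> =
    (THE x. x \<in> X \<and> (\<forall>a\<in>continuous_affine X. a x = integral\<^sup>L \<mu> a))"

definition choquet_le :: "'a::{real_vector, t2_space} set \<Rightarrow> 'a measure \<Rightarrow> 'a measure \<Rightarrow> bool"
  where "choquet_le X \<mu> \<nu> \<longleftrightarrow>
    (\<forall>f. convex_on X f \<and> continuous_on X f \<longrightarrow> integral\<^sup>L \<mu> f \<le> integral\<^sup>L \<nu> f)"

definition maximal_measure :: "'a::{real_vector, t2_space} set \<Rightarrow> 'a measure \<Rightarrow> bool"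
  where "maximal_measure X \<mu> \<longleftrightarrow> \<mu> \<in> radon_probabilities X \<and>
    (\<forall>\<nu>\<in>radon_probabilities X. choquet_le X \<mu> \<nu> \<longrightarrow> \<nu> = \<mu>)"

text \<open>\<^const>\<open>integrable\<close> includes measurability with respect to \<open>\<mu>\<close>.\<close>

definition strongly_affine :: "'a::{real_vector, t2_space} set \<Rightarrow> ('a \<Rightarrow> real) set"
  where "strongly_affine X = {f \<in> extensional X.
    \<forall>\<mu>\<in>radon_probabilities X. integrable \<mu> f \<and> integral\<^sup>L \<mu> f = f (barycenter X \<mu>)}"


section \<open>Split faces\<close>

definition extremal :: "'a::real_vector set \<Rightarrow> 'a set \<Rightarrow> bool"
  where "extremal X A \<longleftrightarrow> A \<subseteq> X \<and>
    (\<forall>y\<in>X. \<forall>z\<in>X. (1/2) *\<^sub>R (y + z) \<in> A \<longrightarrow> y \<in> A \<and> z \<in> A)"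

definition face :: "'a::real_vector set \<Rightarrow> 'a set \<Rightarrow> bool"
  where "face X A \<longleftrightarrow> extremal X A \<and> convex A"

definition complementary_set :: "'a::real_vector set \<Rightarrow> 'a set \<Rightarrow> 'a set"
  where "complementary_set X A = \<Union>{B. face X B \<and> B \<inter> A = {}}"

definition split_decomposition ::
    "'a::real_vector set \<Rightarrow> 'a set \<Rightarrow> 'a \<Rightarrow> real \<Rightarrow> 'a \<Rightarrow> 'a \<Rightarrow> bool"
  where "split_decomposition X A x l a a' \<longleftrightarrow>
    l \<in> {0<..<1} \<and> a \<in> A \<and> a' \<in> complementary_set X A \<and> x = l *\<^sub>R a + (1 - l) *\<^sub>R a'"

definition split_face :: "'a::real_vector set \<Rightarrow> 'a set \<Rightarrow> bool"
  where "split_face X A \<longleftrightarrow> face X A \<and> convex (complementary_set X A) \<and>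
    (\<forall>x \<in> X - (A \<union> complementary_set X A).
      \<exists>!p. case p of (l, a, a') \<Rightarrow> split_decomposition X A x l a a')"

definition split_function :: "'a::real_vector set \<Rightarrow> 'a set \<Rightarrow> 'a \<Rightarrow> real"
  where "split_function X A = (\<lambda>x\<in>X.
    if x \<in> A then 1
    else if x \<in> complementary_set X A then 0
    else (THE l. \<exists>a a'. split_decomposition X A x l a a'))"


section \<open>Strong multipliers\<close>

definition strong_multipliers ::
    "'a::{real_vector, t2_space} set \<Rightarrow> ('a \<Rightarrow> real) set \<Rightarrow> ('a \<Rightarrow> real) set"
  where "strong_multipliers X H = {u \<in> H. \<forall>a\<in>H. \<exists>b\<in>H. \<forall>\<mu>.
    maximal_measure X \<mu> \<longrightarrow> (AE x in \<mu>. b x = u x * a x)}"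

definition strong_multiplier_sets ::
    "'a::{real_vector, t2_space} set \<Rightarrow> ('a \<Rightarrow> real) set \<Rightarrow> 'a set set"
  where "strong_multiplier_sets X H =
    {{x \<in> X. m x > 0} \<inter> ext X | m. m \<in> strong_multipliers X H}"

end

theory Submission
  imports Defs
begin

text \<open>
  Strong multipliers are closed under \<open>m \<mapsto> \<phi> \<circ> m\<close> for continuous \<open>\<phi>\<close>, the composition being
  taken almost everywhere for all maximal measures: this is clear for polynomials, and uniform
  approximation on \<open>ext X\<close> suffices because \<open>H\<close> is determined by extreme points.

  Given a multiplier \<open>m\<close>, let \<open>f\<close> be the increasing limit of the multipliers
  \<open>w\<^sub>n = min 1 (n m\<^sup>+)\<close>. It is strongly affine and equals the indicator of \<open>[m > 0]\<close> almost everywhere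
  for maximal measures. If \<open>\<mu>\<close> is maximal with barycenter \<open>x\<close>, then conditioning \<open>\<mu>\<close> on
  \<open>[f = 1]\<close> and \<open>[f = 0]\<close> writes \<open>x\<close> as a convex combination of points of these two faces; the products
  \<open>w\<^sub>n \<cdot> c\<close> with continuous affine \<open>c\<close> show that the decomposition is unique. Conversely, if
  multipliers \<open>h\<^sub>n\<close> increase to \<open>\<lambda>\<^sub>F\<close>, then \<open>m = \<Sum>\<^sub>n 2\<^sup>-\<^sup>n h\<^sub>n\<^sup>+\<close> is positive exactly at the extreme
  points in \<open>F\<close>.

  Maximal measures with a prescribed barycenter come from Zorn's lemma. The limit of a Choquet-increasing
  chain exists on convex continuous functions by monotonicity, on all continuous functions since
  the functions \<open>exp \<circ> a\<close> with \<open>a\<close> continuous affine span a dense algebra, and is a measure by Riesz.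
\<close>


section \<open>The Riesz representation theorem on a compact space\<close>

text \<open>The obstacle is that \<open>H\<close> is in general neither a lattice nor an algebra:
  products and truncations of its elements are available only up to sets that are null for all
  maximal measures. Two facts make such identities usable. A maximal measure whose barycenter is an
  extreme point is concentrated there, so the identities hold at every extreme point; and because
  \<open>H\<close> is determined by extreme points, inequalities and uniform estimates checked on
  \<open>ext X\<close> hold on all of \<open>X\<close>.

  At other points no pointwise identity is known, and the limit \<open>f\<close> may well take
  values strictly between 0 and 1. There the maximal measures enter a second time: for them
  \<open>f\<close> is almost everywhere 0 or 1, so the mass of \<open>[f = 1]\<close> is the
  integral of \<open>f\<close>, which strong affinity identifies with the value of \<open>f\<close>
  at the barycenter. This is why conditioning produces a decomposition with exactly the weight
  \<open>f x\<close>.\<close>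

lemma Urysohn_compact:
  fixes X :: "'a::t2_space set"
  assumes "compact X" "closed A" "closed B" "A \<inter> B \<inter> X = {}"
  obtains g :: "'a \<Rightarrow> real" where "continuous_on X g" "\<forall>x\<in>X. 0 \<le> g x \<and> g x \<le> 1"
    "\<forall>x\<in>X \<inter> A. g x = 1" "\<forall>x\<in>X \<inter> B. g x = 0"
proof -
  let ?T = "top_of_set X"
  have "Hausdorff_space (euclidean :: 'a topology)"
    unfolding Hausdorff_space_def disjnt_def by simp (meson hausdorff)
  then have "compact_space ?T" "Hausdorff_space ?T"
    using assms(1) by (simp_all add: compact_space_subtopology Hausdorff_space_subtopology)
  then have "normal_space ?T"
    by (simp add: compact_Hausdorff_or_regular_imp_normal_space)
  moreover have "closedin ?T (X \<inter> B)" "closedin ?T (X \<inter> A)"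
    using assms(2,3) by (auto simp: closedin_closed_Int)
  moreover have "disjnt (X \<inter> B) (X \<inter> A)" using assms(4) by (auto simp: disjnt_def)
  moreover have "(0::real) \<le> 1" by simp
  ultimately obtain f where f: "continuous_map ?T (top_of_set {0..1::real}) f"
    "f ` (X \<inter> B) \<subseteq> {0}" "f ` (X \<inter> A) \<subseteq> {1}"
    by (rule Urysohn_lemma)
  show thesis
  proof (rule that[of f])
    show "continuous_on X f" using f(1) by (auto simp: continuous_map_in_subtopology)
    show "\<forall>x\<in>X. 0 \<le> f x \<and> f x \<le> 1"
      using f(1) by (auto simp: continuous_map_in_subtopology Pi_iff)
  qed (use f in auto)
qed

lemma continuous_on_superlevel_closed:
  fixes f :: "'a::t2_space \<Rightarrow> real"
  assumes "compact X" "continuous_on X f"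
  shows "closed {x \<in> X. c \<le> f x}"
proof -
  have "closed (X \<inter> f -` {c..})"
    using assms compact_imp_closed by (intro continuous_closed_preimage) auto
  also have "X \<inter> f -` {c..} = {x \<in> X. c \<le> f x}" by auto
  finally show ?thesis .
qed

text \<open>\<open>L\<close> acts on all functions but is constrained only on those continuous on
  \<open>X\<close>. Continuous functions that agree on \<open>X\<close> get the same value by
  \<open>mono\<close> used twice, so values off \<open>X\<close> never matter.\<close>

locale positive_functional =
  fixes X :: "'a::t2_space set" and L :: "('a \<Rightarrow> real) \<Rightarrow> real"
  assumes compact: "compact X"
    and add: "\<lbrakk>continuous_on X f; continuous_on X g\<rbrakk> \<Longrightarrow> L (\<lambda>x. f x + g x) = L f + L g"
    and cmult: "continuous_on X f \<Longrightarrow> L (\<lambda>x. c * f x) = c * L f"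
    and nonneg: "\<lbrakk>continuous_on X f; \<And>x. x \<in> X \<Longrightarrow> 0 \<le> f x\<rbrakk> \<Longrightarrow> 0 \<le> L f"
    and one: "L (\<lambda>x. 1) = 1"
begin

lemma diff:
  assumes "continuous_on X f" "continuous_on X g"
  shows "L (\<lambda>x. f x - g x) = L f - L g"
  using add[OF assms(1), of "\<lambda>x. (-1) * g x"] cmult[OF assms(2), of "-1"] assms(2)
  by (simp add: continuous_on_minus)

lemma mono:
  assumes "continuous_on X f" "continuous_on X g" "\<And>x. x \<in> X \<Longrightarrow> f x \<le> g x"
  shows "L f \<le> L g"
  using nonneg[of "\<lambda>x. g x - f x"] diff[OF assms(2,1)] assms by (simp add: continuous_on_diff)

lemma const: "L (\<lambda>x. c) = c"
  using cmult[of "\<lambda>x. 1" c] one by simp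

lemma sum:
  assumes "finite I" "\<And>i. i \<in> I \<Longrightarrow> continuous_on X (f i)"
  shows "L (\<lambda>x. \<Sum>i\<in>I. f i x) = (\<Sum>i\<in>I. L (f i))"
  using assms by (induction I) (auto simp: const add continuous_on_sum)

section \<open>The content of open sets\<close>

definition below :: "'a set \<Rightarrow> ('a \<Rightarrow> real) set"
  where "below U = {f. continuous_on X f \<and> (\<forall>x\<in>X. 0 \<le> f x \<and> f x \<le> indicator U x)}"

lemma belowI:
  assumes "continuous_on X f" "\<And>x. x \<in> X \<Longrightarrow> 0 \<le> f x \<and> f x \<le> 1" "\<And>x. x \<in> X \<Longrightarrow> x \<notin> U \<Longrightarrow> f x = 0"
  shows "f \<in> below U"
  using assms by (auto simp: below_def indicator_def)

lemma belowD:
  assumes "f \<in> below U"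
  shows "continuous_on X f" "x \<in> X \<Longrightarrow> 0 \<le> f x" "x \<in> X \<Longrightarrow> f x \<le> 1"
    "x \<in> X \<Longrightarrow> x \<notin> U \<Longrightarrow> f x = 0"
proof -
  show "continuous_on X f" using assms by (simp add: below_def)
  assume x: "x \<in> X"
  then have *: "0 \<le> f x" "f x \<le> indicator U x" using assms by (auto simp: below_def)
  then show "0 \<le> f x" by simp
  have "indicator U x \<le> (1::real)" by (rule indicator_le_1)
  then show "f x \<le> 1" using * by linarith
  show "f x = 0" if "x \<notin> U" using * that by simp
qed

definition content :: "'a set \<Rightarrow> ennreal"
  where "content U = (SUP f\<in>below U. ennreal (L f))"

lemma zero_in_below: "(\<lambda>x. 0) \<in> below U"
  by (simp add: below_def)

lemma content_upper: "f \<in> below U \<Longrightarrow> L f \<le> content U"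
  unfolding content_def by (rule SUP_upper)

lemma content_mono: "U \<inter> X \<subseteq> V \<Longrightarrow> content U \<le> content V"
  unfolding content_def
proof (rule SUP_subset_mono)
  assume *: "U \<inter> X \<subseteq> V"
  have "indicator U x \<le> (indicator V x :: real)" if "x \<in> X" for x
    using * that by (auto simp: indicator_def)
  then show "below U \<subseteq> below V" unfolding below_def by force
qed auto

lemma content_le_1: "content U \<le> 1"
  unfolding content_def
proof (rule SUP_least)
  fix f assume "f \<in> below U"
  then have "L f \<le> L (\<lambda>x. 1)"
    by (intro mono) (auto simp: below_def intro: order_trans[OF _ indicator_le_1])
  then show "ennreal (L f) \<le> 1" by (simp add: one)
qed

lemma content_empty: "U \<inter> X = {} \<Longrightarrow> content U = 0"
proof -
  assume *: "U \<inter> X = {}"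
  have "L f \<le> 0" if "f \<in> below U" for f
  proof -
    have "L f \<le> L (\<lambda>x. 0)"
      using belowD(1,4)[OF that] * by (intro mono) force+
    then show ?thesis by (simp add: const)
  qed
  then have "content U \<le> 0" unfolding content_def
    by (intro SUP_least) (simp add: ennreal_neg)
  then show ?thesis by simp
qed

lemma content_UNIV: "X \<subseteq> U \<Longrightarrow> content U = 1"
proof (rule antisym[OF content_le_1])
  assume "X \<subseteq> U"
  then have "(\<lambda>x. 1) \<in> below U" by (auto intro: belowI)
  then show "1 \<le> content U" using content_upper one by fastforce
qed

text \<open>A function in \<open>below U\<close> vanishes off \<open>U\<close>, but its support may
  reach the boundary of \<open>U\<close>. Subtracting \<open>e\<close> and cutting off at 0 confines
  it to the closed set where \<open>f \<ge> e\<close>; since \<open>L\<close> is normalised, this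
  costs at most \<open>e\<close>.\<close>

lemma below_clip:
  assumes "f \<in> below U" "0 < e" "\<And>x. x \<in> X \<Longrightarrow> e \<le> f x \<Longrightarrow> x \<in> V"
  shows "(\<lambda>x. max (f x - e) 0) \<in> below V" "L f \<le> L (\<lambda>x. max (f x - e) 0) + e"
proof -
  have c: "continuous_on X f" and f: "\<And>x. x \<in> X \<Longrightarrow> 0 \<le> f x \<and> f x \<le> 1"
    using belowD[OF assms(1)] by auto
  have c': "continuous_on X (\<lambda>x. max (f x - e) 0)" using c by (intro continuous_intros)
  then show "(\<lambda>x. max (f x - e) 0) \<in> below V"
    using f assms(2,3) by (intro belowI) force+
  have "L f \<le> L (\<lambda>x. max (f x - e) 0 + e)"
    using c by (intro mono) (auto intro!: continuous_intros)
  also have "\<dots> = L (\<lambda>x. max (f x - e) 0) + e" by (subst add[OF c']) (auto simp: const)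
  finally show "L f \<le> L (\<lambda>x. max (f x - e) 0) + e" .
qed

text \<open>A two-piece partition of unity: where \<open>f \<ge> e\<close>, the part missing
  \<open>V\<close> and the part missing \<open>U\<close> are disjoint closed sets. A Urysohn
  function \<open>g\<close> between them splits the clipped function \<open>h\<close> into
  \<open>h * g\<close>, vanishing off \<open>U\<close>, and \<open>h * (1 - g)\<close>, vanishing
  off \<open>V\<close>.\<close>

lemma content_Un:
  assumes "open U" "open V"
  shows "content (U \<union> V) \<le> content U + content V"
  unfolding content_def[of "U \<union> V"]
proof (rule SUP_least)
  fix f assume f: "f \<in> below (U \<union> V)"
  show "ennreal (L f) \<le> content U + content V"
  proof (rule ennreal_le_epsilon)
    fix e :: real assume e: "0 < e"
    have fc: "continuous_on X f" using f by (simp add: below_def)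
    let ?K = "{x \<in> X. e \<le> f x}"
    have K: "closed ?K" by (rule continuous_on_superlevel_closed[OF compact fc])
    have KUV: "?K \<subseteq> U \<union> V"
      using belowD(4)[OF f] e by force
    have "closed (?K - V)" "closed (?K - U)" using K assms by (auto intro: closed_Diff)
    moreover have "(?K - V) \<inter> (?K - U) \<inter> X = {}" using KUV by blast
    ultimately obtain g :: "'a \<Rightarrow> real" where g: "continuous_on X g" "\<forall>x\<in>X. 0 \<le> g x \<and> g x \<le> 1"
      "\<forall>x\<in>X \<inter> (?K - V). g x = 1" "\<forall>x\<in>X \<inter> (?K - U). g x = 0"
      by (rule Urysohn_compact[OF compact])
    define h where "h = (\<lambda>x. max (f x - e) 0)"
    have "h \<in> below UNIV" unfolding h_def by (rule below_clip(1)[OF f e]) simp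
    then have h: "continuous_on X h" "\<And>x. x \<in> X \<Longrightarrow> 0 \<le> h x \<and> h x \<le> 1" by (auto dest: belowD)
    have hK: "\<And>x. x \<in> X \<Longrightarrow> h x \<noteq> 0 \<Longrightarrow> x \<in> ?K" by (auto simp: h_def max_def split: if_splits)
    have Lf: "L f \<le> L h + e" unfolding h_def by (rule below_clip(2)[OF f e]) simp
    have le1: "h x * g x \<le> 1" "h x * (1 - g x) \<le> 1" if "x \<in> X" for x
      using h(2)[OF that] g(2) that by (auto intro: mult_le_one)
    have 1: "(\<lambda>x. h x * g x) \<in> below U"
    proof -
      have "h x * g x = 0" if "x \<in> X" "x \<notin> U" for x
        using g(4) hK[of x] that by auto
      then show ?thesis using h g le1 by (intro belowI) (auto intro!: continuous_intros)
    qed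
    have 2: "(\<lambda>x. h x * (1 - g x)) \<in> below V"
    proof -
      have "h x * (1 - g x) = 0" if "x \<in> X" "x \<notin> V" for x
        using g(3) hK[of x] that by auto
      then show ?thesis using h g le1 by (intro belowI) (auto intro!: continuous_intros)
    qed
    have "L h = L (\<lambda>x. h x * g x + h x * (1 - g x))"
      by (rule arg_cong[where f=L]) (auto simp: algebra_simps)
    also have "\<dots> = L (\<lambda>x. h x * g x) + L (\<lambda>x. h x * (1 - g x))"
      by (rule add) (auto intro!: continuous_intros h g)
    finally have *: "L f \<le> L (\<lambda>x. h x * g x) + L (\<lambda>x. h x * (1 - g x)) + e" using Lf by simp
    have "0 \<le> L (\<lambda>x. h x * g x)" "0 \<le> L (\<lambda>x. h x * (1 - g x))"
      using 1 2 by (auto intro: nonneg simp: below_def)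
    then have "ennreal (L f) \<le> ennreal (L (\<lambda>x. h x * g x)) + ennreal (L (\<lambda>x. h x * (1 - g x))) + ennreal e"
      using * e by (simp flip: ennreal_plus)
    also have "\<dots> \<le> content U + content V + ennreal e"
      by (intro add_mono content_upper 1 2 order_refl)
    finally show "ennreal (L f) \<le> content U + content V + ennreal e" .
  qed
qed

lemma content_finite_UN:
  assumes "finite I" "\<And>i. i \<in> I \<Longrightarrow> open (U i)"
  shows "content (\<Union>i\<in>I. U i) \<le> (\<Sum>i\<in>I. content (U i))"
  using assms
proof (induction I)
  case (insert i I)
  have "content (U i \<union> (\<Union>i\<in>I. U i)) \<le> content (U i) + content (\<Union>i\<in>I. U i)"
    using insert by (intro content_Un) auto
  also have "\<dots> \<le> content (U i) + (\<Sum>i\<in>I. content (U i))"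
    using insert by (intro add_left_mono) auto
  finally show ?case using insert by simp
qed (simp add: content_empty)

text \<open>The set where \<open>f \<ge> e\<close> is compact, so finitely many \<open>U i\<close>
  cover it and the finite case applies to the clipped function.\<close>

lemma content_UN:
  fixes U :: "nat \<Rightarrow> 'a set"
  assumes "\<And>i. open (U i)"
  shows "content (\<Union>i. U i) \<le> (\<Sum>i. content (U i))"
  unfolding content_def[of "\<Union>i. U i"]
proof (rule SUP_least)
  fix f assume f: "f \<in> below (\<Union>i. U i)"
  show "ennreal (L f) \<le> (\<Sum>i. content (U i))"
  proof (rule ennreal_le_epsilon)
    fix e :: real assume e: "0 < e"
    have fc: "continuous_on X f" using f by (simp add: below_def)
    let ?K = "{x \<in> X. e \<le> f x}"
    have "compact (X \<inter> ?K)"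
      by (intro compact_Int_closed compact continuous_on_superlevel_closed fc)
    moreover have "X \<inter> ?K \<subseteq> (\<Union>i\<in>UNIV. U i)"
      using belowD(4)[OF f] e by force
    ultimately obtain I where I: "finite I" "X \<inter> ?K \<subseteq> (\<Union>i\<in>I. U i)"
      using compactE_image[of "X \<inter> ?K" UNIV U] assms by metis
    have h: "(\<lambda>x. max (f x - e) 0) \<in> below (\<Union>i\<in>I. U i)"
      by (rule below_clip[OF f e]) (use I in auto)
    then have "0 \<le> L (\<lambda>x. max (f x - e) 0)" by (auto intro: nonneg simp: below_def)
    then have "ennreal (L f) \<le> ennreal (L (\<lambda>x. max (f x - e) 0)) + ennreal e"
      using below_clip(2)[OF f e, of UNIV] e by (simp flip: ennreal_plus)
    also have "ennreal (L (\<lambda>x. max (f x - e) 0)) \<le> (\<Sum>i\<in>I. content (U i))"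
      using content_upper[OF h] content_finite_UN[of I U] I assms by (meson order_trans)
    also have "\<dots> \<le> (\<Sum>i. content (U i))" by (rule sum_le_suminf) (use I in auto)
    finally show "ennreal (L f) \<le> (\<Sum>i. content (U i)) + ennreal e" by simp
  qed
qed

section \<open>Outer measure and Caratheodory measurable sets\<close>

definition outer :: "'a set \<Rightarrow> ennreal"
  where "outer A = (INF U\<in>{U. open U \<and> A \<subseteq> U}. content U)"

lemma outer_mono: "A \<subseteq> B \<Longrightarrow> outer A \<le> outer B"
  unfolding outer_def by (rule INF_superset_mono) auto

lemma outer_open: "open U \<Longrightarrow> outer (U \<inter> X) = content U"
proof (rule antisym)
  assume U: "open U"
  then show "outer (U \<inter> X) \<le> content U" unfolding outer_def by (intro INF_lower) auto
  show "content U \<le> outer (U \<inter> X)"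
    unfolding outer_def by (intro INF_greatest content_mono) auto
qed

lemma outer_le_content: "open U \<Longrightarrow> A \<subseteq> U \<Longrightarrow> outer A \<le> content U"
  unfolding outer_def by (intro INF_lower) auto

lemma outer_approx:
  assumes "0 < (e::ennreal)"
  shows "\<exists>U. open U \<and> A \<subseteq> U \<and> content U < outer A + e"
proof -
  have "outer A \<le> 1" using outer_le_content[of UNIV A] content_le_1[of UNIV] by simp
  then have "outer A < outer A + e"
    using assms by (metis ennreal_add_left_cancel_less add.right_neutral ennreal_one_less_top order_le_less_trans infinity_ennreal_def less_irrefl)
  then show ?thesis unfolding outer_def INF_less_iff by auto
qed

lemma outer_measure_space_outer: "outer_measure_space (Pow X) outer"
  unfolding outer_measure_space_def
proof (intro conjI)
  show "positive (Pow X) outer"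
    using outer_open[of "{}"] content_empty[of "{}"] by (simp add: positive_def)
  show "increasing (Pow X) outer" by (auto simp: increasing_def outer_mono)
  show "countably_subadditive (Pow X) outer"
    unfolding countably_subadditive_def
  proof safe
    fix A :: "nat \<Rightarrow> 'a set"
    show "outer (\<Union>i. A i) \<le> (\<Sum>i. outer (A i))"
    proof (rule ennreal_le_epsilon)
      fix e :: real assume e: "0 < e"
      have "\<exists>U. open U \<and> A i \<subseteq> U \<and> content U < outer (A i) + ennreal (e * (1/2)^Suc i)" for i
        by (rule outer_approx) (use e in simp)
      then obtain U where U: "\<And>i. open (U i)" "\<And>i. A i \<subseteq> U i"
        "\<And>i. content (U i) < outer (A i) + ennreal (e * (1/2)^Suc i)" by metis
      have "outer (\<Union>i. A i) \<le> content (\<Union>i. U i)"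
        using U by (intro outer_le_content) auto
      also have "\<dots> \<le> (\<Sum>i. content (U i))" by (intro content_UN U)
      also have "\<dots> \<le> (\<Sum>i. outer (A i) + ennreal (e * (1/2)^Suc i))"
        by (intro suminf_le less_imp_le[OF U(3)]) auto
      also have "\<dots> = (\<Sum>i. outer (A i)) + (\<Sum>i. ennreal (e * (1/2)^Suc i))"
        by (subst suminf_add) auto
      also have "(\<Sum>i. ennreal (e * (1/2)^Suc i)) = ennreal e"
        using e sums_mult[OF power_half_series, of e] by (intro suminf_ennreal_eq) auto
      finally show "outer (\<Union>i. A i) \<le> (\<Sum>i. outer (A i)) + ennreal e" .
    qed
  qed
qed

definition msets :: "'a set set" where "msets = lambda_system X (Pow X) outer"

lemma measure_space_outer: "measure_space X msets outer"
proof -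
  interpret sigma_algebra X "Pow X" by (rule sigma_algebra_Pow)
  show ?thesis unfolding msets_def by (rule caratheodory_lemma[OF outer_measure_space_outer])
qed

lemma outer_subadd: "A \<subseteq> X \<Longrightarrow> B \<subseteq> X \<Longrightarrow> A \<inter> B = {} \<Longrightarrow> outer (A \<union> B) \<le> outer A + outer B"
proof -
  interpret sigma_algebra X "Pow X" by (rule sigma_algebra_Pow)
  assume "A \<subseteq> X" "B \<subseteq> X" "A \<inter> B = {}"
  moreover have "subadditive (Pow X) outer"
    using outer_measure_space_outer countably_subadditive_subadditive
    unfolding outer_measure_space_def by metis
  ultimately show ?thesis using subadditiveD[of "Pow X" outer A B] by simp
qed

text \<open>Caratheodory's condition need only be tested on open \<open>W\<close>, against
  \<open>content W\<close>: \<open>outer\<close> is an infimum over open supersets, and the opposite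
  inequality is subadditivity.\<close>

lemma msetsI:
  assumes "B \<subseteq> X" and *: "\<And>W. open W \<Longrightarrow> outer (X \<inter> W \<inter> B) + outer (X \<inter> W - B) \<le> content W"
  shows "B \<in> msets"
proof -
  have "outer (B \<inter> A) + outer ((X - B) \<inter> A) = outer A" if A: "A \<subseteq> X" for A
  proof (rule antisym)
    have "outer A \<le> outer ((B \<inter> A) \<union> ((X - B) \<inter> A))" using A by (intro outer_mono) auto
    also have "\<dots> \<le> outer (B \<inter> A) + outer ((X - B) \<inter> A)"
      using A by (intro outer_subadd) auto
    finally show "outer A \<le> outer (B \<inter> A) + outer ((X - B) \<inter> A)" .
    show "outer (B \<inter> A) + outer ((X - B) \<inter> A) \<le> outer A"
      unfolding outer_def[of A]
    proof (rule INF_greatest)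
      fix W assume W: "W \<in> {U. open U \<and> A \<subseteq> U}"
      have "outer (B \<inter> A) + outer ((X - B) \<inter> A) \<le> outer (X \<inter> W \<inter> B) + outer (X \<inter> W - B)"
        using W A by (intro add_mono outer_mono) auto
      also have "\<dots> \<le> content W" using W * by auto
      finally show "outer (B \<inter> A) + outer ((X - B) \<inter> A) \<le> content W" .
    qed
  qed
  then show ?thesis using assms(1) unfolding msets_def lambda_system_def by auto
qed

text \<open>Clip \<open>f\<close> in \<open>below (U \<inter> W)\<close> to the closed set
  \<open>?K\<close> where \<open>f \<ge> e\<close>. Any \<open>g\<close> in
  \<open>below (W - ?K)\<close> vanishes on \<open>?K\<close>, so the sum of the two is still in
  \<open>below W\<close>. It remains to take suprema over \<open>g\<close> and \<open>f\<close> and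
  to let \<open>e\<close> tend to 0, as \<open>W - ?K\<close> contains
  \<open>X \<inter> W - U\<close>.\<close>

lemma open_in_msets:
  assumes U: "open U" shows "U \<inter> X \<in> msets"
proof (rule msetsI)
  fix W :: "'a set" assume W: "open W"
  have "content (U \<inter> W) + outer (X \<inter> W - U) \<le> content W"
  proof -
    have "ennreal (L f) + outer (X \<inter> W - U) \<le> content W" if f: "f \<in> below (U \<inter> W)" for f
    proof (rule ennreal_le_epsilon)
      fix e :: real assume e: "0 < e"
      have fc: "continuous_on X f" using f by (simp add: below_def)
      let ?K = "{x \<in> X. e \<le> f x}"
      let ?h = "\<lambda>x. max (f x - e) 0"
      have fUW: "f x = 0" if "x \<in> X" "x \<notin> U \<inter> W" for x
        using belowD(4)[OF f] that by auto
      have h: "?h \<in> below (U \<inter> W)" and Lf: "L f \<le> L ?h + e"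
        using below_clip[OF f e, of "U \<inter> W"] fUW e by force+
      have W': "open (W - ?K)" using continuous_on_superlevel_closed[OF compact fc] W by blast
      have "outer (X \<inter> W - U) \<le> content (W - ?K)"
        using fUW e by (intro outer_le_content W') force
      moreover have "ennreal (L ?h) + content (W - ?K) \<le> content W"
      proof -
        have "ennreal (L ?h) + ennreal (L g) \<le> content W" if g: "g \<in> below (W - ?K)" for g
        proof -
          have c: "continuous_on X ?h" "continuous_on X g" using h g by (auto simp: below_def)
          have "(\<lambda>x. ?h x + g x) \<in> below W"
          proof (rule belowI)
            show "continuous_on X (\<lambda>x. ?h x + g x)" by (intro continuous_intros c)
            fix x assume x: "x \<in> X"
            show "0 \<le> ?h x + g x \<and> ?h x + g x \<le> 1"
              using belowD(2-4)[OF g x] belowD(2,3)[OF h x] x by (cases "x \<in> ?K") auto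
            show "?h x + g x = 0" if "x \<notin> W"
              using belowD(4)[OF g x] belowD(4)[OF h x] that by auto
          qed
          then have "ennreal (L (\<lambda>x. ?h x + g x)) \<le> content W" by (rule content_upper)
          moreover have "0 \<le> L ?h" "0 \<le> L g" using h g by (auto intro!: nonneg simp: below_def)
          ultimately show ?thesis by (subst (asm) add[OF c]) (simp only: ennreal_plus)
        qed
        then show ?thesis
          unfolding content_def[of "W - ?K"]
          by (subst ennreal_SUP_add_right) (use zero_in_below in \<open>auto intro!: SUP_least\<close>)
      qed
      ultimately have *: "ennreal (L ?h) + outer (X \<inter> W - U) \<le> content W"
        by (meson add_left_mono order_trans)
      have "0 \<le> L ?h" using h by (auto intro!: nonneg simp: below_def)
      then have "ennreal (L f) \<le> ennreal (L ?h) + ennreal e"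
        using Lf e by (simp flip: ennreal_plus)
      then have "ennreal (L f) + outer (X \<inter> W - U) \<le> (ennreal (L ?h) + outer (X \<inter> W - U)) + ennreal e"
        using add_right_mono[of "ennreal (L f)" "ennreal (L ?h) + ennreal e"] by (simp add: ac_simps)
      also have "\<dots> \<le> content W + ennreal e" using * by (intro add_mono) auto
      finally show "ennreal (L f) + outer (X \<inter> W - U) \<le> content W + ennreal e" .
    qed
    then have "(SUP f\<in>below (U \<inter> W). ennreal (L f) + outer (X \<inter> W - U)) \<le> content W"
      by (intro SUP_least)
    then show ?thesis
      unfolding content_def[of "U \<inter> W"]
      by (subst (asm) ennreal_SUP_add_left) (use zero_in_below in auto)
  qed
  moreover have "outer (X \<inter> W \<inter> (U \<inter> X)) \<le> content (U \<inter> W)"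
    using U W by (intro outer_le_content) auto
  moreover have "X \<inter> W - U \<inter> X = X \<inter> W - U" by auto
  ultimately show "outer (X \<inter> W \<inter> (U \<inter> X)) + outer (X \<inter> W - U \<inter> X) \<le> content W"
    by (metis add_right_mono order_trans)
qed auto

text \<open>The whole Caratheodory sigma-algebra is kept because it is complete, as
  \<open>radon_probabilities\<close> demands.\<close>

definition riesz_measure :: "'a measure"
  where "riesz_measure = measure_of X msets outer"

lemma sigma_algebra_msets: "sigma_algebra X msets"
  using measure_space_outer by (simp add: measure_space_def)

lemma space_riesz [simp]: "space riesz_measure = X"
  and sets_riesz [simp]: "sets riesz_measure = msets"
  using sigma_algebra.sets_measure_of_eq[OF sigma_algebra_msets] sigma_algebra.space_measure_of_eq[OF sigma_algebra_msets]
  by (auto simp: riesz_measure_def)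

lemma emeasure_riesz: "A \<in> msets \<Longrightarrow> emeasure riesz_measure A = outer A"
  unfolding riesz_measure_def
  by (rule emeasure_measure_of_sigma)
    (use measure_space_outer in \<open>auto simp: measure_space_def\<close>)

lemma borel_msets: "sets (restrict_space borel X) \<subseteq> msets"
proof
  fix A assume "A \<in> sets (restrict_space borel X)"
  then obtain B where B: "B \<in> sets borel" "A = B \<inter> X" by (auto simp: sets_restrict_space)
  interpret sigma_algebra X msets by (rule sigma_algebra_msets)
  have "B \<in> sigma_sets UNIV {S. open S}" using B by (simp add: borel_def)
  then have "B \<inter> X \<in> msets"
  proof induction
    case (Basic a) then show ?case using open_in_msets by auto
  next
    case Empty then show ?case by simp
  next
    case (Compl a)
    have "(UNIV - a) \<inter> X = X - a \<inter> X" by auto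
    then show ?case using Compl by (metis compl_sets)
  next
    case (Union a)
    have "(\<Union>i. a i) \<inter> X = (\<Union>i. a i \<inter> X)" by auto
    then show ?case using Union by (metis countable_UN range_subsetD image_subsetI)
  qed
  then show "A \<in> msets" by (simp add: B)
qed

lemma riesz_radon: "riesz_measure \<in> radon_probabilities X"
  unfolding radon_probabilities_def
proof (intro CollectI conjI ballI)
  have Xin: "X \<in> msets" using open_in_msets[of UNIV] by simp
  have X1: "outer X = 1" using outer_open[of UNIV] content_UNIV[of UNIV] by simp
  show 1: "emeasure riesz_measure (space riesz_measure) = 1" by (simp add: emeasure_riesz Xin X1)
  show "space riesz_measure = X" by simp
  show "sets (restrict_space borel X) \<subseteq> sets riesz_measure" using borel_msets by simp
  show "complete_measure riesz_measure"
  proof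
    fix A B assume AB: "B \<subseteq> A" "A \<in> null_sets riesz_measure"
    have A: "A \<in> msets" "outer A = 0"
      using AB(2) by (auto simp: null_sets_def emeasure_riesz)
    have B: "outer B = 0" using outer_mono[OF AB(1)] A by simp
    have "A \<subseteq> X" using A(1) by (auto simp: msets_def lambda_system_def)
    then have "B \<in> msets"
    proof (intro msetsI)
      fix W :: "'a set" assume W: "open W"
      have "outer (X \<inter> W \<inter> B) \<le> outer B" by (intro outer_mono) auto
      moreover have "outer (X \<inter> W - B) \<le> content W" by (intro outer_le_content W) auto
      ultimately show "outer (X \<inter> W \<inter> B) + outer (X \<inter> W - B) \<le> content W" using B by simp
    qed (use AB in auto)
    then show "B \<in> sets riesz_measure" by simp
  qed
  fix A assume A: "A \<in> sets riesz_measure"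
  interpret finite_measure riesz_measure by (rule finite_measureI) (simp add: 1[simplified])
  have AX: "A \<subseteq> X" using sets.sets_into_space[OF A] by simp
  show "emeasure riesz_measure A = (SUP K\<in>{K. compact K \<and> K \<subseteq> A}. emeasure riesz_measure K)"
  proof (rule antisym)
    show "(SUP K\<in>{K. compact K \<and> K \<subseteq> A}. emeasure riesz_measure K) \<le> emeasure riesz_measure A"
      using A by (intro SUP_least emeasure_mono) auto
    show "emeasure riesz_measure A \<le> (SUP K\<in>{K. compact K \<and> K \<subseteq> A}. emeasure riesz_measure K)"
    proof (rule ennreal_le_epsilon)
      fix e :: real assume e: "0 < e"
      have XA: "X - A \<in> msets" using sets.compl_sets[OF A] by simp
      obtain U where U: "open U" "X - A \<subseteq> U" "content U < outer (X - A) + e"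
        using outer_approx[of "ennreal e" "X - A"] e by (auto simp del: Diff_subset)
      \<comment> \<open>Inner regularity at \<open>A\<close> is outer regularity at its complement:
        \<open>U\<close> is open around \<open>X - A\<close> with little excess mass, so
        \<open>X - U\<close> is a compact part of \<open>A\<close> missing little.\<close>
      let ?K = "X - U"
      have UX: "U \<inter> X \<in> msets" by (rule open_in_msets[OF U(1)])
      have K: "compact ?K" "?K \<subseteq> A" using compact U by (auto intro: compact_diff)
      have KX: "?K = X - U \<inter> X" by auto
      have Km: "?K \<in> msets" unfolding KX using sets.compl_sets[of "U \<inter> X" riesz_measure] UX by simp
      have split: "emeasure riesz_measure A \<le> emeasure riesz_measure ?K + ennreal e"
      proof -
        have "measure riesz_measure (U \<inter> X) \<le> measure riesz_measure (X - A) + e"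
        proof -
          have "emeasure riesz_measure (U \<inter> X) \<le> emeasure riesz_measure (X - A) + e"
            using U(3) by (simp add: emeasure_riesz UX XA outer_open[OF U(1)] less_imp_le)
          then show ?thesis using e by (simp add: emeasure_eq_measure flip: ennreal_plus)
        qed
        moreover have "measure riesz_measure (X - A) = measure riesz_measure X - measure riesz_measure A"
          using finite_measure_compl[OF A] by simp
        moreover have "measure riesz_measure ?K = measure riesz_measure X - measure riesz_measure (U \<inter> X)"
          using finite_measure_compl[of "U \<inter> X"] UX by (simp add: KX[symmetric])
        ultimately have "measure riesz_measure A \<le> measure riesz_measure ?K + e" by linarith
        then show ?thesis using e by (simp add: emeasure_eq_measure flip: ennreal_plus)
      qed
      also have "\<dots> \<le> (SUP K\<in>{K. compact K \<and> K \<subseteq> A}. emeasure riesz_measure K) + ennreal e"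
        using K by (intro add_right_mono SUP_upper) auto
      finally show "emeasure riesz_measure A \<le> (SUP K\<in>{K. compact K \<and> K \<subseteq> A}. emeasure riesz_measure K) + ennreal e" .
    qed
  qed
qed

end

section \<open>Basic facts on Radon probabilities\<close>

lemma radonD:
  assumes "\<mu> \<in> radon_probabilities X"
  shows "space \<mu> = X" "finite_measure \<mu>" "emeasure \<mu> X = 1" "measure \<mu> X = 1"
    "complete_measure \<mu>"
    "A \<in> sets \<mu> \<Longrightarrow> emeasure \<mu> A = (SUP K\<in>{K. compact K \<and> K \<subseteq> A}. emeasure \<mu> K)"
  using assms by (auto simp: radon_probabilities_def measure_def intro!: finite_measureI)

lemma radon_nonempty: "\<mu> \<in> radon_probabilities X \<Longrightarrow> X \<noteq> {}"
  using radonD(3)[of \<mu> X] by auto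

lemma radon_borel:
  assumes "\<mu> \<in> radon_probabilities X" "B \<in> sets borel"
  shows "B \<inter> X \<in> sets \<mu>"
proof -
  have "X \<inter> B \<in> sets (restrict_space borel X)" using assms(2) by (auto simp: sets_restrict_space)
  then show ?thesis using assms(1) by (auto simp: radon_probabilities_def Int_commute)
qed

lemma radon_compact:
  fixes X :: "'a::t2_space set"
  assumes "\<mu> \<in> radon_probabilities X" "compact K" "K \<subseteq> X"
  shows "K \<in> sets \<mu>"
  using radon_borel[OF assms(1), of K] borel_compact[OF assms(2)] assms(3) by (simp add: Int_absorb2)

lemma radon_continuous_measurable:
  fixes f :: "'a::t2_space \<Rightarrow> real"
  assumes "\<mu> \<in> radon_probabilities X" "continuous_on X f"
  shows "f \<in> borel_measurable \<mu>"
proof (rule measurableI)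
  fix A :: "real set" assume "A \<in> sets borel"
  moreover have "f \<in> borel_measurable (restrict_space borel X)"
    by (rule borel_measurable_continuous_on_restrict[OF assms(2)])
  ultimately have "f -` A \<inter> space (restrict_space borel X) \<in> sets (restrict_space borel X)"
    by (rule measurable_sets[rotated])
  then show "f -` A \<inter> space \<mu> \<in> sets \<mu>"
    using assms(1) by (auto simp: space_restrict_space radon_probabilities_def)
qed simp

lemma radon_bounded_integrable:
  fixes f :: "'a::t2_space \<Rightarrow> real"
  assumes "\<mu> \<in> radon_probabilities X" "f \<in> borel_measurable \<mu>" "\<And>x. x \<in> X \<Longrightarrow> \<bar>f x\<bar> \<le> C"
  shows "integrable \<mu> f"
proof -
  interpret finite_measure \<mu> by (rule radonD[OF assms(1)])
  show ?thesis
    using assms radonD(1)[OF assms(1)] by (intro integrable_const_bound[where B=C]) auto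
qed

lemma continuous_bounded:
  fixes f :: "'a::t2_space \<Rightarrow> real"
  assumes "compact X" "continuous_on X f"
  obtains C where "0 < C" "\<forall>x\<in>X. \<bar>f x\<bar> \<le> C"
proof -
  have "bounded (f ` X)" using assms by (simp add: compact_continuous_image compact_imp_bounded)
  then show thesis using that unfolding bounded_pos by auto
qed

lemma radon_continuous_integrable:
  fixes f :: "'a::t2_space \<Rightarrow> real"
  assumes "compact X" "\<mu> \<in> radon_probabilities X" "continuous_on X f"
  shows "integrable \<mu> f"
proof -
  obtain C where "0 < C" "\<forall>x\<in>X. \<bar>f x\<bar> \<le> C" using continuous_bounded[OF assms(1,3)] .
  then show ?thesis
    using assms by (intro radon_bounded_integrable radon_continuous_measurable) auto
qed

lemma radon_integral_const:
  assumes "\<mu> \<in> radon_probabilities X"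
  shows "integral\<^sup>L \<mu> (\<lambda>x. c::real) = c"
  using radonD(1,4)[OF assms] by (simp add: lebesgue_integral_const)

lemma radon_indicator:
  assumes "\<mu> \<in> radon_probabilities X" "A \<in> sets \<mu>"
  shows "integrable \<mu> (indicator A :: _ \<Rightarrow> real)"
    and "integral\<^sup>L \<mu> (indicator A :: _ \<Rightarrow> real) = measure \<mu> A"
proof -
  interpret finite_measure \<mu> by (rule radonD[OF assms(1)])
  show "integrable \<mu> (indicator A :: _ \<Rightarrow> real)"
    using assms(2) by (intro integrable_real_indicator) (auto simp: emeasure_eq_measure)
  show "integral\<^sup>L \<mu> (indicator A :: _ \<Rightarrow> real) = measure \<mu> A"
    using sets.sets_into_space[OF assms(2)] by (simp add: Int_absorb2)
qed

section \<open>The Riesz measure represents the functional\<close>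

context positive_functional
begin

text \<open>\<open>f\<close> is cut into \<open>n\<close> horizontal slices \<open>g i\<close> of
  height \<open>1 / n\<close>. With \<open>m i\<close> the mass of \<open>[f > i/n]\<close>, the
  slice satisfies \<open>L (g i) \<le> m i / n\<close>, and its integral is at least
  \<open>m (Suc i) / n\<close>. After summation the two bounds differ by a telescoped term of at
  most \<open>1 / n\<close>.\<close>

lemma unit_le_integral:
  assumes f: "continuous_on X f" "\<And>x. x \<in> X \<Longrightarrow> 0 \<le> f x \<and> f x \<le> 1"
  shows "L f \<le> integral\<^sup>L riesz_measure f"
proof (rule field_le_epsilon)
  fix e :: real assume "0 < e"
  then obtain n' where "inverse (real (Suc n')) < e" using reals_Archimedean by blast
  then have "0 < Suc n'" "1 / real (Suc n') < e" by (simp_all add: inverse_eq_divide)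
  then obtain n :: nat where n: "0 < n" "1 / n < e" by blast
  note R = riesz_radon
  interpret M: finite_measure riesz_measure by (rule radonD(2)[OF R])
  define g where "g i x = min (max (f x - real i / n) 0) (1 / n)" for i x
  define m where "m i = measure riesz_measure {x \<in> X. real i / n < f x}" for i :: nat
  have g: "continuous_on X (g i)" for i
    unfolding g_def by (intro continuous_intros f)
  have g_sum: "(\<Sum>i<k. g i x) = min (f x) (real k / n)" if "x \<in> X" for x k
  proof (induction k)
    case (Suc k)
    have "real (Suc k) / n = real k / n + 1 / n" by (simp add: add_divide_distrib)
    moreover have "min a b + min (max (a - b) 0) d = min a (b + d)" if "0 \<le> d" for a b d :: real
      using that by (auto simp: min_def max_def)
    ultimately show ?case using Suc by (simp add: g_def)
  qed (use f(2)[OF that] in simp)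
  have fg: "f x = (\<Sum>i<n. g i x)" if "x \<in> X" for x
    using f(2)[OF that] n by (simp add: g_sum[OF that])
  have sets: "{x \<in> X. c < f x} \<in> sets riesz_measure" for c
    using borel_measurable_less[OF _ radon_continuous_measurable[OF R f(1)], of "\<lambda>_. c"] by simp
  have Lg: "L (g i) \<le> m i / n" for i
  proof -
    \<comment> \<open>An open set of the ambient space whose trace on \<open>X\<close> is
      \<open>[f > i/n]\<close>; the minus signs put its complement into superlevel form.\<close>
    let ?U = "- {x \<in> X. - (real i / n) \<le> - f x}"
    have U: "open ?U"
      by (intro open_Compl continuous_on_superlevel_closed compact continuous_on_minus f)
    have UX: "?U \<inter> X = {x \<in> X. real i / n < f x}" by auto
    have "(\<lambda>x. n * g i x) \<in> below ?U"
    proof (rule belowI)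
      show "continuous_on X (\<lambda>x. n * g i x)" by (intro continuous_intros g)
      have "0 \<le> g i x" "g i x \<le> 1 / n" for x by (auto simp: g_def)
      then show "0 \<le> n * g i x \<and> n * g i x \<le> 1" for x
        using n by (metis mult.commute of_nat_0_le_iff of_nat_0_less_iff pos_le_divide_eq zero_le_mult_iff)
      show "n * g i x = 0" if "x \<in> X" "x \<notin> ?U" for x using that n by (auto simp: g_def)
    qed
    then have "ennreal (L (\<lambda>x. n * g i x)) \<le> content ?U" by (rule content_upper)
    also have "\<dots> = outer {x \<in> X. real i / n < f x}" using outer_open[OF U] UX by simp
    also have "\<dots> = ennreal (m i)"
      using emeasure_riesz[of "{x \<in> X. real i / n < f x}"] sets by (simp add: m_def M.emeasure_eq_measure)
    finally have "n * L (g i) \<le> m i" by (simp add: cmult[OF g] m_def)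
    then show ?thesis using n by (simp add: field_simps)
  qed
  have Ig: "m (Suc i) / n \<le> integral\<^sup>L riesz_measure (g i)" for i
  proof -
    let ?A = "{x \<in> X. real (Suc i) / n < f x}"
    have "m (Suc i) / n = integral\<^sup>L riesz_measure (\<lambda>x. (1 / n) * indicator ?A x)"
      using radon_indicator(2)[OF R sets[of "real (Suc i) / n"]] by (simp add: m_def)
    also have "\<dots> \<le> integral\<^sup>L riesz_measure (g i)"
    proof (rule integral_mono)
      show "integrable riesz_measure (\<lambda>x. (1 / n) * indicator ?A x)"
        by (intro integrable_mult_right radon_indicator(1)[OF R sets])
      show "integrable riesz_measure (g i)" by (rule radon_continuous_integrable[OF compact R g])
      show "(1 / n) * indicator ?A x \<le> g i x" if "x \<in> space riesz_measure" for x
      proof -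
        have "real (Suc i) / n = real i / n + 1 / n" by (simp add: add_divide_distrib)
        then show ?thesis by (cases "x \<in> ?A") (auto simp: g_def le_max_iff_disj)
      qed
    qed
    finally show ?thesis .
  qed
  have "L f = (\<Sum>i<n. L (g i))"
  proof -
    have "L f = L (\<lambda>x. \<Sum>i<n. g i x)"
      using f(1) g fg by (intro antisym mono) (auto intro!: continuous_intros)
    then show ?thesis using g by (simp add: sum)
  qed
  also have "\<dots> \<le> (\<Sum>i<n. m i / n)" by (intro sum_mono Lg)
  also have "\<dots> = (\<Sum>i<n. m (Suc i) / n) + (m 0 - m n) / n"
    using sum_lessThan_telescope'[of "\<lambda>i. m i / n" n] by (simp add: sum_subtractf diff_divide_distrib)
  also have "(\<Sum>i<n. m (Suc i) / n) \<le> (\<Sum>i<n. integral\<^sup>L riesz_measure (g i))"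
    by (intro sum_mono Ig)
  also have "(\<Sum>i<n. integral\<^sup>L riesz_measure (g i)) = integral\<^sup>L riesz_measure (\<lambda>x. \<Sum>i<n. g i x)"
    by (intro Bochner_Integration.integral_sum[symmetric] radon_continuous_integrable[OF compact R g])
  also have "\<dots> = integral\<^sup>L riesz_measure f"
    by (rule Bochner_Integration.integral_cong) (auto simp: fg)
  also have "(m 0 - m n) / n \<le> 1 / n"
  proof -
    have "m 0 \<le> measure riesz_measure X"
      unfolding m_def using M.bounded_measure by simp
    moreover have "0 \<le> m n" by (simp add: m_def)
    ultimately have "m 0 - m n \<le> 1" using radonD(4)[OF R] by linarith
    then show ?thesis by (simp add: divide_right_mono)
  qed
  finally show "L f \<le> integral\<^sup>L riesz_measure f + e" using n by simp
qed

lemma le_integral: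
  assumes f: "continuous_on X f"
  shows "L f \<le> integral\<^sup>L riesz_measure f"
proof -
  obtain C where C: "0 < C" "\<forall>x\<in>X. \<bar>f x\<bar> \<le> C" using continuous_bounded[OF compact f] .
  define g where "g x = (1 / (2 * C)) * f x + 1 / 2" for x
  have "L g \<le> integral\<^sup>L riesz_measure g"
  proof (rule unit_le_integral)
    show "continuous_on X g" unfolding g_def by (intro continuous_intros f)
    show "0 \<le> g x \<and> g x \<le> 1" if "x \<in> X" for x
      using C(1) C(2)[rule_format, OF that] by (auto simp: g_def abs_le_iff field_simps)
  qed
  moreover have "L g = (1 / (2 * C)) * L f + 1 / 2"
    unfolding g_def using f by (subst add) (use C(1) in \<open>auto intro!: continuous_intros simp: const cmult[OF f, of "1 / (2 * C)", simplified]\<close>)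
  moreover have "integral\<^sup>L riesz_measure g = (1 / (2 * C)) * integral\<^sup>L riesz_measure f + 1 / 2"
    unfolding g_def using radon_continuous_integrable[OF compact riesz_radon f] radon_integral_const[OF riesz_radon]
      radon_continuous_integrable[OF compact riesz_radon continuous_on_const]
    by (subst Bochner_Integration.integral_add) auto
  ultimately show ?thesis using C(1) by (simp add: field_simps)
qed

lemma integral_riesz:
  assumes f: "continuous_on X f"
  shows "integral\<^sup>L riesz_measure f = L f"
  using le_integral[OF f] le_integral[of "\<lambda>x. - f x"] cmult[OF f, of "-1"] f
  by (auto simp: continuous_on_minus)

end

section \<open>Radon probabilities are determined by continuous functions\<close>

lemma radon_separate:
  fixes X :: "'a::t2_space set"
  assumes "compact X" "\<mu> \<in> radon_probabilities X" "compact K" "K \<subseteq> X" "0 < e"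
  shows "\<exists>f. continuous_on X f \<and> (\<forall>x\<in>X. indicator K x \<le> f x \<and> 0 \<le> f x) \<and>
    integral\<^sup>L \<mu> f \<le> measure \<mu> K + e"
proof -
  note R = radonD[OF assms(2)]
  interpret finite_measure \<mu> by (rule R)
  have Km: "K \<in> sets \<mu>" by (rule radon_compact[OF assms(2-4)])
  have XK: "X - K \<in> sets \<mu>" using sets.compl_sets[OF Km] R(1) by simp
  have "\<exists>K'. compact K' \<and> K' \<subseteq> X - K \<and> measure \<mu> (X - K) - e < measure \<mu> K'"
  \<comment> \<open>If \<open>X - K\<close> has mass below \<open>e\<close>, the empty set serves.
    Otherwise \<open>measure \<mu> (X - K) - e\<close> is nonnegative and survives the conversion to
    \<open>ennreal\<close>, where the supremum of inner regularity is taken.\<close>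
  proof (cases "measure \<mu> (X - K) < e")
    case True
    then show ?thesis by (intro exI[of _ "{}"]) auto
  next
    case False
    then have "ennreal (measure \<mu> (X - K) - e) < emeasure \<mu> (X - K)"
      using assms(5) by (simp add: emeasure_eq_measure ennreal_less_iff)
    then obtain K' where "compact K'" "K' \<subseteq> X - K" "ennreal (measure \<mu> (X - K) - e) < emeasure \<mu> K'"
      unfolding R(6)[OF XK] less_SUP_iff by blast
    then show ?thesis using False by (auto simp: emeasure_eq_measure ennreal_less_iff)
  qed
  then obtain K' where K': "compact K'" "K' \<subseteq> X - K" "measure \<mu> (X - K) - e < measure \<mu> K'" by blast
  have K'm: "K' \<in> sets \<mu>" using K' by (intro radon_compact[OF assms(2)]) auto
  have "closed K" "closed K'" "K \<inter> K' \<inter> X = {}" using K' assms(3) compact_imp_closed by auto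
  then obtain f :: "'a \<Rightarrow> real" where f: "continuous_on X f" "\<forall>x\<in>X. 0 \<le> f x \<and> f x \<le> 1"
    "\<forall>x\<in>X \<inter> K. f x = 1" "\<forall>x\<in>X \<inter> K'. f x = 0" by (rule Urysohn_compact[OF assms(1)])
  have "integral\<^sup>L \<mu> f \<le> integral\<^sup>L \<mu> (\<lambda>x. 1 - indicator K' x)"
  proof (rule integral_mono)
    show "integrable \<mu> f" by (rule radon_continuous_integrable[OF assms(1,2) f(1)])
    show "integrable \<mu> (\<lambda>x. 1 - indicator K' x :: real)"
      using radon_indicator(1)[OF assms(2) K'm] by simp
    show "f x \<le> 1 - indicator K' x" if "x \<in> space \<mu>" for x
      using f that R(1) by (auto simp: indicator_def)
  qed
  also have "\<dots> = 1 - measure \<mu> K'"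
    using radon_indicator[OF assms(2) K'm] radon_integral_const[OF assms(2)]
    by (subst Bochner_Integration.integral_diff) auto
  also have "\<dots> \<le> measure \<mu> K + e"
    using K'(3) finite_measure_compl[OF Km] R by simp
  finally show ?thesis using f assms(4) by (intro exI[of _ f]) (auto simp: indicator_def)
qed

lemma radon_measure_compact_le:
  fixes X :: "'a::t2_space set"
  assumes "compact X" "\<mu> \<in> radon_probabilities X" "\<nu> \<in> radon_probabilities X"
    "\<And>f :: 'a \<Rightarrow> real. continuous_on X f \<Longrightarrow> integral\<^sup>L \<mu> f = integral\<^sup>L \<nu> f" "compact K" "K \<subseteq> X"
  shows "measure \<nu> K \<le> measure \<mu> K"
proof (rule field_le_epsilon)
  fix e :: real assume "0 < e"
  then obtain f where f: "continuous_on X f" "\<forall>x\<in>X. indicator K x \<le> f x \<and> 0 \<le> f x"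
    "integral\<^sup>L \<mu> f \<le> measure \<mu> K + e" using radon_separate[OF assms(1,2,5,6)] by blast
  interpret finite_measure \<nu> by (rule radonD[OF assms(3)])
  have Km: "K \<in> sets \<nu>" by (rule radon_compact[OF assms(3,5,6)])
  have "measure \<nu> K = integral\<^sup>L \<nu> (indicator K)"
    using radon_indicator(2)[OF assms(3) Km] by simp
  also have "\<dots> \<le> integral\<^sup>L \<nu> f"
    using f(2) radonD(1)[OF assms(3)]
    by (intro integral_mono radon_continuous_integrable[OF assms(1,3) f(1)] radon_indicator(1)[OF assms(3) Km]) auto
  also have "\<dots> \<le> measure \<mu> K + e" using f(3) assms(4)[OF f(1)] by simp
  finally show "measure \<nu> K \<le> measure \<mu> K + e" .
qed

text \<open>The supremum in inner regularity is realised along a sequence of compact sets, and their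
  union is Borel.\<close>

lemma radon_sigma_compact:
  fixes X :: "'a::t2_space set"
  assumes "\<mu> \<in> radon_probabilities X" "A \<in> sets \<mu>"
  shows "\<exists>B. B \<in> sets borel \<and> B \<subseteq> A \<and> emeasure \<mu> B = emeasure \<mu> A"
proof -
  note R = radonD[OF assms(1)]
  let ?\<K> = "{K. compact K \<and> K \<subseteq> A}"
  have "{} \<in> ?\<K>" by simp
  then have "emeasure \<mu> ` ?\<K> \<noteq> {}" by blast
  from ennreal_Sup_countable_SUP[OF this] obtain f where
    f: "range f \<subseteq> emeasure \<mu> ` ?\<K>" "Sup (emeasure \<mu> ` ?\<K>) = (SUP i::nat. f i)" by blast
  then have "\<exists>K. compact K \<and> K \<subseteq> A \<and> f i = emeasure \<mu> K" for i by blast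
  then obtain K where K: "\<And>i. compact (K i)" "\<And>i. K i \<subseteq> A" "\<And>i. f i = emeasure \<mu> (K i)" by metis
  have AX: "A \<subseteq> X" using sets.sets_into_space[OF assms(2)] R(1) by simp
  have Km: "K i \<in> sets \<mu>" for i using K(1,2)[of i] AX by (intro radon_compact[OF assms(1)]) auto
  show ?thesis
  proof (intro exI conjI)
    show "(\<Union>i. K i) \<in> sets borel" using borel_compact[OF K(1)] by (intro sets.countable_UN) auto
    show "(\<Union>i. K i) \<subseteq> A" using K by auto
    have "emeasure \<mu> A = (SUP i. f i)" using R(6)[OF assms(2)] f by simp
    also have "\<dots> \<le> emeasure \<mu> (\<Union>i. K i)"
      using Km by (intro SUP_least) (auto simp: K intro!: emeasure_mono)
    finally show "emeasure \<mu> (\<Union>i. K i) = emeasure \<mu> A"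
      using K Km by (intro antisym) (auto intro!: emeasure_mono assms(2))
  qed
qed

text \<open>The sigma-algebra is part of a measure, so it too must be recovered from the values on
  compact sets. Borel sets \<open>B\<close> inside \<open>A\<close> and \<open>C\<close> inside
  \<open>X - A\<close> exhaust the mass; the Borel remainder \<open>?N\<close> is null for both
  measures and contains \<open>A - B\<close>, which is therefore \<open>\<nu>\<close>-measurable by
  completeness.\<close>

lemma radon_sets_subset:
  fixes X :: "'a::t2_space set"
  assumes "\<mu> \<in> radon_probabilities X" "\<nu> \<in> radon_probabilities X"
    and eq: "\<And>K. compact K \<Longrightarrow> K \<subseteq> X \<Longrightarrow> emeasure \<mu> K = emeasure \<nu> K"
  shows "sets \<mu> \<subseteq> sets \<nu>"
proof
  fix A assume A: "A \<in> sets \<mu>"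
  interpret M: finite_measure \<mu> by (rule radonD[OF assms(1)])
  interpret N: complete_measure \<nu> by (rule radonD[OF assms(2)])
  have AX: "A \<subseteq> X" using sets.sets_into_space[OF A] radonD(1)[OF assms(1)] by simp
  have cA: "X - A \<in> sets \<mu>" using sets.compl_sets[OF A] radonD(1)[OF assms(1)] by simp
  obtain B where B: "B \<in> sets borel" "B \<subseteq> A" "emeasure \<mu> B = emeasure \<mu> A"
    using radon_sigma_compact[OF assms(1) A] by blast
  obtain C where C: "C \<in> sets borel" "C \<subseteq> X - A" "emeasure \<mu> C = emeasure \<mu> (X - A)"
    using radon_sigma_compact[OF assms(1) cA] by blast
  have eqS: "emeasure \<mu> S = emeasure \<nu> S" if "S \<in> sets \<mu>" "S \<in> sets \<nu>" for S
  proof -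
    have "S \<subseteq> X" using sets.sets_into_space[OF that(1)] radonD(1)[OF assms(1)] by simp
    then show ?thesis
      unfolding radonD(6)[OF assms(1) that(1)] radonD(6)[OF assms(2) that(2)]
      by (intro SUP_cong) (auto intro: eq)
  qed
  let ?N = "- (B \<union> C) \<inter> X"
  have bor: "- (B \<union> C) \<in> sets borel" using B(1) C(1) by (simp add: borel_comp)
  have N: "?N \<in> sets \<mu>" "?N \<in> sets \<nu>" by (rule radon_borel[OF _ bor], rule assms)+
  have "B \<inter> X = B" "C \<inter> X = C" using B C AX by auto
  then have Bm: "B \<in> sets \<mu>" "B \<in> sets \<nu>" "C \<in> sets \<mu>"
    using radon_borel[OF assms(1) B(1)] radon_borel[OF assms(2) B(1)] radon_borel[OF assms(1) C(1)] by simp_all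
  have "emeasure \<mu> ?N = 0"
  proof -
    have "measure \<mu> B = measure \<mu> A" "measure \<mu> C = measure \<mu> (X - A)" using B C by (simp_all add: measure_def)
    moreover have "measure \<mu> (B \<union> C) = measure \<mu> B + measure \<mu> C"
      using B C Bm by (intro M.finite_measure_Union) auto
    moreover have "measure \<mu> (X - A) = measure \<mu> X - measure \<mu> A"
      using M.finite_measure_compl[OF A] radonD(1)[OF assms(1)] by simp
    moreover have "measure \<mu> ?N = measure \<mu> X - measure \<mu> (B \<union> C)"
    proof -
      have "?N = space \<mu> - (B \<union> C)" using radonD(1)[OF assms(1)] by auto
      then show ?thesis using M.finite_measure_compl[of "B \<union> C"] Bm radonD(1)[OF assms(1)] by simp
    qed
    ultimately show ?thesis by (simp add: M.emeasure_eq_measure)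
  qed
  then have "?N \<in> null_sets \<nu>" using eqS[OF N] N by auto
  then have "A - B \<in> sets \<nu>" by (rule N.complete[rotated]) (use AX C in auto)
  moreover have "A = B \<union> (A - B)" using B by auto
  ultimately show "A \<in> sets \<nu>" using Bm by (metis sets.Un)
qed

lemma radon_eqI:
  fixes X :: "'a::t2_space set"
  assumes "compact X" "\<mu> \<in> radon_probabilities X" "\<nu> \<in> radon_probabilities X"
    "\<And>f :: 'a \<Rightarrow> real. continuous_on X f \<Longrightarrow> integral\<^sup>L \<mu> f = integral\<^sup>L \<nu> f"
  shows "\<mu> = \<nu>"
proof -
  have K: "emeasure \<mu> K = emeasure \<nu> K" if "compact K" "K \<subseteq> X" for K
  proof -
    have "measure \<mu> K = measure \<nu> K"
      using radon_measure_compact_le[OF assms(1,2,3)] radon_measure_compact_le[OF assms(1,3,2)] assms(4) that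
      by (metis antisym)
    then show ?thesis using radonD(2)[OF assms(2)] radonD(2)[OF assms(3)] by (simp add: finite_measure.emeasure_eq_measure)
  qed
  show ?thesis
  proof (rule measure_eqI)
    show "sets \<mu> = sets \<nu>"
      using radon_sets_subset[OF assms(2,3)] radon_sets_subset[OF assms(3,2)] K by (metis antisym)
    then show "emeasure \<mu> A = emeasure \<nu> A" if "A \<in> sets \<mu>" for A
    proof -
      have "A \<in> sets \<nu>" "A \<subseteq> X"
        using that \<open>sets \<mu> = sets \<nu>\<close> sets.sets_into_space[OF that] radonD(1)[OF assms(2)] by auto
      then show ?thesis
        unfolding radonD(6)[OF assms(2) that] radonD(6)[OF assms(3) \<open>A \<in> sets \<nu>\<close>]
        by (intro SUP_cong) (auto intro: K)
    qed
  qed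
qed

section \<open>Separation of points by continuous affine functions\<close>

definition sublinear :: "('v::real_vector \<Rightarrow> real) \<Rightarrow> bool"
  where "sublinear p \<longleftrightarrow> (\<forall>x y. p (x + y) \<le> p x + p y) \<and> (\<forall>c>0. \<forall>x. p (c *\<^sub>R x) \<le> c * p x)"

lemma sublinearD:
  assumes "sublinear p"
  shows "p (x + y) \<le> p x + p y" and "0 < c \<Longrightarrow> p (c *\<^sub>R x) \<le> c * p x"
  using assms by (simp_all add: sublinear_def)

lemma sublinear_zero: "sublinear p \<Longrightarrow> p 0 = 0"
  using sublinearD(2)[of p 2 0] sublinearD(2)[of p "1/2" 0] by simp

text \<open>The definition asks for homogeneity as an inequality, which is easy to verify for
  infima; applying it with the reciprocal factor gives equality.\<close>

lemma sublinear_scale: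
  assumes "sublinear p" "0 \<le> c"
  shows "p (c *\<^sub>R x) = c * p x"
proof (cases "c = 0")
  case False
  then have "p ((1/c) *\<^sub>R (c *\<^sub>R x)) \<le> (1/c) * p (c *\<^sub>R x)" "p (c *\<^sub>R x) \<le> c * p x"
    using assms(2) by (intro sublinearD[OF assms(1)]; simp)+
  then show ?thesis using False assms(2) by (auto simp: field_simps)
qed (simp add: sublinear_zero assms)

lemma sublinear_minus: "sublinear p \<Longrightarrow> - p (- x) \<le> p x"
  using sublinear_zero[of p] sublinearD(1)[of p x "- x"] by simp

text \<open>For sublinear \<open>q\<close>, the largest sublinear functional below \<open>q\<close>
  whose value at \<open>- z\<close> is at most \<open>- q z\<close>. A minimal sublinear functional
  is unchanged by this step, which forces it to be odd.\<close>

definition sublinear_step :: "('v::real_vector \<Rightarrow> real) \<Rightarrow> 'v \<Rightarrow> 'v \<Rightarrow> real"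
  where "sublinear_step q z x = (INF t\<in>{0..}. q (x + t *\<^sub>R z) - t * q z)"

lemma sublinear_step:
  assumes q: "sublinear q"
  shows "sublinear (sublinear_step q z)" and "sublinear_step q z x \<le> q x"
    and "sublinear_step q z (- z) \<le> - q z"
proof -
  let ?g = "\<lambda>x t. q (x + t *\<^sub>R z) - t * q z"
  have add: "q (x + y) \<le> q x + q y" for x y using q by (simp add: sublinear_def)
  have bdd: "bdd_below (?g x ` {0..})" for x
  proof (rule bdd_belowI2[where m="- q (- x)"])
    fix t :: real assume "t \<in> {0..}"
    then show "- q (- x) \<le> ?g x t"
      using add[of "x + t *\<^sub>R z" "- x"] sublinear_scale[OF q, of t z] by simp
  qed
  have lower: "sublinear_step q z x \<le> ?g x t" if "0 \<le> t" for x t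
    unfolding sublinear_step_def using that by (intro cINF_lower bdd) auto
  have greatest: "c \<le> sublinear_step q z x" if "\<And>t. 0 \<le> t \<Longrightarrow> c \<le> ?g x t" for x c
    unfolding sublinear_step_def using that by (intro cINF_greatest) auto
  show "sublinear (sublinear_step q z)"
    unfolding sublinear_def
  proof safe
    fix x y
    have *: "sublinear_step q z (x + y) \<le> ?g x s + ?g y t" if "0 \<le> s" "0 \<le> t" for s t
    proof -
      have "sublinear_step q z (x + y) \<le> ?g (x + y) (s + t)" using that by (intro lower) simp
      also have "\<dots> \<le> ?g x s + ?g y t"
        using add[of "x + s *\<^sub>R z" "y + t *\<^sub>R z"] by (simp add: algebra_simps)
      finally show ?thesis .
    qed
    have "sublinear_step q z (x + y) - ?g y t \<le> sublinear_step q z x" if "0 \<le> t" for t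
      by (rule greatest) (use *[OF _ that] in \<open>simp add: diff_le_eq\<close>)
    then have "sublinear_step q z (x + y) - sublinear_step q z x \<le> sublinear_step q z y"
      by (intro greatest) (simp add: diff_le_eq add.commute)
    then show "sublinear_step q z (x + y) \<le> sublinear_step q z x + sublinear_step q z y" by simp
  next
    fix c :: real and x assume c: "0 < c"
    have "sublinear_step q z (c *\<^sub>R x) / c \<le> sublinear_step q z x"
    proof (rule greatest)
      fix t :: real assume "0 \<le> t"
      then have "sublinear_step q z (c *\<^sub>R x) \<le> ?g (c *\<^sub>R x) (c * t)" using c by (intro lower) simp
      also have "\<dots> = c * ?g x t"
        using sublinear_scale[OF q, of c "x + t *\<^sub>R z"] c by (simp add: algebra_simps)
      finally show "sublinear_step q z (c *\<^sub>R x) / c \<le> ?g x t" using c by (simp add: field_simps)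
    qed
    then show "sublinear_step q z (c *\<^sub>R x) \<le> c * sublinear_step q z x" using c by (simp add: field_simps)
  qed
  show "sublinear_step q z x \<le> q x" using lower[of 0 x] by simp
  show "sublinear_step q z (- z) \<le> - q z" using lower[of 1 "- z"] sublinear_zero[OF q] by simp
qed

lemma sublinear_chain_Inf:
  assumes C: "C \<noteq> {}" "\<And>q. q \<in> C \<Longrightarrow> sublinear q \<and> q \<le> p"
    "\<And>q r. q \<in> C \<Longrightarrow> r \<in> C \<Longrightarrow> q \<le> r \<or> r \<le> q"
  shows "sublinear (\<lambda>x. INF q\<in>C. q x)" and "\<And>q. q \<in> C \<Longrightarrow> (\<lambda>x. INF q\<in>C. q x) \<le> q"
proof -
  let ?u = "\<lambda>x. INF q\<in>C. q x"
  have bdd: "bdd_below ((\<lambda>q. q x) ` C)" for x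
  proof (rule bdd_belowI2[where m="- p (- x)"])
    fix q assume "q \<in> C"
    then show "- p (- x) \<le> q x"
      using sublinear_minus[of q x] C(2)[of q] by (auto simp: le_fun_def intro: order_trans[rotated])
  qed
  have lower: "?u x \<le> q x" if "q \<in> C" for q x using that by (intro cINF_lower bdd)
  have greatest: "c \<le> ?u x" if "\<And>q. q \<in> C \<Longrightarrow> c \<le> q x" for c x
    using that by (intro cINF_greatest C)
  show "?u \<le> q" if "q \<in> C" for q using lower[OF that] by (simp add: le_fun_def)
  show "sublinear ?u"
    unfolding sublinear_def
  proof safe
    fix x y
    have *: "?u (x + y) \<le> q x + r y" if qr: "q \<in> C" "r \<in> C" for q r
    proof -
      \<comment> \<open>In a chain one member lies below both \<open>q\<close> and \<open>r\<close>;
        this is what makes the infimum subadditive.\<close>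
      obtain s where s: "s \<in> C" "s \<le> q" "s \<le> r" using C(3)[OF qr] qr by blast
      have "?u (x + y) \<le> s (x + y)" by (rule lower[OF s(1)])
      also have "\<dots> \<le> s x + s y" using C(2)[OF s(1)] by (simp add: sublinear_def)
      also have "\<dots> \<le> q x + r y" using s by (intro add_mono) (auto simp: le_fun_def)
      finally show ?thesis .
    qed
    have "?u (x + y) - r y \<le> ?u x" if "r \<in> C" for r
      by (rule greatest) (use *[OF _ that] in \<open>simp add: diff_le_eq\<close>)
    then have "?u (x + y) - ?u x \<le> ?u y" by (intro greatest) (simp add: diff_le_eq add.commute)
    then show "?u (x + y) \<le> ?u x + ?u y" by simp
  next
    fix c :: real and x assume c: "0 < c"
    have "?u (c *\<^sub>R x) / c \<le> ?u x"
    proof (rule greatest)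
      fix q assume q: "q \<in> C"
      have "?u (c *\<^sub>R x) \<le> q (c *\<^sub>R x)" by (rule lower[OF q])
      also have "\<dots> \<le> c * q x" using C(2)[OF q] c by (simp add: sublinear_def)
      finally show "?u (c *\<^sub>R x) / c \<le> q x" using c by (simp add: field_simps)
    qed
    then show "?u (c *\<^sub>R x) \<le> c * ?u x" using c by (simp add: field_simps)
  qed
qed

text \<open>Zorn's lemma in the reversed order gives a minimal sublinear \<open>m\<close> below
  \<open>p\<close>. Minimality yields \<open>sublinear_step m z = m\<close>, hence
  \<open>m (- z) \<le> - m z\<close>, and an odd sublinear functional is linear.\<close>

lemma sublinear_dominates_linear:
  assumes p: "sublinear p"
  shows "\<exists>f. linear f \<and> f \<le> p"
proof -
  let ?A = "{q. sublinear q \<and> q \<le> p}"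
  let ?P = "\<lambda>q r :: _ \<Rightarrow> real. r \<le> q"
  have "\<exists>m\<in>?A. \<forall>a\<in>?A. ?P m a \<longrightarrow> a = m"
  proof (rule predicate_Zorn)
    show "partial_order_on ?A (relation_of ?P ?A)"
      by (auto simp: partial_order_on_def preorder_on_def refl_on_def trans_def antisym_def relation_of_def)
    fix C assume C: "C \<in> Chains (relation_of ?P ?A)"
    show "\<exists>u\<in>?A. \<forall>a\<in>C. ?P a u"
    proof (cases "C = {}")
      case True then show ?thesis using p by auto
    next
      case False
      have 1: "\<And>q. q \<in> C \<Longrightarrow> sublinear q \<and> q \<le> p"
        and 2: "\<And>q r. q \<in> C \<Longrightarrow> r \<in> C \<Longrightarrow> q \<le> r \<or> r \<le> q"
        using C by (auto simp: Chains_def relation_of_def)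
      note u = sublinear_chain_Inf[OF False 1 2]
      obtain q where "q \<in> C" using False by blast
      then have "(\<lambda>x. INF q\<in>C. q x) \<le> p" using u(2) 1 by (meson order_trans)
      then show ?thesis using u by (intro bexI[of _ "\<lambda>x. INF q\<in>C. q x"]) auto
    qed
  qed
  then obtain m where m: "sublinear m" "m \<le> p" and min: "\<And>q. sublinear q \<Longrightarrow> q \<le> m \<Longrightarrow> q = m"
    by (auto intro: order_trans)
  have odd: "m (- z) = - m z" for z
  proof (rule antisym)
    have "sublinear_step m z = m"
      by (rule min) (auto simp: le_fun_def intro: sublinear_step[OF m(1)])
    then show "m (- z) \<le> - m z" using sublinear_step(3)[OF m(1), of z] by simp
    show "- m z \<le> m (- z)" using sublinear_minus[OF m(1), of z] by simp
  qed
  have le: "m (x + y) \<le> m x + m y" for x y using m(1) by (simp add: sublinear_def)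
  have "linear m"
  proof (rule linearI)
    show "m (x + y) = m x + m y" for x y
      using le[of x y] le[of "- x" "- y"] odd[of "x + y"] odd[of x] odd[of y] by simp
    show "m (c *\<^sub>R x) = c *\<^sub>R m x" for c x
      using sublinear_scale[OF m(1), of c x] sublinear_scale[OF m(1), of "- c" x] odd[of "c *\<^sub>R x"]
      by (cases "0 \<le> c") auto
  qed
  then show ?thesis using m(2) by blast
qed

text \<open>Starting from \<open>sublinear_step p z\<close> instead of \<open>p\<close> bounds
  \<open>f (- z)\<close> above by \<open>- p z\<close>, which is the lower bound wanted for
  \<open>f z\<close>.\<close>

lemma sublinear_dominates_linear_at:
  assumes p: "sublinear p"
  shows "\<exists>f. linear f \<and> f \<le> p \<and> p z \<le> f z"
proof -
  obtain f where f: "linear f" "f \<le> sublinear_step p z"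
    using sublinear_dominates_linear[OF sublinear_step(1)[OF p]] by blast
  have "f x \<le> p x" for x using f(2) sublinear_step(2)[OF p] by (meson le_funD order_trans)
  moreover have "f (- z) \<le> - p z" using f(2) sublinear_step(3)[OF p] by (meson le_funD order_trans)
  ultimately show ?thesis using f(1) by (intro exI[of _ f]) (auto simp: le_fun_def linear_neg)
qed

section \<open>Minkowski functionals and separation of points\<close>

lemma tendsto_scaleR_lc:
  fixes g :: "'b \<Rightarrow> 'a::locally_convex_space"
  assumes "(f \<longlongrightarrow> c) F" "(g \<longlongrightarrow> x) F"
  shows "((\<lambda>y. f y *\<^sub>R g y) \<longlongrightarrow> c *\<^sub>R x) F"
proof -
  have "filterlim (\<lambda>y. (f y, g y)) (nhds c \<times>\<^sub>F nhds x) F" using assms by (rule filterlim_Pair)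
  from filterlim_compose[OF tendsto_scaleR_pair this] show ?thesis by simp
qed

text \<open>The Minkowski functional. For an open \<open>V\<close> around 0 the infimum is over a
  nonempty set, because the multiples \<open>x / n\<close> tend to 0.\<close>

definition gauge_fun :: "'v::real_vector set \<Rightarrow> 'v \<Rightarrow> real"
  where "gauge_fun V x = Inf {t. 0 < t \<and> (1/t) *\<^sub>R x \<in> V}"

lemma gauge_fun:
  fixes V :: "'a::locally_convex_space set"
  assumes V: "open V" "0 \<in> V" "convex V"
  shows "sublinear (gauge_fun V)" and "x \<in> V \<Longrightarrow> gauge_fun V x \<le> 1" and "x \<notin> V \<Longrightarrow> 1 \<le> gauge_fun V x"
proof -
  let ?S = "\<lambda>x. {t. 0 < t \<and> (1/t) *\<^sub>R x \<in> V}"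
  have ne: "?S x \<noteq> {}" for x
  proof -
    have "(\<lambda>n. (1 / real (Suc n)) *\<^sub>R x) \<longlonglongrightarrow> 0 *\<^sub>R x"
      by (intro tendsto_scaleR_lc tendsto_const LIMSEQ_inverse_real_of_nat[unfolded inverse_eq_divide])
    then have "\<forall>\<^sub>F n in sequentially. (1 / real (Suc n)) *\<^sub>R x \<in> V"
      using V by (simp add: topological_tendstoD)
    then obtain n where "(1 / real (Suc n)) *\<^sub>R x \<in> V" by (auto simp: eventually_sequentially)
    then have "real (Suc n) \<in> ?S x" by simp
    then show ?thesis by blast
  qed
  have bdd: "bdd_below (?S x)" for x by (rule bdd_belowI[of _ 0]) auto
  have lower: "gauge_fun V x \<le> t" if "0 < t" "(1/t) *\<^sub>R x \<in> V" for t x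
    unfolding gauge_fun_def using that by (intro cInf_lower bdd) auto
  have greatest: "c \<le> gauge_fun V x" if "\<And>t. 0 < t \<Longrightarrow> (1/t) *\<^sub>R x \<in> V \<Longrightarrow> c \<le> t" for c x
    unfolding gauge_fun_def using that by (intro cInf_greatest ne) auto
  show "x \<in> V \<Longrightarrow> gauge_fun V x \<le> 1" using lower[of 1 x] by simp
  show "1 \<le> gauge_fun V x" if "x \<notin> V"
  proof (rule greatest, rule ccontr)
    fix t :: real assume t: "0 < t" "(1/t) *\<^sub>R x \<in> V" "\<not> 1 \<le> t"
    then have "t *\<^sub>R ((1/t) *\<^sub>R x) + (1 - t) *\<^sub>R 0 \<in> V" by (intro convexD[OF V(3)] V) auto
    then show False using t that by simp
  qed
  show "sublinear (gauge_fun V)"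
    unfolding sublinear_def
  proof safe
    fix x y
    have *: "gauge_fun V (x + y) \<le> s + t" if st: "0 < s" "(1/s) *\<^sub>R x \<in> V" "0 < t" "(1/t) *\<^sub>R y \<in> V" for s t
    proof (rule lower)
      have "(s/(s+t)) *\<^sub>R ((1/s) *\<^sub>R x) + (t/(s+t)) *\<^sub>R ((1/t) *\<^sub>R y) \<in> V"
        using st by (intro convexD[OF V(3)]) (simp_all flip: add_divide_distrib)
      then show "(1 / (s + t)) *\<^sub>R (x + y) \<in> V" using st by (simp add: scaleR_right_distrib)
    qed (use st in simp)
    have "gauge_fun V (x + y) - t \<le> gauge_fun V x" if "0 < t" "(1/t) *\<^sub>R y \<in> V" for t
      by (rule greatest) (use *[OF _ _ that] in \<open>simp add: diff_le_eq\<close>)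
    then have "gauge_fun V (x + y) - gauge_fun V x \<le> gauge_fun V y"
      by (intro greatest) (simp add: diff_le_eq add.commute)
    then show "gauge_fun V (x + y) \<le> gauge_fun V x + gauge_fun V y" by simp
  next
    fix c :: real and x assume c: "0 < c"
    have "gauge_fun V (c *\<^sub>R x) / c \<le> gauge_fun V x"
    proof (rule greatest)
      fix t :: real assume "0 < t" "(1/t) *\<^sub>R x \<in> V"
      then have "gauge_fun V (c *\<^sub>R x) \<le> c * t" using c by (intro lower) auto
      then show "gauge_fun V (c *\<^sub>R x) / c \<le> t" using c by (simp add: field_simps)
    qed
    then show "gauge_fun V (c *\<^sub>R x) \<le> c * gauge_fun V x" using c by (simp add: field_simps)
  qed
qed

text \<open>A convex open \<open>V\<close> around 0 that misses \<open>x - y\<close> has gauge at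
  least 1 at \<open>x - y\<close> and at most 1 on \<open>V\<close>. A linear \<open>f\<close> below
  the gauge and touching it at \<open>x - y\<close> is thus nonzero there, and its bound on
  \<open>V\<close> makes it continuous.\<close>

lemma linear_functional_separates:
  fixes x y :: "'a::locally_convex_space"
  assumes "x \<noteq> y"
  shows "\<exists>f. linear f \<and> continuous_on UNIV f \<and> f x \<noteq> (f y :: real)"
proof -
  have "0 \<noteq> x - y" using assms by simp
  then obtain U where "open U" "0 \<in> U" "x - y \<notin> U" using t1_space by blast
  then obtain V where V: "open V" "0 \<in> V" "convex V" "x - y \<notin> V"
    using locally_convex[of U] unfolding convex_def by blast
  note g = gauge_fun[OF V(1-3)]
  obtain f where f: "linear f" "f \<le> gauge_fun V" "gauge_fun V (x - y) \<le> f (x - y)"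
    using sublinear_dominates_linear_at[OF g(1)] by blast
  have ne: "f x \<noteq> f y" using f(3) g(3)[OF V(4)] linear_diff[OF f(1), of x y] by auto
  have "f \<midarrow>a\<rightarrow> f a" for a
  proof (rule tendstoI)
    fix e :: real assume e: "0 < e"
    \<comment> \<open>\<open>V\<close> need not be symmetric, so both \<open>z - a\<close> and
      \<open>a - z\<close> are scaled into it. The factor \<open>2/e\<close> makes the difference of
      the values at most \<open>e/2\<close>, strictly below \<open>e\<close>.\<close>
    have "((\<lambda>z. (2/e) *\<^sub>R (z - a)) \<longlongrightarrow> (2/e) *\<^sub>R (a - a)) (at a)"
      "((\<lambda>z. (2/e) *\<^sub>R (a - z)) \<longlongrightarrow> (2/e) *\<^sub>R (a - a)) (at a)"
      by (intro tendsto_scaleR_lc tendsto_diff tendsto_const tendsto_ident_at)+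
    then have "\<forall>\<^sub>F z in at a. (2/e) *\<^sub>R (z - a) \<in> V" "\<forall>\<^sub>F z in at a. (2/e) *\<^sub>R (a - z) \<in> V"
      using V by (auto intro!: topological_tendstoD)
    then show "\<forall>\<^sub>F z in at a. dist (f z) (f a) < e"
    proof eventually_elim
      fix z assume z: "(2/e) *\<^sub>R (z - a) \<in> V" "(2/e) *\<^sub>R (a - z) \<in> V"
      have "f ((2/e) *\<^sub>R (z - a)) \<le> 1" "f ((2/e) *\<^sub>R (a - z)) \<le> 1"
        using f(2) g(2)[OF z(1)] g(2)[OF z(2)] by (meson le_funD order_trans)+
      then have "(2/e) * (f z - f a) \<le> 1" "(2/e) * (f a - f z) \<le> 1"
        by (simp_all add: linear_scale[OF f(1)] linear_diff[OF f(1)])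
      then show "dist (f z) (f a) < e" using e by (auto simp: dist_real_def field_simps abs_if)
    qed
  qed
  then have "continuous_on UNIV f" by (simp add: continuous_on_def)
  then show ?thesis using f(1) ne by blast
qed

lemma continuous_affine_separates:
  fixes X :: "'a::locally_convex_space set"
  assumes "x \<in> X" "y \<in> X" "x \<noteq> y"  "convex X"
  shows "\<exists>a\<in>continuous_affine X. a x \<noteq> a y"
proof -
  obtain f where f: "linear f" "continuous_on UNIV f" "f x \<noteq> (f y :: real)"
    using linear_functional_separates[OF assms(3)] by blast
  have "continuous_on X (restrict f X)"
    using continuous_on_subset[OF f(2), of X] by (simp cong: continuous_on_cong)
  moreover have "affine_on X (restrict f X)"
    unfolding affine_on_def using convexD[OF assms(4)]
    by (auto simp: linear_add[OF f(1)] linear_scale[OF f(1)])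
  ultimately show ?thesis
    using assms f(3) by (intro bexI[of _ "restrict f X"]) (auto simp: continuous_affine_def)
qed

section \<open>Barycenters\<close>

lemma affine_onD:
  assumes "affine_on X f" "x \<in> X" "y \<in> X" "0 \<le> u" "0 \<le> v" "u + v = 1"
  shows "f (u *\<^sub>R x + v *\<^sub>R y) = u * f x + v * f y"
proof -
  have v: "v = 1 - u" using assms(6) by simp
  have "u \<in> {0..1}" using assms by simp
  then show ?thesis using assms(1-3) unfolding v affine_on_def by blast
qed

lemma affine_on_imp_convex_on:
  assumes "convex X" "affine_on X f"
  shows "convex_on X f" "convex_on X (\<lambda>x. - f x)"
  using assms(1) affine_onD[OF assms(2)] unfolding convex_on_def by auto

lemma affine_on_sum:
  assumes "convex X" "affine_on X f" "finite I" "I \<noteq> {}" "(\<Sum>i\<in>I. c i) = 1"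
    "\<And>i. i \<in> I \<Longrightarrow> 0 \<le> c i" "\<And>i. i \<in> I \<Longrightarrow> y i \<in> X"
  shows "f (\<Sum>i\<in>I. c i *\<^sub>R y i) = (\<Sum>i\<in>I. c i * f (y i))"
proof (rule antisym)
  show "f (\<Sum>i\<in>I. c i *\<^sub>R y i) \<le> (\<Sum>i\<in>I. c i * f (y i))"
    by (rule convex_on_sum[OF assms(3,4) affine_on_imp_convex_on(1)[OF assms(1,2)]]) (use assms in auto)
  have "- f (\<Sum>i\<in>I. c i *\<^sub>R y i) \<le> (\<Sum>i\<in>I. c i * - f (y i))"
    by (rule convex_on_sum[OF assms(3,4) affine_on_imp_convex_on(2)[OF assms(1,2)]]) (use assms in auto)
  then show "(\<Sum>i\<in>I. c i * f (y i)) \<le> f (\<Sum>i\<in>I. c i *\<^sub>R y i)" by (simp add: sum_negf)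
qed

lemma continuous_affineD:
  "a \<in> continuous_affine X \<Longrightarrow> affine_on X a" "a \<in> continuous_affine X \<Longrightarrow> continuous_on X a"
  by (auto simp: continuous_affine_def)

locale compact_convex =
  fixes X :: "'a::locally_convex_space set"
  assumes compact: "compact X" and convex: "convex X"
begin

text \<open>The measure is discretised. The vectors of integer parts of \<open>a / e\<close>, with
  one entry for each pair \<open>(a, e)\<close> in \<open>I\<close>, take finitely many values and
  so cut \<open>X\<close> into finitely many cells. Moving the mass of each cell to a sample point
  changes the integral of \<open>a\<close> by at most \<open>e\<close>, and the discrete measure has
  a convex combination as barycenter.\<close>

lemma barycenter_approx:
  assumes \<mu>: "\<mu> \<in> radon_probabilities X"
    and I: "finite I" "\<And>i. i \<in> I \<Longrightarrow> fst i \<in> continuous_affine X \<and> 0 < snd i"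
  shows "\<exists>x\<in>X. \<forall>i\<in>I. \<bar>fst i x - integral\<^sup>L \<mu> (fst i)\<bar> \<le> snd i"
proof -
  interpret M: finite_measure \<mu> by (rule radonD[OF \<mu>])
  have sp: "space \<mu> = X" by (rule radonD[OF \<mu>])
  define g where "g x = (\<lambda>i\<in>I. \<lfloor>fst i x / snd i\<rfloor>)" for x
  have meas: "fst i \<in> borel_measurable \<mu>" and int: "integrable \<mu> (fst i)" if "i \<in> I" for i
    using I(2)[OF that] by (auto intro: radon_continuous_measurable[OF \<mu>]
        radon_continuous_integrable[OF compact \<mu>] continuous_affineD)
  have "\<exists>C. \<forall>x\<in>X. \<bar>fst i x\<bar> \<le> C" if "i \<in> I" for i
    using continuous_bounded[OF compact continuous_affineD(2), of "fst i"] I(2)[OF that] by metis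
  then obtain C where C: "\<And>i x. i \<in> I \<Longrightarrow> x \<in> X \<Longrightarrow> \<bar>fst i x\<bar> \<le> C i" by metis
  have "g ` X \<subseteq> PiE I (\<lambda>i. {\<lfloor>- C i / snd i\<rfloor>..\<lfloor>C i / snd i\<rfloor>})"
  proof safe
    fix x i assume x: "x \<in> X" and i: "i \<in> I"
    have "- C i / snd i \<le> fst i x / snd i" "fst i x / snd i \<le> C i / snd i"
      using C[OF i x] I(2)[OF i] by (intro divide_right_mono; simp add: abs_le_iff)+
    then show "g x i \<in> {\<lfloor>- C i / snd i\<rfloor>..\<lfloor>C i / snd i\<rfloor>}" using i by (auto simp: g_def intro: floor_mono)
  qed (simp add: g_def)
  then have fin: "finite (g ` X)" by (rule finite_subset) (use I in \<open>auto intro: finite_PiE\<close>)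
  define P where "P v = {x \<in> X. g x = v}" for v
  have P: "P v \<in> sets \<mu>" if "v \<in> g ` X" for v
  proof -
    have "P v = {x \<in> space \<mu>. \<forall>i\<in>I. \<lfloor>fst i x / snd i\<rfloor> = v i}"
      using that by (auto simp: P_def g_def sp fun_eq_iff)
    also have "\<dots> \<in> sets \<mu>" using meas I(1) by measurable
    finally show ?thesis .
  qed
  define s where "s v = (SOME x. x \<in> P v)" for v
  have s: "s v \<in> X" "g (s v) = v" if v: "v \<in> g ` X" for v
  proof -
    have "\<exists>x. x \<in> P v" using v by (auto simp: P_def)
    then have "s v \<in> P v" unfolding s_def by (rule someI_ex)
    then show "s v \<in> X" "g (s v) = v" by (auto simp: P_def)
  qed
  have one: "(\<Sum>v\<in>g ` X. measure \<mu> (P v)) = 1"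
  proof -
    have "measure \<mu> (\<Union>v\<in>g ` X. P v) = (\<Sum>v\<in>g ` X. measure \<mu> (P v))"
      using P fin by (intro M.finite_measure_finite_Union) (auto simp: disjoint_family_on_def P_def)
    moreover have "(\<Union>v\<in>g ` X. P v) = X" by (auto simp: P_def)
    ultimately show ?thesis using radonD(4)[OF \<mu>] by simp
  qed
  define x where "x = (\<Sum>v\<in>g ` X. measure \<mu> (P v) *\<^sub>R s v)"
  have "x \<in> X" unfolding x_def
    by (rule convex_sum[OF fin convex one]) (auto intro: s)
  moreover have "\<bar>fst i x - integral\<^sup>L \<mu> (fst i)\<bar> \<le> snd i" if i: "i \<in> I" for i
  proof -
    let ?a = "fst i" and ?e = "snd i"
    let ?h = "\<lambda>y. \<Sum>v\<in>g ` X. indicator (P v) y * ?a (s v)"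
    have inth: "integrable \<mu> ?h"
      by (intro Bochner_Integration.integrable_sum integrable_mult_left radon_indicator(1)[OF \<mu>] P)
    have "?a x = (\<Sum>v\<in>g ` X. measure \<mu> (P v) * ?a (s v))"
      unfolding x_def
      using I(2)[OF i] fin one s radon_nonempty[OF \<mu>]
      by (intro affine_on_sum[OF convex]) (auto intro: continuous_affineD)
    also have "\<dots> = integral\<^sup>L \<mu> ?h"
      using radon_indicator[OF \<mu> P] by (subst Bochner_Integration.integral_sum) auto
    finally have ax: "?a x = integral\<^sup>L \<mu> ?h" .
    have h: "?h y = ?a (s (g y))" if y: "y \<in> X" for y
    proof -
      have "?h y = (\<Sum>v\<in>g ` X. if v = g y then ?a (s v) else 0)"
        using y by (intro sum.cong) (auto simp: P_def)
      then show ?thesis using fin y by simp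
    qed
    have close: "\<bar>?h y - ?a y\<bar> \<le> ?e" if y: "y \<in> X" for y
    proof -
      have "g (s (g y)) = g y" using s y by auto
      moreover have "g z i = \<lfloor>?a z / ?e\<rfloor>" for z using i by (simp add: g_def)
      ultimately have "\<lfloor>?a (s (g y)) / ?e\<rfloor> = \<lfloor>?a y / ?e\<rfloor>" by metis
      then have "\<bar>?a (s (g y)) / ?e - ?a y / ?e\<bar> \<le> 1" by linarith
      then have "\<bar>?a (s (g y)) - ?a y\<bar> / ?e \<le> 1" using I(2)[OF i] by (simp add: diff_divide_distrib[symmetric])
      then show ?thesis using I(2)[OF i] h[OF y] by (simp add: divide_le_eq)
    qed
    have "\<bar>integral\<^sup>L \<mu> ?h - integral\<^sup>L \<mu> ?a\<bar> = \<bar>integral\<^sup>L \<mu> (\<lambda>y. ?h y - ?a y)\<bar>"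
      using inth int[OF i] by (subst Bochner_Integration.integral_diff) auto
    also have "\<dots> \<le> integral\<^sup>L \<mu> (\<lambda>y. \<bar>?h y - ?a y\<bar>)" by (rule integral_abs_bound)
    also have "\<dots> \<le> integral\<^sup>L \<mu> (\<lambda>y. ?e)"
      using inth int[OF i] close sp by (intro integral_mono) auto
    also have "\<dots> = ?e" by (rule radon_integral_const[OF \<mu>])
    finally show ?thesis using ax by simp
  qed
  ultimately show ?thesis by blast
qed

text \<open>By the approximate version the closed sets \<open>?C i\<close> have the finite
  intersection property; a point common to all of them meets every constraint with every positive
  tolerance.\<close>

lemma barycenter_exists:
  assumes \<mu>: "\<mu> \<in> radon_probabilities X"
  shows "\<exists>x\<in>X. \<forall>a\<in>continuous_affine X. a x = integral\<^sup>L \<mu> a"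
proof -
  let ?C = "\<lambda>i. {x \<in> X. - snd i \<le> - \<bar>fst i x - integral\<^sup>L \<mu> (fst i)\<bar>}"
  let ?I = "continuous_affine X \<times> {0::real<..}"
  have "X \<inter> (\<Inter>i\<in>?I. ?C i) \<noteq> {}"
  proof (rule compact_imp_fip_image[OF compact])
    fix i assume "i \<in> ?I"
    then show "closed (?C i)"
      by (intro continuous_on_superlevel_closed compact continuous_intros continuous_affineD(2)) auto
  next
    fix J assume J: "finite J" "J \<subseteq> ?I"
    have "\<exists>x\<in>X. \<forall>i\<in>J. \<bar>fst i x - integral\<^sup>L \<mu> (fst i)\<bar> \<le> snd i"
      by (rule barycenter_approx[OF \<mu> J(1)]) (use J(2) in auto)
    then show "X \<inter> (\<Inter>i\<in>J. ?C i) \<noteq> {}" by auto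
  qed
  then obtain x where x: "x \<in> X" "\<And>i. i \<in> ?I \<Longrightarrow> x \<in> ?C i" by auto
  have "a x = integral\<^sup>L \<mu> a" if a: "a \<in> continuous_affine X" for a
  proof -
    have "\<bar>a x - integral\<^sup>L \<mu> a\<bar> \<le> 0 + e" if "0 < e" for e
      using x(2)[of "(a, e)"] a that by simp
    then have "\<bar>a x - integral\<^sup>L \<mu> a\<bar> \<le> 0" by (rule field_le_epsilon)
    then show ?thesis by simp
  qed
  then show ?thesis using x(1) by blast
qed

lemma continuous_affine_eqI:
  assumes "x \<in> X" "y \<in> X" "\<And>a. a \<in> continuous_affine X \<Longrightarrow> a x = a y"
  shows "x = y"
  using continuous_affine_separates[OF assms(1,2) _ convex] assms(3) by blast

lemma barycenterI:
  assumes "x \<in> X" "\<And>a. a \<in> continuous_affine X \<Longrightarrow> a x = integral\<^sup>L \<mu> a"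
  shows "barycenter X \<mu> = x"
  unfolding barycenter_def
proof (rule the_equality)
  show "y = x" if "y \<in> X \<and> (\<forall>a\<in>continuous_affine X. a y = integral\<^sup>L \<mu> a)" for y
    using that assms by (intro continuous_affine_eqI) auto
qed (use assms in blast)

lemma barycenter:
  assumes "\<mu> \<in> radon_probabilities X"
  shows "barycenter X \<mu> \<in> X" "a \<in> continuous_affine X \<Longrightarrow> integral\<^sup>L \<mu> a = a (barycenter X \<mu>)"
proof -
  obtain x where x: "x \<in> X" "\<And>a. a \<in> continuous_affine X \<Longrightarrow> a x = integral\<^sup>L \<mu> a"
    using barycenter_exists[OF assms] by blast
  then have "barycenter X \<mu> = x" by (rule barycenterI)
  then show "barycenter X \<mu> \<in> X" "a \<in> continuous_affine X \<Longrightarrow> integral\<^sup>L \<mu> a = a (barycenter X \<mu>)"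
    using x by simp_all
qed

lemma continuous_affine_strongly_affine: "continuous_affine X \<subseteq> strongly_affine X"
  using barycenter(2) radon_continuous_integrable[OF compact]
  by (auto simp: strongly_affine_def continuous_affine_def)

section \<open>Conditioning a measure on a set\<close>

lemma conditional_radon:
  assumes \<mu>: "\<mu> \<in> radon_probabilities X" and A: "A \<in> sets \<mu>" "0 < measure \<mu> A"
  defines "\<nu> \<equiv> completion (uniform_measure \<mu> A)"
  shows "\<nu> \<in> radon_probabilities X"
    and "integrable \<mu> h \<Longrightarrow> integral\<^sup>L \<nu> h = integral\<^sup>L \<mu> (\<lambda>x. indicator A x * (h x :: real)) / measure \<mu> A"
proof -
  interpret M: finite_measure \<mu> by (rule radonD[OF \<mu>])
  have eA: "emeasure \<mu> A = ennreal (measure \<mu> A)" by (rule M.emeasure_eq_measure)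
  show "\<nu> \<in> radon_probabilities X"
    unfolding radon_probabilities_def
  proof (intro CollectI conjI ballI)
    have "emeasure (uniform_measure \<mu> A) (space \<mu>) = 1"
      using A eA sets.sets_into_space[OF A(1)]
      by (simp add: Int_absorb2 divide_ennreal)
    then show "emeasure \<nu> (space \<nu>) = 1" by (simp add: \<nu>_def)
    show "space \<nu> = X" using radonD(1)[OF \<mu>] by (simp add: \<nu>_def)
    \<comment> \<open>Conditioning makes every subset of \<open>X - A\<close> negligible, whether
      \<open>\<mu>\<close>-measurable or not; this is why \<open>\<nu>\<close> is defined as a
      completion.\<close>
    show "complete_measure \<nu>" unfolding \<nu>_def by (rule completion.complete_measure_axioms)
    show "sets (restrict_space borel X) \<subseteq> sets \<nu>"
      using \<mu> by (auto simp: radon_probabilities_def \<nu>_def)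
    fix B assume "B \<in> sets \<nu>"
    then have B: "B \<in> sets (completion (uniform_measure \<mu> A))" by (simp add: \<nu>_def)
    \<comment> \<open>\<open>?B\<close> is a \<open>\<mu>\<close>-measurable subset of
      \<open>B\<close> with the same conditional mass, so compact subsets of
      \<open>A \<inter> ?B\<close> already exhaust \<open>B\<close>.\<close>
    let ?B = "main_part (uniform_measure \<mu> A) B"
    have mB: "?B \<in> sets \<mu>" "?B \<subseteq> B"
      using main_part_sets[OF B] main_part_null_part_Un[OF B] by auto
    have AB: "A \<inter> ?B \<in> sets \<mu>" using A(1) mB(1) by auto
    have "emeasure \<nu> B = emeasure \<mu> (A \<inter> ?B) / emeasure \<mu> A"
      using B A mB by (simp add: \<nu>_def)
    also have "\<dots> = (SUP K\<in>{K. compact K \<and> K \<subseteq> A \<inter> ?B}. emeasure \<mu> K / emeasure \<mu> A)"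
      unfolding radonD(6)[OF \<mu> AB] by (rule SUP_divide_ennreal)
    also have "\<dots> \<le> (SUP K\<in>{K. compact K \<and> K \<subseteq> B}. emeasure \<nu> K)"
    proof (rule SUP_mono)
      fix K assume "K \<in> {K. compact K \<and> K \<subseteq> A \<inter> ?B}"
      then have K: "compact K" "K \<subseteq> A" "K \<subseteq> ?B" by auto
      then have "K \<subseteq> X" using sets.sets_into_space[OF A(1)] radonD(1)[OF \<mu>] by auto
      then have "K \<in> sets \<mu>" by (rule radon_compact[OF \<mu> K(1)])
      then have "emeasure \<nu> K = emeasure \<mu> K / emeasure \<mu> A"
        using K A by (simp add: \<nu>_def Int_absorb1)
      then show "\<exists>K'\<in>{K. compact K \<and> K \<subseteq> B}. emeasure \<mu> K / emeasure \<mu> A \<le> emeasure \<nu> K'"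
        using K mB by (intro bexI[of _ K]) auto
    qed
    finally show "emeasure \<nu> B = (SUP K\<in>{K. compact K \<and> K \<subseteq> B}. emeasure \<nu> K)"
      by (intro antisym SUP_least emeasure_mono \<open>B \<in> sets \<nu>\<close>) auto
  qed
  have um: "uniform_measure \<mu> A = density \<mu> (\<lambda>x. ennreal (indicator A x / measure \<mu> A))"
    unfolding uniform_measure_def eA using A(2)
      divide_ennreal[of 1 "measure \<mu> A"]
    by (intro arg_cong[where f="density \<mu>"] ext) (auto simp: indicator_def)
  assume h: "integrable \<mu> h"
  have "integral\<^sup>L \<nu> h = integral\<^sup>L (uniform_measure \<mu> A) h"
    unfolding \<nu>_def using h by (intro integral_completion) auto
  also have "\<dots> = integral\<^sup>L \<mu> (\<lambda>x. (indicator A x / measure \<mu> A) *\<^sub>R h x)"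
    unfolding um using A h by (intro integral_density) auto
  also have "\<dots> = integral\<^sup>L \<mu> (\<lambda>x. indicator A x * h x) / measure \<mu> A"
    by simp
  finally show "integral\<^sup>L \<nu> h = integral\<^sup>L \<mu> (\<lambda>x. indicator A x * h x) / measure \<mu> A" .
qed

lemma strongly_affineD:
  assumes "h \<in> strongly_affine X" "\<mu> \<in> radon_probabilities X"
  shows "integrable \<mu> h" "integral\<^sup>L \<mu> h = h (barycenter X \<mu>)"
  using assms by (auto simp: strongly_affine_def)

text \<open>\<open>b\<close> and \<open>c\<close> are the barycenters of \<open>\<mu>\<close>
  conditioned on \<open>A\<close> and on its complement. Strong affinity evaluates every
  \<open>h\<close> at them, continuous or not; this is what later applies to a monotone limit of
  elements of \<open>H\<close>.\<close>

lemma barycenter_split: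
  assumes \<mu>: "\<mu> \<in> radon_probabilities X" and A: "A \<in> sets \<mu>" "0 < measure \<mu> A" "measure \<mu> A < 1"
  shows "\<exists>b\<in>X. \<exists>c\<in>X. barycenter X \<mu> = measure \<mu> A *\<^sub>R b + (1 - measure \<mu> A) *\<^sub>R c \<and>
    (\<forall>h\<in>strongly_affine X. measure \<mu> A * h b = integral\<^sup>L \<mu> (\<lambda>x. indicator A x * h x) \<and>
      (1 - measure \<mu> A) * h c = integral\<^sup>L \<mu> (\<lambda>x. indicator (X - A) x * h x))"
proof -
  interpret M: finite_measure \<mu> by (rule radonD[OF \<mu>])
  let ?p = "measure \<mu> A"
  have B: "X - A \<in> sets \<mu>" "measure \<mu> (X - A) = 1 - ?p"
    using sets.compl_sets[OF A(1)] M.finite_measure_compl[OF A(1)] radonD[OF \<mu>] by auto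
  note \<nu>1 = conditional_radon[OF \<mu> A(1,2)]
  have "0 < measure \<mu> (X - A)" using A B by simp
  note \<nu>2 = conditional_radon[OF \<mu> B(1) this]
  define b c where "b = barycenter X (completion (uniform_measure \<mu> A))"
    and "c = barycenter X (completion (uniform_measure \<mu> (X - A)))"
  have bc: "b \<in> X" "c \<in> X" unfolding b_def c_def by (intro barycenter \<nu>1(1) \<nu>2(1))+
  have h: "?p * h b = integral\<^sup>L \<mu> (\<lambda>x. indicator A x * h x)"
    "(1 - ?p) * h c = integral\<^sup>L \<mu> (\<lambda>x. indicator (X - A) x * h x)" if h: "h \<in> strongly_affine X" for h
  proof -
    have "h b = integral\<^sup>L \<mu> (\<lambda>x. indicator A x * h x) / ?p"
      "h c = integral\<^sup>L \<mu> (\<lambda>x. indicator (X - A) x * h x) / (1 - ?p)"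
      using strongly_affineD(2)[OF h \<nu>1(1)] strongly_affineD(2)[OF h \<nu>2(1)]
        \<nu>1(2)[OF strongly_affineD(1)[OF h \<mu>]] \<nu>2(2)[OF strongly_affineD(1)[OF h \<mu>]] B
      by (simp_all add: b_def c_def)
    then show "?p * h b = integral\<^sup>L \<mu> (\<lambda>x. indicator A x * h x)"
      "(1 - ?p) * h c = integral\<^sup>L \<mu> (\<lambda>x. indicator (X - A) x * h x)" using A by simp_all
  qed
  have "barycenter X \<mu> = ?p *\<^sub>R b + (1 - ?p) *\<^sub>R c"
  proof (rule barycenterI)
    show "?p *\<^sub>R b + (1 - ?p) *\<^sub>R c \<in> X" using bc A convexD[OF convex] by simp
    fix a assume a: "a \<in> continuous_affine X"
    then have as: "a \<in> strongly_affine X" using continuous_affine_strongly_affine by blast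
    note ai = strongly_affineD(1)[OF as \<mu>]
    have "a (?p *\<^sub>R b + (1 - ?p) *\<^sub>R c) = ?p * a b + (1 - ?p) * a c"
      using A bc by (intro affine_onD[OF continuous_affineD(1)[OF a]]) auto
    also have "\<dots> = integral\<^sup>L \<mu> (\<lambda>x. indicator A x * a x) + integral\<^sup>L \<mu> (\<lambda>x. indicator (X - A) x * a x)"
      using h[OF as] by simp
    also have "\<dots> = integral\<^sup>L \<mu> (\<lambda>x. indicator A x * a x + indicator (X - A) x * a x)"
      using integrable_mult_indicator[OF A(1) ai] integrable_mult_indicator[OF B(1) ai]
      by (subst Bochner_Integration.integral_add) auto
    also have "\<dots> = integral\<^sup>L \<mu> a"
      using radonD(1)[OF \<mu>] by (intro Bochner_Integration.integral_cong) (auto simp: indicator_def)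
    finally show "a (?p *\<^sub>R b + (1 - ?p) *\<^sub>R c) = integral\<^sup>L \<mu> a" .
  qed
  then show ?thesis using bc h by blast
qed

section \<open>Measures with an extreme barycenter\<close>

lemma extD:
  assumes "x \<in> ext X" "b \<in> X" "c \<in> X" "0 < p" "p < 1" "x = p *\<^sub>R b + (1 - p) *\<^sub>R c"
  shows "b = x" "c = x"
proof -
  have "b = c"
  proof (rule ccontr)
    assume "b \<noteq> c"
    then have "x \<in> open_segment c b" using assms by (auto simp: in_segment intro!: exI[of _ p])
    then show False using assms by (auto simp: ext_def extreme_point_of_def open_segment_commute)
  qed
  then show "b = x" "c = x" using assms(6) by (simp_all flip: scaleR_left_distrib)
qed

text \<open>The mean of \<open>a\<close> over \<open>?A\<close> exceeds \<open>a x\<close>. If the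
  mass of \<open>?A\<close> were strictly between 0 and 1, then \<open>x\<close> would be a proper
  convex combination of two conditional barycenters; extremality makes the first one equal to
  \<open>x\<close>, yet the value of \<open>a\<close> there is that mean. Mass 1 contradicts
  \<open>a x\<close> being the integral of \<open>a\<close>.\<close>

lemma extreme_no_mass:
  assumes x: "x \<in> ext X" and \<mu>: "\<mu> \<in> radon_probabilities X" "barycenter X \<mu> = x"
    and a: "affine_on X a" "continuous_on X a"
  shows "measure \<mu> {y \<in> X. a x < a y} = 0"
proof (rule ccontr)
  let ?A = "{y \<in> X. a x < a y}" and ?a = "restrict a X"
  assume "measure \<mu> ?A \<noteq> 0"
  interpret M: finite_measure \<mu> by (rule radonD[OF \<mu>(1)])
  have sp: "space \<mu> = X" by (rule radonD[OF \<mu>(1)])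
  have xX: "x \<in> X" using x by (auto simp: ext_def extreme_point_of_def)
  have am: "a \<in> borel_measurable \<mu>" by (rule radon_continuous_measurable[OF \<mu>(1) a(2)])
  have A: "?A \<in> sets \<mu>" using borel_measurable_less[OF borel_measurable_const am, of "a x"] sp by simp
  have p: "0 < measure \<mu> ?A" using \<open>measure \<mu> ?A \<noteq> 0\<close> by (simp add: zero_less_measure_iff)
  have ca: "?a \<in> continuous_affine X"
    using a convexD[OF convex] by (auto simp: continuous_affine_def affine_on_def cong: continuous_on_cong)
  then have sa: "?a \<in> strongly_affine X" using continuous_affine_strongly_affine by blast
  have ai: "integrable \<mu> a" by (rule radon_continuous_integrable[OF compact \<mu>(1) a(2)])
  have "0 < integral\<^sup>L \<mu> (\<lambda>y. indicator ?A y * (a y - a x))"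
  proof -
    have int: "integrable \<mu> (\<lambda>y. indicator ?A y * (a y - a x))"
      using integrable_mult_indicator[OF A, of "\<lambda>y. a y - a x"] ai by simp
    have "\<not> (AE y in \<mu>. indicator ?A y * (a y - a x) = 0)"
    proof
      assume "AE y in \<mu>. indicator ?A y * (a y - a x) = 0"
      then have "AE y in \<mu>. y \<notin> ?A" by eventually_elim (auto simp: indicator_def split: if_splits)
      then show False using p A M.emeasure_eq_measure[of ?A] by (simp add: AE_iff_measurable[OF A] sp)
    qed
    then have "integral\<^sup>L \<mu> (\<lambda>y. indicator ?A y * (a y - a x)) \<noteq> 0"
      using integral_nonneg_eq_0_iff_AE[OF int] by (auto simp: indicator_def)
    moreover have "0 \<le> integral\<^sup>L \<mu> (\<lambda>y. indicator ?A y * (a y - a x))"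
      by (intro Bochner_Integration.integral_nonneg) (auto simp: indicator_def)
    ultimately show ?thesis by simp
  qed
  also have "integral\<^sup>L \<mu> (\<lambda>y. indicator ?A y * (a y - a x)) =
      integral\<^sup>L \<mu> (\<lambda>y. indicator ?A y * ?a y) - measure \<mu> ?A * a x"
  proof -
    have "integral\<^sup>L \<mu> (\<lambda>y. indicator ?A y * (a y - a x)) =
        integral\<^sup>L \<mu> (\<lambda>y. indicator ?A y * a y - indicator ?A y * a x)"
      by (simp add: algebra_simps)
    also have "\<dots> = integral\<^sup>L \<mu> (\<lambda>y. indicator ?A y * a y) - measure \<mu> ?A * a x"
      using integrable_mult_indicator[OF A ai] radon_indicator[OF \<mu>(1) A]
      by (subst Bochner_Integration.integral_diff) auto
    also have "integral\<^sup>L \<mu> (\<lambda>y. indicator ?A y * a y) = integral\<^sup>L \<mu> (\<lambda>y. indicator ?A y * ?a y)"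
      using sp by (intro Bochner_Integration.integral_cong) auto
    finally show ?thesis .
  qed
  finally have *: "measure \<mu> ?A * a x < integral\<^sup>L \<mu> (\<lambda>y. indicator ?A y * ?a y)" by simp
  show False
  proof (cases "measure \<mu> ?A < 1")
    case True
    obtain b c where bc: "b \<in> X" "c \<in> X" "x = measure \<mu> ?A *\<^sub>R b + (1 - measure \<mu> ?A) *\<^sub>R c"
      "measure \<mu> ?A * ?a b = integral\<^sup>L \<mu> (\<lambda>y. indicator ?A y * ?a y)"
      using barycenter_split[OF \<mu>(1) A p True] sa \<mu>(2) by blast
    have "b = x" by (rule extD(1)[OF x bc(1,2) p True bc(3)])
    then show False using * bc xX by simp
  next
    case False
    then have 1: "measure \<mu> ?A = 1" using M.bounded_measure[of ?A] radonD(4)[OF \<mu>(1)] sp by simp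
    have "AE y in \<mu>. y \<in> ?A"
      using M.finite_measure_compl[OF A] 1 radonD(4)[OF \<mu>(1)] sp A
      by (intro AE_I[of _ _ "X - ?A"]) (auto simp: M.emeasure_eq_measure sets.compl_sets)
    then have "AE y in \<mu>. indicator ?A y * ?a y = ?a y" by eventually_elim simp
    then have "integral\<^sup>L \<mu> (\<lambda>y. indicator ?A y * ?a y) = integral\<^sup>L \<mu> ?a"
      using borel_measurable_integrable[OF strongly_affineD(1)[OF sa \<mu>(1)]] A
      by (intro integral_cong_AE borel_measurable_times borel_measurable_indicator)
    then show False using * 1 barycenter(2)[OF \<mu>(1) ca] \<mu>(2) xX by simp
  qed
qed

text \<open>The null sets \<open>[a > a x]\<close> cover \<open>X - {x}\<close>, but there may be
  uncountably many of them. Inner regularity replaces \<open>X - {x}\<close> by a compact set of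
  positive mass, which finitely many of them cover.\<close>

lemma extreme_barycenter_AE:
  assumes x: "x \<in> ext X" and \<mu>: "\<mu> \<in> radon_probabilities X" "barycenter X \<mu> = x"
  shows "AE y in \<mu>. y = x"
proof (rule ccontr)
  assume no: "\<not> (AE y in \<mu>. y = x)"
  interpret M: finite_measure \<mu> by (rule radonD[OF \<mu>(1)])
  have sp: "space \<mu> = X" by (rule radonD[OF \<mu>(1)])
  have xX: "x \<in> X" using x by (auto simp: ext_def extreme_point_of_def)
  have B: "X - {x} \<in> sets \<mu>"
    using sets.compl_sets[OF radon_compact[OF \<mu>(1), of "{x}"]] xX sp by simp
  have "emeasure \<mu> (X - {x}) \<noteq> 0"
    using no AE_I[of \<mu> "\<lambda>y. y = x" "X - {x}"] B sp by auto
  then have "0 < emeasure \<mu> (X - {x})" by (simp add: zero_less_iff_neq_zero)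
  then obtain K where K: "compact K" "K \<subseteq> X - {x}" "0 < emeasure \<mu> K"
    unfolding radonD(6)[OF \<mu>(1) B] less_SUP_iff by blast
  define S where "S a = - {y \<in> X. - a x \<le> - a y}" for a :: "'a \<Rightarrow> real"
  let ?\<A> = "{a. affine_on X a \<and> continuous_on X a}"
  have cover: "K \<subseteq> (\<Union>a\<in>?\<A>. S a)"
  proof
    fix y assume y: "y \<in> K"
    then obtain a where a: "a \<in> continuous_affine X" "a x \<noteq> a y"
      using continuous_affine_separates[OF xX _ _ convex, of y] K(2) by blast
    have "(\<lambda>z. - a z) \<in> ?\<A>" "a \<in> ?\<A>"
      using continuous_affineD[OF a(1)]
      by (auto simp: affine_on_def algebra_simps intro: continuous_on_minus)
    moreover have "y \<in> S a \<or> y \<in> S (\<lambda>z. - a z)" using a(2) y K by (auto simp: S_def)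
    ultimately show "y \<in> (\<Union>a\<in>?\<A>. S a)" by blast
  qed
  have "open (S a)" if "a \<in> ?\<A>" for a
    unfolding S_def using that
    by (intro open_Compl continuous_on_superlevel_closed compact continuous_on_minus) auto
  then obtain F where F: "F \<subseteq> ?\<A>" "finite F" "K \<subseteq> (\<Union>a\<in>F. S a)"
    using compactE_image[OF K(1), of ?\<A> S] cover by metis
  have null: "{y \<in> X. a x < a y} \<in> null_sets \<mu>" if "a \<in> F" for a
  proof (rule null_setsI)
    have a: "affine_on X a" "continuous_on X a" using that F by auto
    show "emeasure \<mu> {y \<in> X. a x < a y} = 0"
      using extreme_no_mass[OF x \<mu> a] by (simp add: M.emeasure_eq_measure)
    show "{y \<in> X. a x < a y} \<in> sets \<mu>"
      using borel_measurable_less[OF borel_measurable_const radon_continuous_measurable[OF \<mu>(1) a(2)], of "a x"] sp by simp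
  qed
  have "(\<Union>a\<in>F. {y \<in> X. a x < a y}) \<in> null_sets \<mu>"
    using F(2) null by (intro null_sets.finite_UN) auto
  moreover have "K \<subseteq> (\<Union>a\<in>F. {y \<in> X. a x < a y})" using F(3) K(2) by (force simp: S_def)
  ultimately have "emeasure \<mu> K \<le> 0"
    using emeasure_mono[of K "\<Union>a\<in>F. {y \<in> X. a x < a y}" \<mu>] by (simp add: null_sets_def)
  then show False using K(3) by simp
qed

end

section \<open>Maximal measures\<close>

text \<open>Exponentials combine two properties: products of generators are generators, since
  exponents add, and every generator is convex, so the Choquet order controls its integrals.
  Products of affine functions themselves need not be convex.\<close>

inductive_set exp_span :: "'a::{real_vector, topological_space} set \<Rightarrow> ('a \<Rightarrow> real) set" for X
  where
    exp: "affine_on X a \<Longrightarrow> continuous_on X a \<Longrightarrow> (\<lambda>x. exp (a x)) \<in> exp_span X"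
  | add: "f \<in> exp_span X \<Longrightarrow> g \<in> exp_span X \<Longrightarrow> (\<lambda>x. f x + g x) \<in> exp_span X"
  | cmult: "f \<in> exp_span X \<Longrightarrow> (\<lambda>x. c * f x) \<in> exp_span X"

lemma exp_span_continuous: "f \<in> exp_span X \<Longrightarrow> continuous_on X f"
  by (induction rule: exp_span.induct) (auto intro!: continuous_intros)

lemma exp_span_mult:
  assumes "f \<in> exp_span X" "g \<in> exp_span X"
  shows "(\<lambda>x. f x * g x) \<in> exp_span X"
  using assms
proof (induction arbitrary: g rule: exp_span.induct)
  case (exp a)
  from exp(3) exp(1,2) show ?case
  proof (induction rule: exp_span.induct)
    case (exp b)
    have "affine_on X (\<lambda>x. a x + b x)"
      using exp unfolding affine_on_def by (simp add: distrib_left)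
    then have "(\<lambda>x. exp (a x + b x)) \<in> exp_span X"
      using exp by (intro exp_span.exp continuous_on_add)
    then show ?case by (simp add: exp_add)
  next
    case (add f g)
    then show ?case using exp_span.add[of "\<lambda>x. exp (a x) * f x" X "\<lambda>x. exp (a x) * g x"]
      by (simp add: distrib_left)
  next
    case (cmult f c)
    then show ?case using exp_span.cmult[of "\<lambda>x. exp (a x) * f x" X c] by (simp add: ac_simps)
  qed
next
  case (add f h)
  then show ?case using exp_span.add[of "\<lambda>x. f x * g x" X "\<lambda>x. h x * g x"] by (simp add: distrib_right)
next
  case (cmult f c)
  then have "(\<lambda>x. c * (f x * g x)) \<in> exp_span X" by (intro exp_span.cmult)
  then show ?case by (simp add: mult.assoc)
qed

lemma convex_on_exp_affine:
  assumes "convex X" "affine_on X a"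
  shows "convex_on X (\<lambda>x. exp (a x))"
  unfolding convex_on_def
proof (intro conjI ballI allI impI)
  fix x y and u v :: real assume xy: "x \<in> X" "y \<in> X" and uv: "0 \<le> u" "0 \<le> v" "u + v = 1"
  have "exp (a (u *\<^sub>R x + v *\<^sub>R y)) = exp (u *\<^sub>R a x + v *\<^sub>R a y)"
    using affine_onD[OF assms(2) xy uv] by simp
  also have "\<dots> \<le> u * exp (a x) + v * exp (a y)"
    using exp_convex uv unfolding convex_on_def by blast
  finally show "exp (a (u *\<^sub>R x + v *\<^sub>R y)) \<le> u * exp (a x) + v * exp (a y)" .
qed (rule assms)

text \<open>A Cauchy criterion along a filter: constants approximating \<open>h\<close> to within
  \<open>1/(n+1)\<close> form a Cauchy sequence, and its limit is the limit of
  \<open>h\<close>.\<close>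

lemma filterlim_approximable_real:
  fixes h :: "'b \<Rightarrow> real"
  assumes F: "F \<noteq> bot" and *: "\<And>e. 0 < e \<Longrightarrow> \<exists>l. \<forall>\<^sub>F x in F. \<bar>h x - l\<bar> \<le> e"
  shows "\<exists>l. (h \<longlongrightarrow> l) F"
proof -
  have "\<exists>l. \<forall>\<^sub>F x in F. \<bar>h x - l\<bar> \<le> inverse (real (Suc n))" for n by (rule *) simp
  then obtain l where l: "\<And>n. \<forall>\<^sub>F x in F. \<bar>h x - l n\<bar> \<le> inverse (real (Suc n))" by metis
  have close: "\<bar>l m - l n\<bar> \<le> inverse (real (Suc m)) + inverse (real (Suc n))" for m n
  proof -
    have "\<forall>\<^sub>F x in F. \<bar>l m - l n\<bar> \<le> inverse (real (Suc m)) + inverse (real (Suc n))"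
      using l[of m] l[of n] by eventually_elim linarith
    then show ?thesis using F by simp
  qed
  have "Cauchy l"
  proof (rule metric_CauchyI)
    fix e :: real assume "0 < e"
    then obtain N where N: "inverse (real (Suc N)) < e / 2" using reals_Archimedean[of "e/2"] by auto
    have "dist (l m) (l n) < e" if "N \<le> m" "N \<le> n" for m n
    proof -
      have "inverse (real (Suc m)) \<le> inverse (real (Suc N))" "inverse (real (Suc n)) \<le> inverse (real (Suc N))"
        using that by (auto intro!: le_imp_inverse_le)
      then show ?thesis using close[of m n] N unfolding dist_real_def by linarith
    qed
    then show "\<exists>M. \<forall>m\<ge>M. \<forall>n\<ge>M. dist (l m) (l n) < e" by blast
  qed
  then obtain L where L: "l \<longlonglongrightarrow> L" using Cauchy_convergent convergent_def by blast
  have "(h \<longlongrightarrow> L) F"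
  proof (rule tendstoI)
    fix e :: real assume e: "0 < e"
    have "\<forall>\<^sub>F n in sequentially. \<bar>l n - L\<bar> < e / 2"
      using tendstoD[OF L, of "e/2"] e by (simp add: dist_real_def)
    moreover have "\<forall>\<^sub>F n in sequentially. inverse (real (Suc n)) < e / 2"
      using order_tendstoD(2)[OF LIMSEQ_inverse_real_of_nat, of "e/2"] e by simp
    ultimately have "\<forall>\<^sub>F n in sequentially. \<bar>l n - L\<bar> < e / 2 \<and> inverse (real (Suc n)) < e / 2"
      by eventually_elim simp
    then obtain n where n: "\<bar>l n - L\<bar> < e / 2" "inverse (real (Suc n)) < e / 2"
      by (auto simp: eventually_sequentially)
    show "\<forall>\<^sub>F x in F. dist (h x) L < e"
      using l[of n] unfolding dist_real_def by eventually_elim (use n in linarith)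
  qed
  then show ?thesis by blast
qed

context compact_convex
begin

lemma exp_span_dense:
  assumes "continuous_on X f" "0 < e"
  shows "\<exists>g\<in>exp_span X. \<forall>x\<in>X. \<bar>f x - g x\<bar> < e"
proof -
  interpret function_ring_on "exp_span X" X
  proof
    show "(\<lambda>_. c) \<in> exp_span X" for c
      using exp_span.cmult[OF exp_span.exp[of X "\<lambda>_. 0"], of c] by (simp add: affine_on_def)
    show "\<exists>f\<in>exp_span X. f x \<noteq> f y" if xy: "x \<in> X" "y \<in> X" "x \<noteq> y" for x y
    proof -
      obtain a where "a \<in> continuous_affine X" "a x \<noteq> a y"
        using continuous_affine_separates[OF xy convex] by blast
      then show ?thesis
        by (intro bexI[of _ "\<lambda>x. exp (a x)"] exp_span.exp) (auto intro: continuous_affineD)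
    qed
  qed (auto intro: compact exp_span_continuous exp_span.add exp_span_mult)
  show ?thesis by (rule Stone_Weierstrass_basic[OF assms])
qed

text \<open>Reduces statements on continuous functions to convex ones: the first three cases reach
  the exponential span, the last one its uniform closure. It serves both for equality of integrals
  and for convergence along a chain.\<close>

lemma continuous_function_induct [consumes 1, case_names convex add cmult approx]:
  assumes f: "continuous_on X f"
    and convex: "\<And>f. convex_on X f \<Longrightarrow> continuous_on X f \<Longrightarrow> P f"
    and add: "\<And>f g. continuous_on X f \<Longrightarrow> continuous_on X g \<Longrightarrow> P f \<Longrightarrow> P g \<Longrightarrow> P (\<lambda>x. f x + g x)"
    and cmult: "\<And>c f. continuous_on X f \<Longrightarrow> P f \<Longrightarrow> P (\<lambda>x. c * f x)"
    and approx: "\<And>f. continuous_on X f \<Longrightarrow>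
      (\<And>e. 0 < e \<Longrightarrow> \<exists>g. continuous_on X g \<and> P g \<and> (\<forall>x\<in>X. \<bar>f x - g x\<bar> \<le> e)) \<Longrightarrow> P f"
  shows "P (f :: 'a \<Rightarrow> real)"
proof -
  have span: "P g" if "g \<in> exp_span X" for g
    using that
  proof (induction rule: exp_span.induct)
    case (exp a)
    then show ?case
      using compact_convex.convex[OF compact_convex_axioms]
      by (intro convex convex_on_exp_affine continuous_intros) auto
  qed (auto intro: add cmult exp_span_continuous)
  show ?thesis
  proof (rule approx[OF f])
    fix e :: real assume "0 < e"
    then obtain g where "g \<in> exp_span X" "\<forall>x\<in>X. \<bar>f x - g x\<bar> < e" using exp_span_dense[OF f] by blast
    then show "\<exists>g. continuous_on X g \<and> P g \<and> (\<forall>x\<in>X. \<bar>f x - g x\<bar> \<le> e)"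
      using span exp_span_continuous by (intro exI[of _ g]) (auto intro: less_imp_le)
  qed
qed

lemma radon_integral_close:
  assumes "\<mu> \<in> radon_probabilities X" "continuous_on X f" "continuous_on X g"
    "\<forall>x\<in>X. \<bar>f x - g x\<bar> \<le> (e::real)"
  shows "\<bar>integral\<^sup>L \<mu> f - integral\<^sup>L \<mu> g\<bar> \<le> e"
proof -
  note i = radon_continuous_integrable[OF compact assms(1)]
  have "\<bar>integral\<^sup>L \<mu> f - integral\<^sup>L \<mu> g\<bar> = \<bar>integral\<^sup>L \<mu> (\<lambda>x. f x - g x)\<bar>"
    using i assms by (subst Bochner_Integration.integral_diff) auto
  also have "\<dots> \<le> integral\<^sup>L \<mu> (\<lambda>x. \<bar>f x - g x\<bar>)" by (rule integral_abs_bound)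
  also have "\<dots> \<le> integral\<^sup>L \<mu> (\<lambda>x. e)"
    using assms radonD(1)[OF assms(1)] i by (intro integral_mono i continuous_intros) auto
  also have "\<dots> = e" by (rule radon_integral_const[OF assms(1)])
  finally show ?thesis .
qed

text \<open>Integrals of convex continuous functions determine those of all continuous functions,
  and these determine the measure together with its sigma-algebra. Hence Zorn's lemma can be applied
  to measures themselves.\<close>

lemma choquet_antisym:
  assumes \<mu>: "\<mu> \<in> radon_probabilities X" and \<nu>: "\<nu> \<in> radon_probabilities X"
    and "choquet_le X \<mu> \<nu>" "choquet_le X \<nu> \<mu>"
  shows "\<mu> = \<nu>"
proof (rule radon_eqI[OF compact \<mu> \<nu>])
  fix f :: "'a \<Rightarrow> real" assume "continuous_on X f"
  then show "integral\<^sup>L \<mu> f = integral\<^sup>L \<nu> f"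
  proof (induction rule: continuous_function_induct)
    case (convex f)
    then show ?case using assms(3,4) by (auto simp: choquet_le_def intro: antisym)
  next
    case (add f g)
    then show ?case using radon_continuous_integrable[OF compact \<mu>] radon_continuous_integrable[OF compact \<nu>]
      by simp
  next
    case (cmult c f)
    then show ?case using radon_continuous_integrable[OF compact \<mu>] radon_continuous_integrable[OF compact \<nu>]
      by simp
  next
    case (approx f)
    have "\<bar>integral\<^sup>L \<mu> f - integral\<^sup>L \<nu> f\<bar> \<le> 0 + e" if "0 < e" for e
    proof -
      obtain g where g: "continuous_on X g" "integral\<^sup>L \<mu> g = integral\<^sup>L \<nu> g" "\<forall>x\<in>X. \<bar>f x - g x\<bar> \<le> e / 2"
        using approx(2)[of "e/2"] \<open>0 < e\<close> by auto
      show ?thesis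
        using radon_integral_close[OF \<mu> approx(1) g(1,3)] radon_integral_close[OF \<nu> approx(1) g(1,3)] g(2)
        by linarith
    qed
    then have "\<bar>integral\<^sup>L \<mu> f - integral\<^sup>L \<nu> f\<bar> \<le> 0" by (rule field_le_epsilon)
    then show ?case by simp
  qed
qed

lemma choquet_trans: "choquet_le X \<mu> \<nu> \<Longrightarrow> choquet_le X \<nu> \<rho> \<Longrightarrow> choquet_le X \<mu> \<rho>"
  by (auto simp: choquet_le_def intro: order_trans)

lemma choquet_chain_upper_bound:
  assumes ne: "C \<noteq> {}" and C: "C \<subseteq> radon_probabilities X"
    and chain: "\<And>\<mu> \<nu>. \<mu> \<in> C \<Longrightarrow> \<nu> \<in> C \<Longrightarrow> choquet_le X \<mu> \<nu> \<or> choquet_le X \<nu> \<mu>"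
  shows "\<exists>\<rho>\<in>radon_probabilities X. \<forall>\<mu>\<in>C. choquet_le X \<mu> \<rho>"
proof -
  \<comment> \<open>The filter of tails of the chain; totality of the Choquet order on
    \<open>C\<close> makes the tails a filter base.\<close>
  define F where "F = (INF \<mu>\<in>C. principal {\<nu> \<in> C. choquet_le X \<mu> \<nu>})"
  have ev: "eventually Q F \<longleftrightarrow> (\<exists>\<mu>\<in>C. \<forall>\<nu>\<in>C. choquet_le X \<mu> \<nu> \<longrightarrow> Q \<nu>)" for Q
  proof -
    have "\<exists>\<rho>\<in>C. principal {\<nu> \<in> C. choquet_le X \<rho> \<nu>}
        \<le> inf (principal {\<nu> \<in> C. choquet_le X \<mu> \<nu>}) (principal {\<nu> \<in> C. choquet_le X \<mu>' \<nu>})"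
      if "\<mu> \<in> C" "\<mu>' \<in> C" for \<mu> \<mu>'
      using chain[OF that] that choquet_trans by (auto simp: subset_iff)
    then show ?thesis unfolding F_def by (subst eventually_INF_base[OF ne]) (auto simp: eventually_principal)
  qed
  have refl: "choquet_le X \<mu> \<mu>" for \<mu> by (simp add: choquet_le_def)
  have F: "F \<noteq> bot" using ev[of "\<lambda>_. False"] refl by (auto simp: trivial_limit_def)
  have evC: "\<forall>\<^sub>F \<nu> in F. \<nu> \<in> C" using ne ev by auto
  note int = radon_continuous_integrable[OF compact]
  have conv: "\<exists>l. ((\<lambda>\<nu>. integral\<^sup>L \<nu> f) \<longlongrightarrow> l) F" if "continuous_on X f" for f :: "'a \<Rightarrow> real"
    using that
  proof (induction rule: continuous_function_induct)
    case (convex f)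
    obtain B where B: "\<forall>x\<in>X. \<bar>f x\<bar> \<le> B" using continuous_bounded[OF compact convex(2)] by blast
    have bdd: "bdd_above ((\<lambda>\<nu>. integral\<^sup>L \<nu> f) ` C)"
    proof (rule bdd_aboveI2[where M=B])
      fix \<nu> assume "\<nu> \<in> C"
      then have \<nu>: "\<nu> \<in> radon_probabilities X" using C by auto
      have "integral\<^sup>L \<nu> f \<le> integral\<^sup>L \<nu> (\<lambda>x. B)"
        using B radonD(1)[OF \<nu>] by (intro integral_mono int[OF \<nu>] convex continuous_intros) (auto simp: abs_le_iff)
      also have "\<dots> = B" by (rule radon_integral_const[OF \<nu>])
      finally show "integral\<^sup>L \<nu> f \<le> B" .
    qed
    \<comment> \<open>Integrals of a convex function increase along the chain, so they converge to
      their supremum.\<close>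
    have "((\<lambda>\<nu>. integral\<^sup>L \<nu> f) \<longlongrightarrow> (SUP \<nu>\<in>C. integral\<^sup>L \<nu> f)) F"
    proof (rule order_tendstoI)
      fix c assume "c < (SUP \<nu>\<in>C. integral\<^sup>L \<nu> f)"
      then obtain \<mu> where \<mu>: "\<mu> \<in> C" "c < integral\<^sup>L \<mu> f" using less_cSUP_iff[OF ne bdd] by blast
      have "c < integral\<^sup>L \<nu> f" if "choquet_le X \<mu> \<nu>" for \<nu>
        using that \<mu>(2) convex by (auto simp: choquet_le_def intro: less_le_trans)
      then show "\<forall>\<^sub>F \<nu> in F. c < integral\<^sup>L \<nu> f" using \<mu>(1) ev by blast
    next
      fix c assume c: "(SUP \<nu>\<in>C. integral\<^sup>L \<nu> f) < c"
      show "\<forall>\<^sub>F \<nu> in F. integral\<^sup>L \<nu> f < c"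
        using evC by eventually_elim (use cSUP_upper[OF _ bdd] c in \<open>auto intro: le_less_trans\<close>)
    qed
    then show ?case by blast
  next
    case (add f g)
    then obtain l m where lm: "((\<lambda>\<nu>. integral\<^sup>L \<nu> f) \<longlongrightarrow> l) F" "((\<lambda>\<nu>. integral\<^sup>L \<nu> g) \<longlongrightarrow> m) F" by blast
    have "\<forall>\<^sub>F \<nu> in F. integral\<^sup>L \<nu> f + integral\<^sup>L \<nu> g = integral\<^sup>L \<nu> (\<lambda>x. f x + g x)"
      using evC by eventually_elim (use C int add in auto)
    from Lim_transform_eventually[OF tendsto_add[OF lm] this] show ?case by blast
  next
    case (cmult c f)
    then obtain l where l: "((\<lambda>\<nu>. integral\<^sup>L \<nu> f) \<longlongrightarrow> l) F" by blast
    from tendsto_mult_left[OF l, of c] show ?case by auto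
  next
    case (approx f)
    show ?case
    proof (rule filterlim_approximable_real[OF F])
      fix e :: real assume "0 < e"
      then obtain g where g: "continuous_on X g" "\<forall>x\<in>X. \<bar>f x - g x\<bar> \<le> e / 2"
        "\<exists>l. ((\<lambda>\<nu>. integral\<^sup>L \<nu> g) \<longlongrightarrow> l) F" using approx(2)[of "e/2"] by auto
      then obtain l where l: "((\<lambda>\<nu>. integral\<^sup>L \<nu> g) \<longlongrightarrow> l) F" by blast
      have "\<forall>\<^sub>F \<nu> in F. \<bar>integral\<^sup>L \<nu> g - l\<bar> < e / 2"
        using tendstoD[OF l, of "e/2"] \<open>0 < e\<close> by (simp add: dist_real_def)
      then have "\<forall>\<^sub>F \<nu> in F. \<bar>integral\<^sup>L \<nu> f - l\<bar> \<le> e"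
        using evC
      proof eventually_elim
        case (elim \<nu>)
        then have "\<bar>integral\<^sup>L \<nu> f - integral\<^sup>L \<nu> g\<bar> \<le> e / 2"
          using C by (intro radon_integral_close[OF _ approx(1) g(1,2)]) auto
        then show ?case using elim(1) by linarith
      qed
      then show "\<exists>l. \<forall>\<^sub>F \<nu> in F. \<bar>integral\<^sup>L \<nu> f - l\<bar> \<le> e" by blast
    qed
  qed
  \<comment> \<open>\<open>Lim\<close> is unspecified where no limit exists; by \<open>conv\<close>
    this does not occur for functions continuous on \<open>X\<close>.\<close>
  define L where "L f = Lim F (\<lambda>\<nu>. integral\<^sup>L \<nu> f)" for f :: "'a \<Rightarrow> real"
  have L: "((\<lambda>\<nu>. integral\<^sup>L \<nu> f) \<longlongrightarrow> L f) F" if "continuous_on X f" for f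
    using conv[OF that] tendsto_Lim[OF F] unfolding L_def by blast
  have LI: "L f = l" if "((\<lambda>\<nu>. integral\<^sup>L \<nu> f) \<longlongrightarrow> l) F" for f l
    using tendsto_Lim[OF F that] by (simp add: L_def)
  interpret P: positive_functional X L
  proof
    show "compact X" by (rule compact)
    fix f g :: "'a \<Rightarrow> real" assume fg: "continuous_on X f" "continuous_on X g"
    have "\<forall>\<^sub>F \<nu> in F. integral\<^sup>L \<nu> f + integral\<^sup>L \<nu> g = integral\<^sup>L \<nu> (\<lambda>x. f x + g x)"
      using evC by eventually_elim (use C int fg in auto)
    from Lim_transform_eventually[OF tendsto_add[OF L[OF fg(1)] L[OF fg(2)]] this]
    show "L (\<lambda>x. f x + g x) = L f + L g" by (rule LI)
  next
    fix f :: "'a \<Rightarrow> real" and c assume f: "continuous_on X f"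
    show "L (\<lambda>x. c * f x) = c * L f" by (rule LI) (use tendsto_mult_left[OF L[OF f], of c] in simp)
  next
    fix f :: "'a \<Rightarrow> real" assume f: "continuous_on X f" "\<And>x. x \<in> X \<Longrightarrow> 0 \<le> f x"
    have "\<forall>\<^sub>F \<nu> in F. 0 \<le> integral\<^sup>L \<nu> f"
      using evC by eventually_elim (use C f radonD(1) in \<open>force intro: Bochner_Integration.integral_nonneg\<close>)
    then show "0 \<le> L f" using L[OF f(1)] F tendsto_lowerbound by blast
  next
    have "\<forall>\<^sub>F \<nu> in F. 1 = integral\<^sup>L \<nu> (\<lambda>x. 1 :: real)"
      using evC by eventually_elim (use C radon_integral_const in force)
    from Lim_transform_eventually[OF tendsto_const this] show "L (\<lambda>x. 1) = 1" by (rule LI)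
  qed
  have "choquet_le X \<mu> P.riesz_measure" if \<mu>: "\<mu> \<in> C" for \<mu>
    unfolding choquet_le_def
  proof safe
    fix f assume f: "convex_on X f" "continuous_on X f"
    have "\<forall>\<^sub>F \<nu> in F. integral\<^sup>L \<mu> f \<le> integral\<^sup>L \<nu> f" using \<mu> ev f by (auto simp: choquet_le_def)
    then have "integral\<^sup>L \<mu> f \<le> L f" using L[OF f(2)] F tendsto_lowerbound by blast
    then show "integral\<^sup>L \<mu> f \<le> integral\<^sup>L P.riesz_measure f" using P.integral_riesz[OF f(2)] by simp
  qed
  then show ?thesis using P.riesz_radon by blast
qed

theorem maximal_measure_exists:
  assumes x: "x \<in> X"
  shows "\<exists>\<mu>. maximal_measure X \<mu> \<and> barycenter X \<mu> = x"
proof -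
  \<comment> \<open>The Riesz measure of evaluation at \<open>x\<close> is the Dirac measure,
    obtained with a complete sigma-algebra and regularity already in place.\<close>
  interpret P: positive_functional X "\<lambda>f. f x"
    using x compact by unfold_locales auto
  let ?\<delta> = P.riesz_measure
  have \<delta>: "?\<delta> \<in> radon_probabilities X" by (rule P.riesz_radon)
  let ?A = "{\<mu> \<in> radon_probabilities X. choquet_le X ?\<delta> \<mu>}"
  have "\<exists>m\<in>?A. \<forall>\<nu>\<in>?A. choquet_le X m \<nu> \<longrightarrow> \<nu> = m"
  proof (rule predicate_Zorn)
    show "partial_order_on ?A (relation_of (choquet_le X) ?A)"
      unfolding partial_order_on_def preorder_on_def
      by (auto simp: refl_on_def trans_def antisym_def relation_of_def choquet_le_def[of X \<mu> \<mu> for \<mu>]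
          intro: choquet_trans choquet_antisym)
    fix C assume C: "C \<in> Chains (relation_of (choquet_le X) ?A)"
    then have C1: "C \<subseteq> ?A" and C2: "\<And>\<mu> \<nu>. \<mu> \<in> C \<Longrightarrow> \<nu> \<in> C \<Longrightarrow> choquet_le X \<mu> \<nu> \<or> choquet_le X \<nu> \<mu>"
      by (auto simp: Chains_def relation_of_def)
    show "\<exists>u\<in>?A. \<forall>a\<in>C. choquet_le X a u"
    proof (cases "C = {}")
      case True
      then show ?thesis using \<delta> by (auto simp: choquet_le_def)
    next
      case False
      obtain \<rho> where \<rho>: "\<rho> \<in> radon_probabilities X" "\<forall>\<mu>\<in>C. choquet_le X \<mu> \<rho>"
        using choquet_chain_upper_bound[OF False _ C2] C1 by blast
      then have "choquet_le X ?\<delta> \<rho>" using False C1 choquet_trans by blast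
      then show ?thesis using \<rho> by blast
    qed
  qed
  then obtain m where m: "m \<in> radon_probabilities X" "choquet_le X ?\<delta> m"
    and max: "\<And>\<nu>. \<nu> \<in> ?A \<Longrightarrow> choquet_le X m \<nu> \<Longrightarrow> \<nu> = m" by blast
  \<comment> \<open>Whatever lies above \<open>m\<close> also lies above \<open>?\<delta>\<close>,
    so maximality within \<open>?A\<close> is maximality among all Radon probabilities.\<close>
  have "maximal_measure X m"
    unfolding maximal_measure_def using m max choquet_trans by blast
  moreover have "barycenter X m = x"
  proof (rule barycenterI[OF x])
    fix a assume a: "a \<in> continuous_affine X"
    \<comment> \<open>Both \<open>a\<close> and \<open>- a\<close> are convex, so going up in the
      Choquet order leaves the integral of \<open>a\<close> unchanged.\<close>
    note c = affine_on_imp_convex_on[OF convex continuous_affineD(1)[OF a]]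
    have cont: "continuous_on X a" "continuous_on X (\<lambda>x. - a x)"
      using continuous_affineD(2)[OF a] by (auto intro: continuous_on_minus)
    have "integral\<^sup>L ?\<delta> a \<le> integral\<^sup>L m a" "integral\<^sup>L ?\<delta> (\<lambda>x. - a x) \<le> integral\<^sup>L m (\<lambda>x. - a x)"
      using m(2) c cont unfolding choquet_le_def by blast+
    then show "a x = integral\<^sup>L m a" using P.integral_riesz[OF cont(1)] by simp
  qed
  ultimately show ?thesis by blast
qed

end

section \<open>Calculus of strong multipliers\<close>

lemma uniform_limit_pointwise:
  fixes h :: "nat \<Rightarrow> 'a \<Rightarrow> real"
  shows "uniform_limit X h f sequentially \<Longrightarrow> x \<in> X \<Longrightarrow> (\<lambda>n. h n x) \<longlonglongrightarrow> f x"
  by (rule tendsto_uniform_limitI)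

lemma affine_on_limit:
  assumes "convex X" "\<And>n::nat. affine_on X (h n)" "\<And>x. x \<in> X \<Longrightarrow> (\<lambda>n. h n x) \<longlonglongrightarrow> f x"
  shows "affine_on X f"
  unfolding affine_on_def
proof safe
  fix x y and t :: real assume xy: "x \<in> X" "y \<in> X" "t \<in> {0..1}"
  then have "t *\<^sub>R x + (1 - t) *\<^sub>R y \<in> X" by (intro convexD[OF assms(1)]) auto
  then have "(\<lambda>n. h n (t *\<^sub>R x + (1 - t) *\<^sub>R y)) \<longlonglongrightarrow> f (t *\<^sub>R x + (1 - t) *\<^sub>R y)" by (rule assms(3))
  moreover have "h n (t *\<^sub>R x + (1 - t) *\<^sub>R y) = t * h n x + (1 - t) * h n y" for n
    using assms(2)[of n] xy unfolding affine_on_def by blast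
  ultimately have "(\<lambda>n. t * h n x + (1 - t) * h n y) \<longlonglongrightarrow> f (t *\<^sub>R x + (1 - t) *\<^sub>R y)" by simp
  moreover have "(\<lambda>n. t * h n x + (1 - t) * h n y) \<longlonglongrightarrow> t * f x + (1 - t) * f y"
    by (intro tendsto_intros assms(3) xy)
  ultimately show "f (t *\<^sub>R x + (1 - t) *\<^sub>R y) = t * f x + (1 - t) * f y" by (rule LIMSEQ_unique)
qed

lemma face_level_set:
  assumes "convex X" "affine_on X f" "\<And>x. x \<in> X \<Longrightarrow> f x \<le> c"
  shows "face X {x \<in> X. f x = c}"
  unfolding face_def extremal_def
proof (intro conjI ballI impI)
  fix y z assume yz: "y \<in> X" "z \<in> X" and m: "(1/2) *\<^sub>R (y + z) \<in> {x \<in> X. f x = c}"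
  have "f ((1/2) *\<^sub>R y + (1/2) *\<^sub>R z) = 1/2 * f y + 1/2 * f z"
    by (rule affine_onD[OF assms(2) yz]) auto
  then have "f y + f z = 2 * c" using m by (simp add: scaleR_right_distrib)
  then have "f y = c" "f z = c" using assms(3)[OF yz(1)] assms(3)[OF yz(2)] by linarith+
  then show "y \<in> {x \<in> X. f x = c}" "z \<in> {x \<in> X. f x = c}" using yz by auto
next
  show "convex {x \<in> X. f x = c}"
  proof (rule convexI)
    fix x y and u v :: real
    assume *: "x \<in> {x \<in> X. f x = c}" "y \<in> {x \<in> X. f x = c}" "0 \<le> u" "0 \<le> v" "u + v = 1"
    then have "f (u *\<^sub>R x + v *\<^sub>R y) = u * c + v * c" using affine_onD[OF assms(2)] by auto
    also have "\<dots> = c" using *(5) by (metis distrib_right mult_1)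
    finally show "u *\<^sub>R x + v *\<^sub>R y \<in> {x \<in> X. f x = c}" using * convexD[OF assms(1)] by auto
  qed
qed auto

text \<open>\<open>extremal\<close> speaks of midpoints only. For \<open>t \<le> 1/2\<close> the
  given point is the midpoint of \<open>c\<close> and the point with weight \<open>2 * t\<close>, so
  the weight of \<open>b\<close> can be doubled inside \<open>B\<close>; once it exceeds
  \<open>1/2\<close>, \<open>b\<close> itself is an endpoint of a bisected segment. The number
  \<open>n\<close> bounds the doublings.\<close>

lemma extremal_segment_left:
  assumes "convex X" "extremal X B" "b \<in> X" "c \<in> X" "0 < t" "t \<le> 1" "t *\<^sub>R b + (1 - t) *\<^sub>R c \<in> B"
  shows "b \<in> B"
proof -
  have "b \<in> B" if "0 < t" "t \<le> 1" "t *\<^sub>R b + (1 - t) *\<^sub>R c \<in> B" "1 \<le> 2 ^ n * t" for n :: nat and t :: real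
    using that
  proof (induction n arbitrary: t)
    case 0
    then have "t = 1" by simp
    then show ?case using 0 by simp
  next
    case (Suc n)
    show ?case
    proof (cases "t \<le> 1/2")
      case True
      define y where "y = (2*t) *\<^sub>R b + (1 - 2*t) *\<^sub>R c"
      have y: "y \<in> X" unfolding y_def using True Suc assms by (intro convexD[OF assms(1)]) auto
      have "(1/2) *\<^sub>R (y + c) = t *\<^sub>R b + (1 - t) *\<^sub>R c"
        by (simp add: y_def algebra_simps flip: scaleR_left_distrib)
      then have "y \<in> B" using Suc.prems(3) assms(2,4) y by (auto simp: extremal_def)
      then show ?thesis unfolding y_def using True Suc.prems by (intro Suc.IH[of "2*t"]) auto
    next
      case False
      define y where "y = (2*t - 1) *\<^sub>R b + (2 - 2*t) *\<^sub>R c"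
      have y: "y \<in> X" unfolding y_def using False Suc assms by (intro convexD[OF assms(1)]) auto
      have "(1/2) *\<^sub>R (b + y) = t *\<^sub>R b + (1 - t) *\<^sub>R c"
        by (simp add: y_def algebra_simps flip: scaleR_left_distrib)
      then show ?thesis using Suc.prems(3) assms(2,3) y unfolding extremal_def by metis
    qed
  qed
  moreover obtain n :: nat where "1 / t < 2 ^ n" using real_arch_pow[of 2 "1/t"] by auto
  then have "1 \<le> 2 ^ n * t" using assms(5) by (simp add: field_simps)
  ultimately show ?thesis using assms(5-7) by blast
qed

lemma monotone_limits_refl:
  assumes "f \<in> F" "f \<in> extensional X" "bounded (f ` X)"
  shows "f \<in> monotone_limits X F"
proof -
  obtain C where "\<forall>x\<in>X. \<bar>f x\<bar> \<le> C" using assms(3) by (auto simp: bounded_iff)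
  then show ?thesis using assms unfolding monotone_limits_def
    by (intro CollectI conjI exI[of _ "\<lambda>_. f"]) auto
qed

section \<open>Comparison on extreme points\<close>

locale multiplier_space = compact_convex X for X :: "'a::locally_convex_space set" +
  fixes H :: "('a \<Rightarrow> real) set"
  assumes intermediate: "intermediate_function_space X H"
    and strongly_affine: "H \<subseteq> strongly_affine X"
    and determined: "determined_by_extreme_points X (monotone_limits X H)"
begin

lemma H_affine: "u \<in> H \<Longrightarrow> affine_on X u"
  and H_extensional: "u \<in> H \<Longrightarrow> u \<in> extensional X"
  and H_bounded: "u \<in> H \<Longrightarrow> bounded (u ` X)"
  using intermediate by (auto simp: intermediate_function_space_def bounded_affine_def)

lemma H_bound: "u \<in> H \<Longrightarrow> \<exists>C>0. \<forall>x\<in>X. \<bar>u x\<bar> \<le> C"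
  using H_bounded[of u] unfolding bounded_pos by auto

lemma H_cmult: "u \<in> H \<Longrightarrow> (\<lambda>x\<in>X. c * u x) \<in> H"
  and H_add: "u \<in> H \<Longrightarrow> v \<in> H \<Longrightarrow> (\<lambda>x\<in>X. u x + v x) \<in> H"
  using intermediate by (auto simp: intermediate_function_space_def function_subspace_def)

lemma H_const: "(\<lambda>x\<in>X. c) \<in> H"
proof -
  have "(\<lambda>x\<in>X. c) \<in> continuous_affine X"
    using convexD[OF convex] by (auto simp: continuous_affine_def affine_on_def left_diff_distrib cong: continuous_on_cong)
  then show ?thesis using intermediate by (auto simp: intermediate_function_space_def)
qed

lemma H_lin: "u \<in> H \<Longrightarrow> v \<in> H \<Longrightarrow> (\<lambda>x\<in>X. c * u x + d * v x) \<in> H"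
  using H_add[OF H_cmult[of u c] H_cmult[of v d]] by (simp cong: restrict_cong)

lemma ext_subset: "ext X \<subseteq> X"
  by (auto simp: ext_def extreme_point_of_def)

lemma H_determined: "u \<in> H \<Longrightarrow> x \<in> X \<Longrightarrow> (INF y\<in>ext X. u y) \<le> u x"
  using determined monotone_limits_refl[OF _ H_extensional H_bounded]
  by (auto simp: determined_by_extreme_points_def)

text \<open>\<open>Inf {}\<close> is one fixed real number; without extreme points it would be a
  lower bound for every constant function, since all constants lie in \<open>H\<close>.\<close>

lemma ext_nonempty: "x \<in> X \<Longrightarrow> ext X \<noteq> {}"
proof
  assume x: "x \<in> X" and e: "ext X = {}"
  have "Inf {} \<le> c" for c :: real using H_determined[OF H_const x, of c] x by (simp add: e)
  from this[of "Inf {} - 1"] show False by simp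
qed

lemma H_nonneg:
  assumes "u \<in> H" "\<And>y. y \<in> ext X \<Longrightarrow> 0 \<le> u y" "x \<in> X"
  shows "0 \<le> u x"
proof -
  have "0 \<le> (INF y\<in>ext X. u y)" by (rule cINF_greatest) (use assms ext_nonempty in auto)
  then show ?thesis using H_determined[OF assms(1,3)] by simp
qed

text \<open>\<open>d * v - c * u + e\<close> lies in \<open>H\<close>, so its nonnegativity on
  \<open>ext X\<close> persists on \<open>X\<close>. The scalars admit the shapes used later:
  \<open>c = 0\<close> or \<open>d = 0\<close> for constant bounds, \<open>c = -1\<close> for
  absolute values.\<close>

lemma H_le:
  assumes "u \<in> H" "v \<in> H" "\<And>y. y \<in> ext X \<Longrightarrow> c * u y \<le> d * v y + e" "x \<in> X"
  shows "c * u x \<le> d * v x + e"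
proof -
  have "(\<lambda>x\<in>X. 1 * (\<lambda>x\<in>X. d * v x + (- c) * u x) x + 1 * (\<lambda>x\<in>X. e) x) \<in> H"
    by (intro H_lin H_const assms)
  moreover have "0 \<le> d * v y - c * u y + e" if "y \<in> ext X" for y using assms(3)[OF that] by simp
  ultimately show ?thesis using H_nonneg[OF _ _ assms(4)] assms(4) ext_subset by fastforce
qed

lemma H_uniform_limit:
  assumes "\<And>n. h n \<in> H" "uniform_limit X h f sequentially"
  shows "restrict f X \<in> H"
proof -
  let ?f = "restrict f X"
  have lim: "uniform_limit X h ?f sequentially"
    using assms(2) by (simp cong: uniform_limit_cong')
  have "affine_on X ?f"
    using H_affine[OF assms(1)] uniform_limit_pointwise[OF lim] by (rule affine_on_limit[OF convex])
  moreover have "bounded (?f ` X)"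
    using uniform_limit_bounded[OF lim] H_bounded[OF assms(1)] by simp
  ultimately have "?f \<in> bounded_affine X" by (simp add: bounded_affine_def)
  then show ?thesis
    using intermediate assms(1) lim unfolding intermediate_function_space_def by blast
qed

text \<open>By \<open>H_le\<close> the Cauchy condition spreads from \<open>ext X\<close> to
  \<open>X\<close>, and \<open>H\<close> is closed under uniform limits. In this way new elements of
  \<open>H\<close> arise from estimates at extreme points alone.\<close>

lemma H_complete:
  assumes h: "\<And>n. h n \<in> H"
    and cauchy: "\<And>e. 0 < e \<Longrightarrow> \<exists>N. \<forall>m\<ge>N. \<forall>n\<ge>N. \<forall>y\<in>ext X. \<bar>h m y - h n y\<bar> \<le> e"
  shows "\<exists>f\<in>H. uniform_limit X h f sequentially"
proof -
  have "uniformly_Cauchy_on X h"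
  proof (rule uniformly_Cauchy_onI)
    fix e :: real assume e: "0 < e"
    then obtain N where N: "\<forall>m\<ge>N. \<forall>n\<ge>N. \<forall>y\<in>ext X. \<bar>h m y - h n y\<bar> \<le> e / 2"
      using cauchy[of "e/2"] by auto
    have le: "h m x \<le> h n x + e / 2" if mn: "N \<le> m" "N \<le> n" and x: "x \<in> X" for m n x
    proof -
      have "1 * h m y \<le> 1 * h n y + e / 2" if "y \<in> ext X" for y
        using N[rule_format, OF mn that] by linarith
      from H_le[OF h h this x] show ?thesis by simp
    qed
    have "dist (h m x) (h n x) < e" if "N \<le> m" "N \<le> n" "x \<in> X" for m n x
      using le[OF that] le[OF that(2,1,3)] e unfolding dist_real_def by linarith
    then show "\<exists>M. \<forall>x\<in>X. \<forall>m\<ge>M. \<forall>n\<ge>M. dist (h m x) (h n x) < e" by blast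
  qed
  then obtain f where "uniform_limit X h f sequentially"
    using Cauchy_uniformly_convergent unfolding uniformly_convergent_on_def by blast
  then show ?thesis
    using H_uniform_limit[OF h] by (intro bexI[of _ "restrict f X"]) (simp_all cong: uniform_limit_cong')
qed

text \<open>The guard lets facts known only on \<open>X\<close> be used pointwise;
  \<open>M_iff\<close> matches it with the unguarded form, as every maximal measure has space
  \<open>X\<close>.\<close>

definition maximal_AE :: "('a \<Rightarrow> bool) \<Rightarrow> bool"
  where "maximal_AE Q \<longleftrightarrow> (\<forall>\<mu>. maximal_measure X \<mu> \<longrightarrow> (AE x in \<mu>. x \<in> X \<longrightarrow> Q x))"

lemma maximal_radon: "maximal_measure X \<mu> \<Longrightarrow> \<mu> \<in> radon_probabilities X"
  by (simp add: maximal_measure_def)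

text \<open>The bridge from almost-everywhere statements to extreme points: some maximal measure has
  barycenter \<open>y\<close> and is concentrated at \<open>y\<close>, so the constant statement
  \<open>Q y\<close> holds almost everywhere for a nonzero measure.\<close>

lemma maximal_AE_ext:
  assumes "maximal_AE Q" "y \<in> ext X"
  shows "Q y"
proof -
  have y: "y \<in> X" using assms(2) ext_subset by auto
  then obtain \<mu> where \<mu>: "maximal_measure X \<mu>" "barycenter X \<mu> = y"
    using maximal_measure_exists by blast
  have "AE x in \<mu>. x = y" by (rule extreme_barycenter_AE[OF assms(2) maximal_radon[OF \<mu>(1)] \<mu>(2)])
  moreover have "AE x in \<mu>. x \<in> X \<longrightarrow> Q x" using assms(1) \<mu>(1) by (simp add: maximal_AE_def)
  ultimately have "AE x in \<mu>. Q y" by eventually_elim (use y in auto)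
  moreover have "emeasure \<mu> (space \<mu>) \<noteq> 0"
    using radonD[OF maximal_radon[OF \<mu>(1)]] by simp
  ultimately show ?thesis by (simp add: eventually_const ae_filter_eq_bot_iff)
qed

lemma maximal_AE_mono: "maximal_AE P \<Longrightarrow> (\<And>x. x \<in> X \<Longrightarrow> P x \<Longrightarrow> Q x) \<Longrightarrow> maximal_AE Q"
  unfolding maximal_AE_def by (auto elim!: eventually_mono)

lemma maximal_AE_conj: "maximal_AE P \<Longrightarrow> maximal_AE Q \<Longrightarrow> maximal_AE (\<lambda>x. P x \<and> Q x)"
  unfolding maximal_AE_def by (auto simp: imp_conjR)

lemma maximal_AE_all: "(\<And>n::nat. maximal_AE (P n)) \<Longrightarrow> maximal_AE (\<lambda>x. \<forall>n. P n x)"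
  unfolding maximal_AE_def
proof safe
  fix \<mu> assume *: "\<And>n. \<forall>\<mu>. maximal_measure X \<mu> \<longrightarrow> (AE x in \<mu>. x \<in> X \<longrightarrow> P n x)" "maximal_measure X \<mu>"
  have "AE x in \<mu>. \<forall>n. x \<in> X \<longrightarrow> P n x" unfolding AE_all_countable using * by blast
  then show "AE x in \<mu>. x \<in> X \<longrightarrow> (\<forall>n. P n x)" by eventually_elim blast
qed

lemma maximal_AE_I: "(\<And>x. x \<in> X \<Longrightarrow> Q x) \<Longrightarrow> maximal_AE Q"
  unfolding maximal_AE_def by simp

section \<open>The algebra of strong multipliers\<close>

abbreviation M :: "('a \<Rightarrow> real) set" where "M \<equiv> strong_multipliers X H"

lemma M_iff: "u \<in> M \<longleftrightarrow> u \<in> H \<and> (\<forall>a\<in>H. \<exists>b\<in>H. maximal_AE (\<lambda>x. b x = u x * a x))"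
proof -
  have "(\<forall>\<mu>. maximal_measure X \<mu> \<longrightarrow> (AE x in \<mu>. b x = u x * a x)) \<longleftrightarrow> maximal_AE (\<lambda>x. b x = u x * a x)" for a b
  proof -
    have "(AE x in \<mu>. b x = u x * a x) \<longleftrightarrow> (AE x in \<mu>. x \<in> X \<longrightarrow> b x = u x * a x)"
      if "maximal_measure X \<mu>" for \<mu>
      using radonD(1)[OF maximal_radon[OF that]] by (intro AE_cong) auto
    then show ?thesis unfolding maximal_AE_def by blast
  qed
  then show ?thesis by (simp add: strong_multipliers_def)
qed

lemma M_H: "u \<in> M \<Longrightarrow> u \<in> H"
  by (simp add: M_iff)

lemma M_const: "(\<lambda>x\<in>X. c) \<in> M"
  unfolding M_iff
proof (intro conjI ballI H_const)
  fix a assume "a \<in> H"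
  then show "\<exists>b\<in>H. maximal_AE (\<lambda>x. b x = (\<lambda>x\<in>X. c) x * a x)"
    by (intro bexI[OF _ H_cmult[of a c]] maximal_AE_I) auto
qed

lemma M_lin:
  assumes "u \<in> M" "v \<in> M"
  shows "(\<lambda>x\<in>X. c * u x + d * v x) \<in> M"
  unfolding M_iff
proof (intro conjI ballI)
  show "(\<lambda>x\<in>X. c * u x + d * v x) \<in> H" using assms by (intro H_lin M_H)
  fix a assume "a \<in> H"
  then obtain b1 b2 where b: "b1 \<in> H" "maximal_AE (\<lambda>x. b1 x = u x * a x)" "b2 \<in> H" "maximal_AE (\<lambda>x. b2 x = v x * a x)"
    using assms unfolding M_iff by metis
  show "\<exists>b\<in>H. maximal_AE (\<lambda>x. b x = (\<lambda>x\<in>X. c * u x + d * v x) x * a x)"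
    by (intro bexI[OF _ H_lin[OF b(1,3), of c d]] maximal_AE_mono[OF maximal_AE_conj[OF b(2,4)]])
      (auto simp: algebra_simps)
qed

text \<open>At extreme points \<open>b m - b n\<close> is \<open>(w m - w n) * a\<close> with
  \<open>a\<close> bounded, so the products are uniformly Cauchy there and converge in
  \<open>H\<close>. The limit is the product of \<open>u\<close> and \<open>a\<close>, as only
  countably many null sets are discarded for each maximal measure.\<close>

lemma M_uniform_limit:
  assumes w: "\<And>n. w n \<in> M" and u: "u \<in> H" "uniform_limit X w u sequentially"
  shows "u \<in> M"
  unfolding M_iff
proof (intro conjI ballI u)
  fix a assume a: "a \<in> H"
  obtain C where C: "0 < C" "\<forall>x\<in>X. \<bar>a x\<bar> \<le> C" using H_bound[OF a] by auto
  have "\<exists>b\<in>H. maximal_AE (\<lambda>x. b x = w n x * a x)" for n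
    using w[of n, unfolded M_iff] a by blast
  then obtain b where b: "\<And>n. b n \<in> H" "\<And>n. maximal_AE (\<lambda>x. b n x = w n x * a x)" by metis
  have "\<exists>f\<in>H. uniform_limit X b f sequentially"
  proof (rule H_complete[OF b(1)])
    fix e :: real assume e: "0 < e"
    then have "\<forall>\<^sub>F n in sequentially. \<forall>x\<in>X. dist (w n x) (u x) < e / (2 * C)"
      using u(2) C(1) unfolding uniform_limit_iff by simp
    then obtain N where N: "\<forall>n\<ge>N. \<forall>x\<in>X. dist (w n x) (u x) < e / (2 * C)"
      by (auto simp: eventually_sequentially)
    have "\<bar>b m y - b n y\<bar> \<le> e" if mn: "N \<le> m" "N \<le> n" and y: "y \<in> ext X" for m n y
    proof -
      have yX: "y \<in> X" using y ext_subset by auto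
      have "\<bar>w m y - u y\<bar> < e / (2 * C)" "\<bar>w n y - u y\<bar> < e / (2 * C)"
        using N mn yX by (auto simp: dist_real_def)
      then have "\<bar>w m y - w n y\<bar> \<le> e / (2 * C) + e / (2 * C)" by linarith
      also have "\<dots> = e / C" by (simp add: field_simps)
      finally have "\<bar>w m y - w n y\<bar> * \<bar>a y\<bar> \<le> e / C * C"
        using C yX e by (intro mult_mono) auto
      moreover have "b m y - b n y = (w m y - w n y) * a y"
        using maximal_AE_ext[OF b(2) y] by (simp add: algebra_simps)
      ultimately show ?thesis using C(1) by (simp add: abs_mult)
    qed
    then show "\<exists>N. \<forall>m\<ge>N. \<forall>n\<ge>N. \<forall>y\<in>ext X. \<bar>b m y - b n y\<bar> \<le> e" by blast
  qed
  then obtain f where f: "f \<in> H" "uniform_limit X b f sequentially" by blast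
  have "maximal_AE (\<lambda>x. f x = u x * a x)"
  proof (rule maximal_AE_mono[OF maximal_AE_all[OF b(2)]])
    fix x assume x: "x \<in> X" "\<forall>n. b n x = w n x * a x"
    have "(\<lambda>n. w n x * a x) \<longlonglongrightarrow> f x" using uniform_limit_pointwise[OF f(2) x(1)] x(2) by simp
    moreover have "(\<lambda>n. w n x * a x) \<longlonglongrightarrow> u x * a x"
      by (intro tendsto_intros uniform_limit_pointwise[OF u(2) x(1)])
    ultimately show "f x = u x * a x" by (rule LIMSEQ_unique)
  qed
  then show "\<exists>b\<in>H. maximal_AE (\<lambda>x. b x = u x * a x)" using f(1) by blast
qed

text \<open>The case of products carries the weight: \<open>v\<close> is itself an element of
  \<open>H\<close>, so the multiplier \<open>u\<close> provides a representative \<open>w\<close> of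
  \<open>u * v\<close> in \<open>H\<close>. It is again a multiplier, by multiplying first with
  \<open>v\<close> and then with \<open>u\<close>.\<close>

lemma M_polynomial:
  assumes m: "m \<in> M" and "real_polynomial_function p"
  shows "\<exists>w\<in>M. maximal_AE (\<lambda>x. w x = p (m x))"
  using assms(2)
proof (induction rule: real_polynomial_function.induct)
  case (linear f)
  have f: "f t = f 1 * t" for t
    using linear_scale[OF bounded_linear.linear[OF linear], of t 1] by (simp add: mult.commute)
  have "maximal_AE (\<lambda>x. (\<lambda>x\<in>X. f 1 * m x + 0 * m x) x = f (m x))"
    by (rule maximal_AE_I) (simp add: f[of "m _"])
  then show ?case using M_lin[OF m m] by blast
next
  case (const c)
  show ?case by (intro bexI[OF _ M_const[of c]] maximal_AE_I) auto
next
  case (add f g)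
  then obtain u v where u: "u \<in> M" "maximal_AE (\<lambda>x. u x = f (m x))"
    and v: "v \<in> M" "maximal_AE (\<lambda>x. v x = g (m x))" by blast
  show ?case
    by (intro bexI[OF _ M_lin[OF u(1) v(1), of 1 1]] maximal_AE_mono[OF maximal_AE_conj[OF u(2) v(2)]]) auto
next
  case (mult f g)
  then obtain u v where u: "u \<in> M" "maximal_AE (\<lambda>x. u x = f (m x))"
    and v: "v \<in> M" "maximal_AE (\<lambda>x. v x = g (m x))" by blast
  obtain w where w: "w \<in> H" "maximal_AE (\<lambda>x. w x = u x * v x)"
    using u(1) M_H[OF v(1)] unfolding M_iff by blast
  have "w \<in> M"
    unfolding M_iff
  proof (intro conjI ballI w)
    fix a assume "a \<in> H"
    then obtain c where c: "c \<in> H" "maximal_AE (\<lambda>x. c x = v x * a x)" using v(1) unfolding M_iff by blast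
    then obtain b where b: "b \<in> H" "maximal_AE (\<lambda>x. b x = u x * c x)" using u(1) unfolding M_iff by blast
    have "maximal_AE (\<lambda>x. b x = w x * a x)"
      by (rule maximal_AE_mono[OF maximal_AE_conj[OF w(2) maximal_AE_conj[OF c(2) b(2)]]]) simp
    then show "\<exists>b\<in>H. maximal_AE (\<lambda>x. b x = w x * a x)" using b(1) by blast
  qed
  moreover have "maximal_AE (\<lambda>x. w x = f (m x) * g (m x))"
    by (rule maximal_AE_mono[OF maximal_AE_conj[OF w(2) maximal_AE_conj[OF u(2) v(2)]]]) simp
  ultimately show ?case by blast
qed

lemma M_continuous:
  assumes m: "m \<in> M" and \<phi>: "continuous_on UNIV (\<phi> :: real \<Rightarrow> real)"
  shows "\<exists>w\<in>M. maximal_AE (\<lambda>x. w x = \<phi> (m x))"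
proof -
  obtain C where C: "\<forall>x\<in>X. \<bar>m x\<bar> \<le> C" using H_bound[OF M_H[OF m]] by blast
  have "\<exists>p. real_polynomial_function p \<and> (\<forall>t\<in>{-C..C}. \<bar>\<phi> t - p t\<bar> < inverse (real (Suc n)))" for n
  proof -
    have "compact {-C..C}" "continuous_on {-C..C} \<phi>" "0 < inverse (real (Suc n))"
      using continuous_on_subset[OF \<phi>] by auto
    from Stone_Weierstrass_real_polynomial_function[OF this] show ?thesis by metis
  qed
  then obtain p where p: "\<And>n. real_polynomial_function (p n)"
    "\<And>n. \<forall>t\<in>{-C..C}. \<bar>\<phi> t - p n t\<bar> < inverse (real (Suc n))" by metis
  have "\<exists>w\<in>M. maximal_AE (\<lambda>x. w x = p n (m x))" for n by (rule M_polynomial[OF m p(1)])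
  then obtain w where w: "\<And>n. w n \<in> M" "\<And>n. maximal_AE (\<lambda>x. w n x = p n (m x))" by metis
  have close: "\<bar>\<phi> (m x) - p n (m x)\<bar> < inverse (real (Suc n))" if "x \<in> X" for x n
    using p(2)[of n] C that by (auto simp: abs_le_iff minus_le_iff)
  have "\<exists>u\<in>H. uniform_limit X w u sequentially"
  proof (rule H_complete[OF M_H[OF w(1)]])
    fix e :: real assume "0 < e"
    then obtain N where N: "inverse (real (Suc N)) < e / 2" using reals_Archimedean[of "e/2"] by auto
    have "\<bar>w k y - w n y\<bar> \<le> e" if "N \<le> k" "N \<le> n" "y \<in> ext X" for k n y
    proof -
      have "inverse (real (Suc k)) \<le> inverse (real (Suc N))" "inverse (real (Suc n)) \<le> inverse (real (Suc N))"
        using that by (auto intro!: le_imp_inverse_le)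
      moreover have "w k y = p k (m y)" "w n y = p n (m y)" using maximal_AE_ext[OF w(2) that(3)] by auto
      moreover have "y \<in> X" using that ext_subset by auto
      ultimately show ?thesis using close[of y k] close[of y n] N by linarith
    qed
    then show "\<exists>N. \<forall>k\<ge>N. \<forall>n\<ge>N. \<forall>y\<in>ext X. \<bar>w k y - w n y\<bar> \<le> e" by blast
  qed
  then obtain u where u: "u \<in> H" "uniform_limit X w u sequentially" by blast
  have "u \<in> M" by (rule M_uniform_limit[OF w(1) u])
  moreover have "maximal_AE (\<lambda>x. u x = \<phi> (m x))"
  proof (rule maximal_AE_mono[OF maximal_AE_all[OF w(2)]])
    fix x assume x: "x \<in> X" "\<forall>n. w n x = p n (m x)"
    have "(\<lambda>n. p n (m x)) \<longlonglongrightarrow> u x" using uniform_limit_pointwise[OF u(2) x(1)] x(2) by simp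
    moreover have "(\<lambda>n. p n (m x)) \<longlonglongrightarrow> \<phi> (m x)"
    proof (rule LIM_zero_cancel, rule Lim_null_comparison[OF _ LIMSEQ_inverse_real_of_nat])
      show "\<forall>\<^sub>F n in sequentially. norm (p n (m x) - \<phi> (m x)) \<le> inverse (real (Suc n))"
        using close[OF x(1)] by (intro always_eventually) (auto simp: abs_minus_commute intro: less_imp_le)
    qed
    ultimately show "u x = \<phi> (m x)" by (rule LIMSEQ_unique)
  qed
  ultimately show ?thesis by blast
qed

end

section \<open>Split faces\<close>

lemma face_convex: "face X A \<Longrightarrow> convex A" and face_extremal: "face X A \<Longrightarrow> extremal X A"
  and face_subset: "face X A \<Longrightarrow> A \<subseteq> X"
  by (auto simp: face_def extremal_def)

lemma complementary_set_subset: "complementary_set X A \<subseteq> X"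
  unfolding complementary_set_def using face_subset by blast

context compact_convex
begin

text \<open>Off \<open>F\<close> an extreme point must lie in the complementary set, since a proper
  decomposition would make it equal to its component in \<open>F\<close>.\<close>

lemma split_function_ext:
  assumes F: "split_face X F" and y: "y \<in> ext X"
  shows "split_function X F y = (if y \<in> F then 1 else 0)"
proof -
  have FX: "F \<subseteq> X" using F face_subset by (auto simp: split_face_def)
  have yX: "y \<in> X" using y by (auto simp: ext_def extreme_point_of_def)
  have "y \<in> complementary_set X F" if "y \<notin> F"
  proof (rule ccontr)
    assume "y \<notin> complementary_set X F"
    then have "\<exists>!p. case p of (l, a, a') \<Rightarrow> split_decomposition X F y l a a'"
      using F that yX unfolding split_face_def by blast
    then obtain p where "case p of (l, a, a') \<Rightarrow> split_decomposition X F y l a a'" by (rule ex1E)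
    then obtain l a a' where "split_decomposition X F y l a a'" by (cases p) auto
    then have "l \<in> {0<..<1}" "a \<in> F" "a' \<in> complementary_set X F" "y = l *\<^sub>R a + (1 - l) *\<^sub>R a'"
      by (auto simp: split_decomposition_def)
    then have "a = y" using FX complementary_set_subset[of X F] by (intro extD[OF y, of a a' l]) auto
    then show False using \<open>a \<in> F\<close> that by simp
  qed
  then show ?thesis using yX by (auto simp: split_function_def)
qed

text \<open>
  In \<open>trunc\<close>, \<open>b n\<close> stands for the product \<open>w\<^sub>n \<cdot> c\<close>; its limits on the two faces force the component
  in \<open>[f = 1]\<close> of a point to be unique.
\<close>

lemma split_face_level_set:
  assumes f: "affine_on X f" "\<And>x. x \<in> X \<Longrightarrow> 0 \<le> f x \<and> f x \<le> 1" "f \<in> extensional X"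
    and decomp: "\<And>x. x \<in> X \<Longrightarrow> 0 < f x \<Longrightarrow> f x < 1 \<Longrightarrow>
      \<exists>b\<in>X. \<exists>c\<in>X. f b = 1 \<and> f c = 0 \<and> x = f x *\<^sub>R b + (1 - f x) *\<^sub>R c"
    and trunc: "\<And>c. c \<in> continuous_affine X \<Longrightarrow> \<exists>b. (\<forall>n::nat. affine_on X (b n)) \<and>
      (\<forall>x\<in>X. f x = 1 \<longrightarrow> (\<lambda>n. b n x) \<longlonglongrightarrow> c x) \<and> (\<forall>x\<in>X. f x = 0 \<longrightarrow> (\<lambda>n. b n x) \<longlonglongrightarrow> 0)"
  shows "split_face X {x \<in> X. f x = 1} \<and> split_function X {x \<in> X. f x = 1} = f"
proof -
  let ?F = "{x \<in> X. f x = 1}" and ?G = "{x \<in> X. f x = 0}"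
  have F: "face X ?F" by (rule face_level_set[OF convex f(1)]) (use f in auto)
  have "affine_on X (\<lambda>x. - f x)" using f(1) by (auto simp: affine_on_def algebra_simps)
  then have "face X {x \<in> X. - f x = 0}" by (rule face_level_set[OF convex]) (use f in auto)
  then have G: "face X ?G" by simp
  \<comment> \<open>A face \<open>B\<close> disjoint from \<open>?F\<close> contains no point with
    \<open>0 < f x < 1\<close>: the component \<open>b\<close> of such a point would lie in
    \<open>B\<close> by extremality and in \<open>?F\<close> by \<open>f b = 1\<close>.\<close>
  have compl: "complementary_set X ?F = ?G"
  proof
    show "?G \<subseteq> complementary_set X ?F" unfolding complementary_set_def using G by auto
    show "complementary_set X ?F \<subseteq> ?G"
      unfolding complementary_set_def
    proof safe
      fix x B assume B: "face X B" "B \<inter> ?F = {}" "x \<in> B"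
      show x: "x \<in> X" using B face_subset by auto
      show "f x = 0"
      proof (rule ccontr)
        assume "f x \<noteq> 0"
        moreover have "f x \<noteq> 1" using B x by auto
        ultimately have "0 < f x" "f x < 1" using f(2)[OF x] by auto
        then obtain b c where bc: "b \<in> X" "c \<in> X" "f b = 1" "x = f x *\<^sub>R b + (1 - f x) *\<^sub>R c"
          using decomp[OF x] by metis
        have "f x *\<^sub>R b + (1 - f x) *\<^sub>R c \<in> B" using bc(4) B(3) by simp
        then have "b \<in> B"
          by (rule extremal_segment_left[OF convex face_extremal[OF B(1)] bc(1,2) \<open>0 < f x\<close> less_imp_le[OF \<open>f x < 1\<close>]])
        then show False using B(2) bc(1,3) by auto
      qed
    qed
  qed
  have level: "l = f x" if "split_decomposition X ?F x l a a'" for x l a a'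
  proof -
    have s: "l \<in> {0<..<1}" "a \<in> ?F" "a' \<in> ?G" "x = l *\<^sub>R a + (1 - l) *\<^sub>R a'"
      using that by (auto simp: split_decomposition_def compl)
    then have "f x = l * f a + (1 - l) * f a'" unfolding s(4) by (intro affine_onD[OF f(1)]) auto
    then show ?thesis using s by simp
  qed
  have ex: "\<exists>a a'. split_decomposition X ?F x (f x) a a'" if x: "x \<in> X - (?F \<union> ?G)" for x
  proof -
    have "0 < f x" "f x < 1" using x f(2)[of x] by auto
    then obtain b c where "b \<in> X" "c \<in> X" "f b = 1" "f c = 0" "x = f x *\<^sub>R b + (1 - f x) *\<^sub>R c"
      using decomp[of x] x by (metis DiffD1)
    then have "split_decomposition X ?F x (f x) b c"
      unfolding split_decomposition_def compl using \<open>0 < f x\<close> \<open>f x < 1\<close> by simp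
    then show ?thesis by blast
  qed
  have unique: "a = b \<and> a' = b'"
    if ab: "split_decomposition X ?F x l a a'" "split_decomposition X ?F x l b b'" for x l a a' b b'
  proof -
    have a: "l \<in> {0<..<1}" "a \<in> X" "f a = 1" "a' \<in> X" "f a' = 0" "x = l *\<^sub>R a + (1 - l) *\<^sub>R a'"
      and b: "b \<in> X" "f b = 1" "b' \<in> X" "f b' = 0" "x = l *\<^sub>R b + (1 - l) *\<^sub>R b'"
      using ab by (auto simp: split_decomposition_def compl)
    have "a = b"
    proof (rule continuous_affine_eqI[OF a(2) b(1)])
      fix c assume "c \<in> continuous_affine X"
      then obtain t where t: "\<And>n::nat. affine_on X (t n)"
        "\<And>x. x \<in> X \<Longrightarrow> f x = 1 \<Longrightarrow> (\<lambda>n. t n x) \<longlonglongrightarrow> c x" "\<And>x. x \<in> X \<Longrightarrow> f x = 0 \<Longrightarrow> (\<lambda>n. t n x) \<longlonglongrightarrow> 0"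
        using trunc by blast
      \<comment> \<open>The component in \<open>?G\<close> drops out in the limit, leaving
        \<open>l\<close> times the value of \<open>c\<close> at the component in \<open>?F\<close>.
        Two decompositions of \<open>x\<close> must give the same limit.\<close>
      have lim: "(\<lambda>n. t n (l *\<^sub>R p + (1 - l) *\<^sub>R q)) \<longlonglongrightarrow> l * c p"
        if "p \<in> X" "f p = 1" "q \<in> X" "f q = 0" for p q
      proof -
        have "t n (l *\<^sub>R p + (1 - l) *\<^sub>R q) = l * t n p + (1 - l) * t n q" for n
          using a(1) that by (intro affine_onD[OF t(1)]) auto
        moreover have "(\<lambda>n. l * t n p + (1 - l) * t n q) \<longlonglongrightarrow> l * c p + (1 - l) * 0"
          by (intro tendsto_intros t that)
        ultimately show ?thesis by simp
      qed
      have "(\<lambda>n. t n x) \<longlonglongrightarrow> l * c a" using lim[OF a(2-5)] a(6) by simp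
      moreover have "(\<lambda>n. t n x) \<longlonglongrightarrow> l * c b" using lim[OF b(1-4)] b(5) by simp
      ultimately have "l * c a = l * c b" by (rule LIMSEQ_unique)
      then show "c a = c b" using a(1) by simp
    qed
    moreover have "(1 - l) *\<^sub>R a' = (1 - l) *\<^sub>R b'" using a(6) b(5) \<open>a = b\<close> by (metis add_left_cancel)
    ultimately show ?thesis using a(1) by simp
  qed
  have "split_face X ?F"
    unfolding split_face_def compl
  proof (intro conjI ballI F face_convex[OF G])
    fix x assume x: "x \<in> X - (?F \<union> ?G)"
    then obtain a a' where a: "split_decomposition X ?F x (f x) a a'" using ex by blast
    show "\<exists>!p. case p of (l, a, a') \<Rightarrow> split_decomposition X ?F x l a a'"
    proof (rule ex1I[of _ "(f x, a, a')"])
      fix p assume "case p of (l, a, a') \<Rightarrow> split_decomposition X ?F x l a a'"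
      then obtain l b b' where p: "p = (l, b, b')" and d: "split_decomposition X ?F x l b b'"
        by (cases p) auto
      have "l = f x" by (rule level[OF d])
      then show "p = (f x, a, a')" using unique[OF a] d p by auto
    qed (use a in simp)
  qed
  moreover have "split_function X ?F = f"
  proof (rule extensionalityI[OF _ f(3)])
    show "split_function X ?F \<in> extensional X" by (simp add: split_function_def)
    fix x assume x: "x \<in> X"
    show "split_function X ?F x = f x"
    proof (cases "x \<in> ?F \<union> ?G")
      case True
      then show ?thesis using x by (auto simp: split_function_def compl)
    next
      case False
      have "(THE l. \<exists>a a'. split_decomposition X ?F x l a a') = f x"
        using ex[of x] x False level by (intro the_equality) auto
      then show ?thesis using x False by (simp add: split_function_def compl)
    qed
  qed
  ultimately show ?thesis by blast
qed

end

section \<open>From a multiplier to a split face\<close>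

context multiplier_space
begin

lemma multiplier_truncations:
  assumes m: "m \<in> M"
  obtains w where "\<And>n::nat. w n \<in> M" "\<And>n. maximal_AE (\<lambda>x. w n x = min 1 (real n * max (m x) 0))"
proof -
  have "\<exists>w\<in>M. maximal_AE (\<lambda>x. w x = min 1 (real n * max (m x) 0))" for n
    by (rule M_continuous[OF m, of "\<lambda>t. min 1 (real n * max t 0)"]) (intro continuous_intros)
  then show thesis using that by metis
qed

lemma truncation_tendsto:
  "(\<lambda>n. min 1 (real n * max t 0)) \<longlonglongrightarrow> (if 0 < t then 1 else 0 :: real)"
proof (cases "0 < t")
  case True
  obtain N where "1 / t < real N" using reals_Archimedean2 by blast
  then have N: "1 < real N * t" using True by (simp add: field_simps)
  have "\<forall>\<^sub>F n in sequentially. min 1 (real n * max t 0) = 1"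
    using eventually_ge_at_top[of N]
  proof eventually_elim
    fix n assume "N \<le> n"
    then have "real N * t \<le> real n * t" using True by (intro mult_right_mono) auto
    then have "1 < real n * t" using N by linarith
    then have "1 \<le> real n * max t 0" using True by simp
    then show "min 1 (real n * max t 0) = 1" by simp
  qed
  then show ?thesis using True by (simp add: tendsto_eventually)
qed simp

theorem multiplier_support_split_face:
  assumes m: "m \<in> M"
  shows "\<exists>F. split_face X F \<and> split_function X F \<in> monotone_limits X M \<and>
    {x \<in> X. m x > 0} \<inter> ext X = F \<inter> ext X"
proof -
  obtain w where w: "\<And>n::nat. w n \<in> M" and wm: "\<And>n. maximal_AE (\<lambda>x. w n x = min 1 (real n * max (m x) 0))"
    using multiplier_truncations[OF m] by blast
  have wH: "w n \<in> H" for n by (rule M_H[OF w])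
  have w_ext: "w n y = min 1 (real n * max (m y) 0)" if "y \<in> ext X" for n y
    by (rule maximal_AE_ext[OF wm that])
  \<comment> \<open>Off \<open>ext X\<close> the \<open>w n\<close> are given by the truncation
    formula only almost everywhere, so order relations on \<open>X\<close> are obtained by
    comparison on \<open>ext X\<close>.\<close>
  have w_mono: "w n x \<le> w (Suc n) x" if "x \<in> X" for n x
  proof -
    have "1 * w n y \<le> 1 * w (Suc n) y + 0" if "y \<in> ext X" for y
    proof -
      have "real n * max (m y) 0 \<le> real (Suc n) * max (m y) 0" by (intro mult_right_mono) auto
      then have "min 1 (real n * max (m y) 0) \<le> min 1 (real (Suc n) * max (m y) 0)"
        by (intro min.mono order_refl)
      then show ?thesis unfolding w_ext[OF that] by simp
    qed
    from H_le[OF wH wH this that] show ?thesis by simp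
  qed
  have w01: "0 \<le> w n x" "w n x \<le> 1" if "x \<in> X" for n x
    using H_le[OF wH[of n] wH[of n], of 0 1 0 x] H_le[OF wH[of n] wH[of n], of 1 0 1 x] that
    by (auto simp: w_ext)
  define f where "f = (\<lambda>x\<in>X. lim (\<lambda>n. w n x))"
  have lim: "(\<lambda>n. w n x) \<longlonglongrightarrow> f x" if x: "x \<in> X" for x
  proof -
    have "incseq (\<lambda>n. w n x)" using w_mono[OF x] by (intro incseq_SucI) auto
    then have "convergent (\<lambda>n. w n x)"
      using w01[OF x] incseq_convergent[of "\<lambda>n. w n x" 1] convergent_def by metis
    then show ?thesis using x by (simp add: f_def convergent_LIMSEQ_iff)
  qed
  have f_lim: "f \<in> monotone_limits X M"
    unfolding monotone_limits_def
    using w w01 w_mono lim by (auto simp: f_def intro!: exI[of _ w] exI[of _ 1])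
  have f_affine: "affine_on X f" by (rule affine_on_limit[OF convex H_affine[OF wH] lim])
  have f01: "0 \<le> f x \<and> f x \<le> 1" if x: "x \<in> X" for x
    using LIMSEQ_le_const[OF lim[OF x], of 0] LIMSEQ_le_const2[OF lim[OF x], of 1] w01[OF x] by auto
  \<comment> \<open>\<open>f\<close> need not belong to \<open>H\<close>, being only a monotone
    limit; dominated convergence still passes strong affinity on to it.\<close>
  have f_sa: "f \<in> strongly_affine X"
    unfolding strongly_affine_def
  proof (intro CollectI conjI ballI)
    show "f \<in> extensional X" by (simp add: f_def)
    fix \<mu> assume \<mu>: "\<mu> \<in> radon_probabilities X"
    have sp: "space \<mu> = X" by (rule radonD[OF \<mu>])
    have wsa: "w n \<in> strongly_affine X" for n using wH strongly_affine by blast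
    note wi = strongly_affineD[OF wsa \<mu>]
    have meas: "f \<in> borel_measurable \<mu>"
      by (rule borel_measurable_LIMSEQ_real[of _ w]) (use lim sp wi in auto)
    show "integrable \<mu> f"
      by (rule radon_bounded_integrable[OF \<mu> meas, of 1]) (use f01 in \<open>auto simp: abs_le_iff intro: order_trans[of _ 0]\<close>)
    have "(\<lambda>n. integral\<^sup>L \<mu> (w n)) \<longlonglongrightarrow> integral\<^sup>L \<mu> f"
    proof (rule integral_dominated_convergence[where w="\<lambda>_. 1"])
      show "AE x in \<mu>. (\<lambda>n. w n x) \<longlonglongrightarrow> f x" using lim sp by auto
      show "AE x in \<mu>. norm (w n x) \<le> 1" for n using w01 sp by auto
      show "integrable \<mu> (\<lambda>_. 1 :: real)" by (rule radon_bounded_integrable[OF \<mu>, of _ 1]) auto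
    qed (use meas wi in auto)
    then have "(\<lambda>n. w n (barycenter X \<mu>)) \<longlonglongrightarrow> integral\<^sup>L \<mu> f" by (simp add: wi)
    then show "integral\<^sup>L \<mu> f = f (barycenter X \<mu>)"
      using LIMSEQ_unique lim[OF barycenter(1)[OF \<mu>]] by blast
  qed
  have f_m: "maximal_AE (\<lambda>x. f x = (if 0 < m x then 1 else 0))"
  proof (rule maximal_AE_mono[OF maximal_AE_all[OF wm]])
    fix x assume x: "x \<in> X" "\<forall>n. w n x = min 1 (real n * max (m x) 0)"
    then have "(\<lambda>n. w n x) \<longlonglongrightarrow> (if 0 < m x then 1 else 0)" using truncation_tendsto[of "m x"] by simp
    then show "f x = (if 0 < m x then 1 else 0)" by (rule LIMSEQ_unique[OF lim[OF x(1)]])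
  qed
  let ?F = "{x \<in> X. f x = 1}"
  have split: "split_face X ?F \<and> split_function X ?F = f"
  proof (rule split_face_level_set[OF f_affine f01])
    show "f \<in> extensional X" by (simp add: f_def)
  next
    fix x assume x: "x \<in> X" "0 < f x" "f x < 1"
    obtain \<mu> where max: "maximal_measure X \<mu>" and bar: "barycenter X \<mu> = x"
      using maximal_measure_exists[OF x(1)] by blast
    note \<mu> = maximal_radon[OF max]
    have sp: "space \<mu> = X" by (rule radonD[OF \<mu>])
    note fi = strongly_affineD[OF f_sa \<mu>]
    have F: "?F \<in> sets \<mu>"
      using borel_measurable_eq[OF borel_measurable_integrable[OF fi(1)] borel_measurable_const, of 1] sp by simp
    have XF: "X - ?F \<in> sets \<mu>" using sets.compl_sets[OF F] sp by simp
    have AE: "AE x in \<mu>. x \<in> X \<longrightarrow> f x = 0 \<or> f x = 1"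
      using maximal_AE_mono[OF f_m, of "\<lambda>x. f x = 0 \<or> f x = 1"] max by (simp add: maximal_AE_def)
    note m1 = borel_measurable_times[OF borel_measurable_indicator[OF F] borel_measurable_integrable[OF fi(1)]]
    note m2 = borel_measurable_times[OF borel_measurable_indicator[OF XF] borel_measurable_integrable[OF fi(1)]]
    have i1: "integral\<^sup>L \<mu> (\<lambda>x. indicator ?F x * f x) = f x"
    proof -
      have "AE y in \<mu>. indicator ?F y * f y = f y"
        using AE AE_space by eventually_elim (auto simp: sp)
      then have "integral\<^sup>L \<mu> (\<lambda>x. indicator ?F x * f x) = integral\<^sup>L \<mu> f"
        by (rule integral_cong_AE[OF m1 borel_measurable_integrable[OF fi(1)]])
      then show ?thesis using fi(2) bar by simp
    qed
    have i2: "integral\<^sup>L \<mu> (\<lambda>x. indicator (X - ?F) x * f x) = 0"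
    proof -
      have "AE y in \<mu>. indicator (X - ?F) y * f y = 0"
        using AE AE_space by eventually_elim (auto simp: sp)
      then have "integral\<^sup>L \<mu> (\<lambda>x. indicator (X - ?F) x * f x) = integral\<^sup>L \<mu> (\<lambda>x. 0)"
        by (rule integral_cong_AE[OF m2 borel_measurable_const])
      then show ?thesis by simp
    qed
    \<comment> \<open>On \<open>?F\<close> the function \<open>f\<close> is 1, and elsewhere it
      vanishes almost everywhere. Hence the weight delivered by \<open>barycenter_split\<close> is
      \<open>f x\<close>, which lies strictly between 0 and 1 as conditioning requires.\<close>
    have p: "measure \<mu> ?F = f x"
    proof -
      have "integral\<^sup>L \<mu> (\<lambda>x. indicator ?F x * f x) = integral\<^sup>L \<mu> (indicator ?F)"
        by (intro Bochner_Integration.integral_cong) (auto simp: indicator_def)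
      then show ?thesis using i1 radon_indicator(2)[OF \<mu> F] by simp
    qed
    obtain b c where bc: "b \<in> X" "c \<in> X" "x = f x *\<^sub>R b + (1 - f x) *\<^sub>R c"
      "f x * f b = f x" "(1 - f x) * f c = 0"
      using barycenter_split[OF \<mu> F] x(2,3) f_sa i1 i2 unfolding p bar by metis
    then have "f b = 1" "f c = 0" using x by simp_all
    then show "\<exists>b\<in>X. \<exists>c\<in>X. f b = 1 \<and> f c = 0 \<and> x = f x *\<^sub>R b + (1 - f x) *\<^sub>R c"
      using bc by metis
  next
    fix c assume c: "c \<in> continuous_affine X"
    then have cH: "c \<in> H" using intermediate by (auto simp: intermediate_function_space_def)
    obtain K where K: "0 < K" "\<forall>x\<in>X. \<bar>c x\<bar> \<le> K" using H_bound[OF cH] by blast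
    have "\<exists>b\<in>H. maximal_AE (\<lambda>x. b x = w n x * c x)" for n using w[of n] cH unfolding M_iff by blast
    then obtain b where b: "\<And>n. b n \<in> H" "\<And>n. maximal_AE (\<lambda>x. b n x = w n x * c x)" by metis
    have b_ext: "b n y = w n y * c y" if "y \<in> ext X" for n y by (rule maximal_AE_ext[OF b(2) that])
    have ext01: "0 \<le> w n y" "w n y \<le> 1" "\<bar>c y\<bar> \<le> K" if "y \<in> ext X" for n y
      using w01[of y n] K(2) that ext_subset by auto
    \<comment> \<open>This bound controls \<open>b n\<close> where \<open>w n\<close> tends to 0,
      the bound \<open>close\<close> where \<open>w n\<close> tends to 1. Both are verified at
      extreme points, where \<open>b n\<close> really is the product.\<close>
    have upper: "\<bar>b n x\<bar> \<le> K * w n x" if x: "x \<in> X" for n x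
    proof -
      have *: "\<bar>b n y\<bar> \<le> K * w n y" if y: "y \<in> ext X" for y
        using ext01[OF y] by (simp add: b_ext[OF y] abs_mult mult_right_mono mult.commute)
      show ?thesis
        using H_le[OF b(1)[of n] wH[of n], of 1 K 0 x] H_le[OF b(1)[of n] wH[of n], of "-1" K 0 x] * x
        by (force simp: abs_le_iff)
    qed
    have close: "\<bar>b n x - c x\<bar> \<le> K - K * w n x" if x: "x \<in> X" for n x
    proof -
      let ?d = "\<lambda>x\<in>X. 1 * b n x + (- 1) * c x"
      have d: "?d \<in> H" by (intro H_lin b cH)
      have *: "\<bar>?d y\<bar> \<le> K - K * w n y" if y: "y \<in> ext X" for y
      proof -
        have "b n y - c y = - ((1 - w n y) * c y)" by (simp add: b_ext[OF y] algebra_simps)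
        then have "\<bar>b n y - c y\<bar> = (1 - w n y) * \<bar>c y\<bar>" using ext01(2)[OF y] by (simp add: abs_mult)
        also have "\<dots> \<le> (1 - w n y) * K" using ext01[OF y] by (intro mult_left_mono) auto
        finally show ?thesis using y ext_subset by (auto simp: algebra_simps)
      qed
      have "1 * ?d x \<le> (- K) * w n x + K" "(-1) * ?d x \<le> (- K) * w n x + K"
        by (rule H_le[OF d wH _ x]; use * in \<open>force simp: abs_le_iff\<close>)+
      then show ?thesis using x by (simp add: abs_le_iff)
    qed
    show "\<exists>b. (\<forall>n. affine_on X (b n)) \<and> (\<forall>x\<in>X. f x = 1 \<longrightarrow> (\<lambda>n. b n x) \<longlonglongrightarrow> c x) \<and>
        (\<forall>x\<in>X. f x = 0 \<longrightarrow> (\<lambda>n. b n x) \<longlonglongrightarrow> 0)"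
    proof (intro exI[of _ b] conjI allI ballI impI)
      show "affine_on X (b n)" for n by (rule H_affine[OF b(1)])
    next
      fix x assume x: "x \<in> X" "f x = 1"
      have "(\<lambda>n. K - K * w n x) \<longlonglongrightarrow> K - K * 1"
        using lim[OF x(1)] x(2) by (intro tendsto_intros) simp
      then have "(\<lambda>n. K - K * w n x) \<longlonglongrightarrow> 0" by simp
      then have "(\<lambda>n. b n x - c x) \<longlonglongrightarrow> 0"
        by (rule Lim_null_comparison[rotated]) (use close[OF x(1)] in auto)
      then show "(\<lambda>n. b n x) \<longlonglongrightarrow> c x" by (rule LIM_zero_cancel)
    next
      fix x assume x: "x \<in> X" "f x = 0"
      have "(\<lambda>n. K * w n x) \<longlonglongrightarrow> K * 0"
        using lim[OF x(1)] x(2) by (intro tendsto_intros) simp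
      then have "(\<lambda>n. K * w n x) \<longlonglongrightarrow> 0" by simp
      then show "(\<lambda>n. b n x) \<longlonglongrightarrow> 0"
        by (rule Lim_null_comparison[rotated]) (use upper[OF x(1)] in auto)
    qed
  qed
  have "{x \<in> X. m x > 0} \<inter> ext X = ?F \<inter> ext X"
    using maximal_AE_ext[OF f_m] by (auto split: if_splits)
  then show ?thesis using split f_lim by metis
qed

section \<open>From a split face to a multiplier\<close>

theorem split_face_multiplier_support:
  assumes F: "split_face X F" and lim: "split_function X F \<in> monotone_limits X M"
  shows "\<exists>m\<in>M. {x \<in> X. m x > 0} \<inter> ext X = F \<inter> ext X"
proof -
  let ?f = "split_function X F"
  obtain h C where h: "\<And>n. h n \<in> M" and C: "\<And>n x. x \<in> X \<Longrightarrow> \<bar>h n x\<bar> \<le> C"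
    and inc: "\<And>n x. x \<in> X \<Longrightarrow> h n x \<le> h (Suc n) x" and hf: "\<And>x. x \<in> X \<Longrightarrow> (\<lambda>n. h n x) \<longlonglongrightarrow> ?f x"
    using lim unfolding monotone_limits_def by blast
  \<comment> \<open>Early \<open>h n\<close> may be negative at points of \<open>F\<close>; without
    positive parts they could cancel later positive values in the sum.\<close>
  have "\<exists>w\<in>M. maximal_AE (\<lambda>x. w x = max (h n x) 0)" for n
    by (rule M_continuous[OF h, of "\<lambda>t. max t 0"]) (intro continuous_intros)
  then obtain w where w: "\<And>n. w n \<in> M" "\<And>n. maximal_AE (\<lambda>x. w n x = max (h n x) 0)" by metis
  have w_ext: "w n y = max (h n y) 0" if "y \<in> ext X" for n y by (rule maximal_AE_ext[OF w(2) that])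
  have wH: "w n \<in> H" for n by (rule M_H[OF w(1)])
  have w0: "0 \<le> w n x" if "x \<in> X" for n x
    using H_le[OF wH[of n] wH[of n], of 0 1 0 x] that by (auto simp: w_ext)
  have wC: "w n x \<le> \<bar>C\<bar>" if x: "x \<in> X" for n x
  proof -
    have "1 * w n y \<le> 0 * w n y + \<bar>C\<bar>" if "y \<in> ext X" for y
      using C[of y n] that ext_subset by (auto simp: w_ext[OF that])
    from H_le[OF wH wH this x] show ?thesis by simp
  qed
  \<comment> \<open>The weights turn the common bound \<open>\<bar>C\<bar>\<close> into a summable
    majorant, so the partial sums converge uniformly and the sum is again a multiplier.\<close>
  let ?g = "\<lambda>k x. (1/2) ^ k * w k x"
  define s where "s n = (\<lambda>x\<in>X. \<Sum>k<n. ?g k x)" for n :: nat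
  have sM: "s n \<in> M" for n
  proof (induction n)
    case 0
    have "s 0 = (\<lambda>x\<in>X. 0)" by (rule ext) (simp add: s_def)
    then show ?case using M_const[of 0] by (simp only:)
  next
    case (Suc n)
    have "s (Suc n) = (\<lambda>x\<in>X. 1 * s n x + (1/2)^n * w n x)" by (rule ext) (simp add: s_def)
    then show ?case using M_lin[OF Suc w(1)[of n], of 1 "(1/2)^n"] by (simp only:)
  qed
  have summable: "summable (\<lambda>k. (1/2) ^ k * \<bar>C\<bar>)" by (intro summable_mult2 summable_geometric) auto
  have bound: "norm (?g k x) \<le> (1/2) ^ k * \<bar>C\<bar>" if "x \<in> X" for k x
    using w0[OF that, of k] wC[OF that, of k] by (simp add: abs_mult)
  have ul: "uniform_limit X (\<lambda>n x. \<Sum>k<n. ?g k x) (\<lambda>x. \<Sum>k. ?g k x) sequentially"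
    by (rule Weierstrass_m_test[OF bound summable])
  define m where "m = (\<lambda>x\<in>X. \<Sum>k. ?g k x)"
  have um: "uniform_limit X s m sequentially"
    using ul by (simp add: s_def m_def cong: uniform_limit_cong')
  have "restrict m X \<in> H" by (rule H_uniform_limit[OF M_H[OF sM] um])
  then have "m \<in> H" by (simp add: m_def)
  then have mM: "m \<in> M" by (rule M_uniform_limit[OF sM _ um])
  have pos: "0 < m y \<longleftrightarrow> y \<in> F" if y: "y \<in> ext X" for y
  proof -
    have yX: "y \<in> X" using y ext_subset by auto
    have sg: "summable (\<lambda>k. ?g k y)" by (rule summable_comparison_test'[OF summable bound[OF yX]])
    have iff: "0 < m y \<longleftrightarrow> (\<exists>k. 0 < w k y)"
      using suminf_pos_iff[OF sg] w0[OF yX] yX by (simp add: m_def zero_less_mult_iff)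
    show ?thesis
    proof (cases "y \<in> F")
      case True
      then have "(\<lambda>n. h n y) \<longlonglongrightarrow> 1" using hf[OF yX] split_function_ext[OF F y] by simp
      then have "\<forall>\<^sub>F n in sequentially. 0 < h n y" by (rule order_tendstoD) simp
      then obtain n where "0 < h n y" by (auto simp: eventually_sequentially)
      then have "0 < w n y" using w_ext[OF y, of n] by simp
      then show ?thesis using True iff by blast
    next
      case False
      then have l0: "(\<lambda>n. h n y) \<longlonglongrightarrow> 0" using hf[OF yX] split_function_ext[OF F y] by simp
      \<comment> \<open>An increasing sequence with limit 0 stays nonpositive, so every positive
        part \<open>w n y\<close> vanishes off \<open>F\<close>.\<close>
      have "incseq (\<lambda>n. h n y)" using inc[OF yX] by (intro incseq_SucI) auto
      then have "h n y \<le> 0" for n using incseq_le[OF _ l0] by blast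
      then show ?thesis using False iff w_ext[OF y] by auto
    qed
  qed
  have "{x \<in> X. m x > 0} \<inter> ext X = F \<inter> ext X" using pos ext_subset by auto
  then show ?thesis using mM by blast
qed

end

theorem theorem9p1:
  fixes X :: "'a::locally_convex_space set" and H :: "('a \<Rightarrow> real) set"
  assumes "compact X" and "convex X"
    and "intermediate_function_space X H"
    and "H \<subseteq> strongly_affine X"
    and "determined_by_extreme_points X (monotone_limits X H)"
  shows "strong_multiplier_sets X H =
    {F \<inter> ext X | F. split_face X F \<and>
      split_function X F \<in> monotone_limits X (strong_multipliers X H)}"
proof -
  interpret multiplier_space X H using assms by unfold_locales
  show ?thesis
    unfolding strong_multiplier_sets_def
  proof (intro equalityI subsetI)
    fix A assume "A \<in> {{x \<in> X. m x > 0} \<inter> ext X | m. m \<in> M}"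
    then obtain m where m: "m \<in> M" "A = {x \<in> X. m x > 0} \<inter> ext X" by blast
    then obtain F where "split_face X F" "split_function X F \<in> monotone_limits X M" "A = F \<inter> ext X"
      using multiplier_support_split_face[OF m(1)] by auto
    then show "A \<in> {F \<inter> ext X | F. split_face X F \<and> split_function X F \<in> monotone_limits X M}" by blast
  next
    fix A assume "A \<in> {F \<inter> ext X | F. split_face X F \<and> split_function X F \<in> monotone_limits X M}"
    then obtain F where F: "split_face X F" "split_function X F \<in> monotone_limits X M" "A = F \<inter> ext X" by blast
    then obtain m where "m \<in> M" "A = {x \<in> X. m x > 0} \<inter> ext X"
      using split_face_multiplier_support[OF F(1,2)] by auto
    then show "A \<in> {{x \<in> X. m x > 0} \<inter> ext X | m. m \<in> M}" by blast
  qed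
qed

end
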